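(* Let $G=(V,E)$ be a finite simple graph with $V=\{1,\dots,n\}$, $n\ge 1$, and let $k$ be a field. Assume that $V$ is a disjoint union of two non-empty subsets $V_1,V_2$ such that $G$ contains the complete bipartite graph with bipartition $V_1\cup V_2$ as a subgraph (that is, $\{u,v\}\in E$ for all $u\in V_1$, $v\in V_2$). Then the function $s\mapsto \operatorname{reg} I(G)^s$, $s\ge 1$, is strictly increasing.
   Context: The edge ideal of $G$ is the monomial ideal $I(G)=(x_ix_j:\{i,j\}\in E)\subseteq k[x_1,\dots,x_n]$, where $k[x_1,\dots,x_n]$ is standard graded. $\operatorname{reg}$ denotes Castelnuovo–Mumford regularity: $\operatorname{reg} M=\sup\{j-i:\operatorname{Tor}^{Q}_i(k,M)_j\ne 0\}$ with $Q=k[x_1,\dots,x_n]$. *)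

theory Defs
  imports
    "HOL-Library.Poly_Mapping"
    "HOL-Library.Extended_Real"
    "HOL-Algebra.Coset"
    "Jordan_Normal_Form.Matrix"
begin

text \<open>
  Commutative algebra over the polynomial ring \<open>Q = k[x\<^sub>v : v \<in> V]\<close>. The vertex set \<open>V\<close> is the
  universe of a finite type \<open>'v\<close>; a monomial is its exponent vector and \<open>Q\<close> carries the
  convolution product of \<open>Poly_Mapping\<close>.
\<close>

type_synonym ('v, 'k) mpoly = "('v \<Rightarrow>\<^sub>0 nat) \<Rightarrow>\<^sub>0 'k"

definition var :: "'v \<Rightarrow> ('v, 'k::field) mpoly" where
  "var v = Poly_Mapping.single (Poly_Mapping.single v 1) 1"

definition mono_degree :: "('v::finite \<Rightarrow>\<^sub>0 nat) \<Rightarrow> nat" where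
  "mono_degree m = (\<Sum>v\<in>UNIV. Poly_Mapping.lookup m v)"

definition homogeneous :: "int \<Rightarrow> ('v::finite, 'k::field) mpoly set" where
  "homogeneous j = {p. \<forall>m\<in>Poly_Mapping.keys p. int (mono_degree m) = j}"

definition const_coeff :: "('v, 'k::field) mpoly \<Rightarrow> 'k" where
  "const_coeff p = Poly_Mapping.lookup p 0"

definition ideal_span :: "('v, 'k::field) mpoly set \<Rightarrow> ('v, 'k) mpoly set" where
  "ideal_span S = module.span (*) S"

primrec ideal_power :: "('v, 'k::field) mpoly set \<Rightarrow> nat \<Rightarrow> ('v, 'k) mpoly set" where
  "ideal_power I 0 = UNIV"
| "ideal_power I (Suc s) = ideal_span {a * b | a b. a \<in> I \<and> b \<in> ideal_power I s}"

definition edge_ideal :: "'v set set \<Rightarrow> ('v, 'k::field) mpoly set" where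
  "edge_ideal E = ideal_span {var i * var j | i j. {i, j} \<in> E}"

text \<open>
  A complex of graded free modules of finite rank with an augmentation to \<open>k = Q/\<mm>\<close>:
  \<open>F\<^sub>p = \<Oplus>\<^sub>a Q(- twist F p a)\<close> with \<open>a\<close> ranging over \<open>{..<rank F p}\<close>, and \<open>diff F p\<close> is the
  matrix of the differential \<open>F\<^bsub>p+1\<^esub> \<rightarrow> F\<^sub>p\<close>. The augmentation is the \<open>Q\<close>-linear map
  \<open>F\<^sub>0 \<rightarrow> k\<close> sending the \<open>a\<close>-th basis element to \<open>aug F $ a\<close>; since \<open>Q\<close> acts on \<open>k\<close> through
  constant coefficients, it is given by \<open>augmentation\<close> below.
\<close>

record (overloaded) ('v, 'k) free_complex =
  rank :: "nat \<Rightarrow> nat"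
  twist :: "nat \<Rightarrow> nat \<Rightarrow> int"
  diff :: "nat \<Rightarrow> ('v, 'k) mpoly mat"
  aug :: "'k vec"

definition augmentation ::
    "('v, 'k::field) free_complex \<Rightarrow> ('v, 'k) mpoly vec \<Rightarrow> 'k" where
  "augmentation F x = aug F \<bullet> map_vec const_coeff x"

text \<open>The last three conditions say that \<open>\<dots> \<rightarrow> F\<^sub>1 \<rightarrow> F\<^sub>0 \<rightarrow> k \<rightarrow> 0\<close> is exact. The two
  conditions before them say that the differentials and the augmentation are homogeneous
  of degree 0, where \<open>k\<close> sits in degree 0.\<close>

definition graded_free_resolution :: "('v::finite, 'k::field) free_complex \<Rightarrow> bool" where
  "graded_free_resolution F \<longleftrightarrow>
     (\<forall>p. diff F p \<in> carrier_mat (rank F p) (rank F (Suc p))) \<and>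
     aug F \<in> carrier_vec (rank F 0) \<and>
     (\<forall>p. \<forall>a<rank F p. \<forall>b<rank F (Suc p).
        diff F p $$ (a, b) \<in> homogeneous (twist F (Suc p) b - twist F p a)) \<and>
     (\<forall>a<rank F 0. aug F $ a \<noteq> 0 \<longrightarrow> twist F 0 a = 0) \<and>
     augmentation F ` carrier_vec (rank F 0) = UNIV \<and>
     {x \<in> carrier_vec (rank F 0). augmentation F x = 0}
       = (\<lambda>y. diff F 0 *\<^sub>v y) ` carrier_vec (rank F 1) \<and>
     (\<forall>p. {x \<in> carrier_vec (rank F (Suc p)). diff F p *\<^sub>v x = 0\<^sub>v (rank F p)}
       = (\<lambda>y. diff F (Suc p) *\<^sub>v y) ` carrier_vec (rank F (Suc (Suc p))))"

text \<open>A fixed graded free resolution of \<open>k\<close>; up to isomorphism \<open>Tor\<close> does not depend on it.\<close>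

definition residue_resolution :: "('v::finite, 'k::field) free_complex" where
  "residue_resolution = (SOME F. graded_free_resolution F)"

text \<open>\<open>(F\<^sub>p \<otimes>\<^sub>Q M)\<^sub>j\<close> for a homogeneous ideal \<open>M\<close>, under the canonical isomorphism
  \<open>F\<^sub>p \<otimes>\<^sub>Q M \<cong> \<Oplus>\<^sub>a M(- twist F p a)\<close>; the differential is again multiplication by \<open>diff F\<close>.\<close>

definition tensor_component ::
    "('v::finite, 'k::field) free_complex \<Rightarrow> ('v, 'k) mpoly set \<Rightarrow> nat \<Rightarrow> int
      \<Rightarrow> ('v, 'k) mpoly vec set" where
  "tensor_component F M p j =
     {x \<in> carrier_vec (rank F p). \<forall>a<rank F p. x $ a \<in> M \<inter> homogeneous (j - twist F p a)}"

definition tensor_cycles ::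
    "('v::finite, 'k::field) free_complex \<Rightarrow> ('v, 'k) mpoly set \<Rightarrow> nat \<Rightarrow> int
      \<Rightarrow> ('v, 'k) mpoly vec set" where
  "tensor_cycles F M i j =
     {x \<in> tensor_component F M i j. \<forall>p. i = Suc p \<longrightarrow> diff F p *\<^sub>v x = 0\<^sub>v (rank F p)}"

definition tensor_boundaries ::
    "('v::finite, 'k::field) free_complex \<Rightarrow> ('v, 'k) mpoly set \<Rightarrow> nat \<Rightarrow> int
      \<Rightarrow> ('v, 'k) mpoly vec set" where
  "tensor_boundaries F M i j = (\<lambda>y. diff F i *\<^sub>v y) ` tensor_component F M (Suc i) j"

definition homology_group ::
    "('v::finite, 'k::field) free_complex \<Rightarrow> ('v, 'k) mpoly set \<Rightarrow> nat \<Rightarrow> int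
      \<Rightarrow> ('v, 'k) mpoly vec set monoid" where
  "homology_group F M i j =
     \<lparr>carrier = tensor_cycles F M i j, monoid.mult = (+), one = 0\<^sub>v (rank F i)\<rparr>
       Mod tensor_boundaries F M i j"

text \<open>The additive group of \<open>Tor\<^sup>Q\<^sub>i(k, M)\<^sub>j\<close>.\<close>

definition Tor :: "('v::finite, 'k::field) mpoly set \<Rightarrow> nat \<Rightarrow> int
      \<Rightarrow> ('v, 'k) mpoly vec set monoid" where
  "Tor M i j = homology_group residue_resolution M i j"

text \<open>The supremum is taken in the extended reals, so that \<open>reg {0} = -\<infinity>\<close>.\<close>

definition reg :: "('v::finite, 'k::field) mpoly set \<Rightarrow> ereal" where
  "reg M = Sup {ereal (real_of_int (j - int i)) | i j. carrier (Tor M i j) \<noteq> {\<one>\<^bsub>Tor M i j\<^esub>}}"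

end

theory Submission
  imports Defs
begin

text \<open>
  Multidegree by multidegree, \<open>Tor\<^sub>i(k, J)\<close> of a monomial ideal \<open>J\<close> is the cohomology of
  a finite complex whose cochains are supported on a family of subsets of \<open>V\<close> that is closed under
  supersets: in multidegree \<open>b\<close>, the sets \<open>\<sigma>\<close> such that the monomial with exponent
  \<open>b - 1\<close> outside \<open>\<sigma>\<close> and \<open>b\<close> on \<open>\<sigma>\<close> is in
  \<open>J\<close>. The local cohomology of \<open>J\<close> in degree \<open>a\<close> has the same form, with the
  sets \<open>\<sigma>\<close> such that the monomial with exponent \<open>a\<close> lies in \<open>J\<close> once the
  variables in \<open>\<sigma>\<close> are inverted. Both are cases of one construction, in which every variable has a
  lower and an upper exponent, and where a large \<open>N\<close> stands for an infinite exponent. Cutting the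
  interval of one variable in two gives an exact triangle (\<open>family_triangle\<close>). With it the variables are
  switched one at a time from the Koszul to the Cech position, and neither \<open>koszul_value_imp_cech_value\<close>
  nor \<open>cech_value_le_koszul_value\<close> lowers the number that enters the regularity. This is an elementary
  form of the fact that \<open>Tor\<close> and local cohomology give the same regularity.

  The graph enters on the side of local cohomology. For an exponent \<open>a \<ge> 0\<close>, the sets
  \<open>\<sigma>\<close> such that the monomial is not in the localized power \<open>I\<^sup>s\<close> form a
  simplicial complex, the degree complex. Inverting a vertex of \<open>V1\<close> and one of \<open>V2\<close> inverts
  an edge, so each face lies in \<open>V1\<close> or in \<open>V2\<close>. Let \<open>y \<in> V2\<close>. Where a
  vertex of \<open>V1\<close> is inverted, the localized \<open>I\<close> contains \<open>y\<close>, and therefore a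
  monomial is in \<open>I\<^sup>s\<close> iff its product with \<open>y\<close> is in
  \<open>I\<^sup>s\<^sup>+\<^sup>1\<close> (\<open>power_exponent_localized_shift\<close>). Hence the passage from
  \<open>(a, s)\<close> to \<open>(a + y, s + 1)\<close> does not change the nonempty faces in \<open>V1\<close> and
  can only add faces in \<open>V2\<close>. A class that is visible on \<open>V1\<close> survives, and its degree goes
  up by one; a class visible on \<open>V2\<close> is shifted by a vertex of \<open>V1\<close> instead. The class that
  separates the two parts survives because both remain nonempty. What is left is the class of the empty face, for a
  monomial in the saturation of \<open>I\<^sup>s\<close> that is not in \<open>I\<^sup>s\<close>. If its degree is
  below \<open>2 s\<close>, multiplication by an edge works, because the product has too small a degree for
  \<open>I\<^sup>s\<^sup>+\<^sup>1\<close>. Otherwise its degree on one side exceeds \<open>s\<close>, and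
  multiplication by a vertex of the other side works. If \<open>a\<close> has negative exponents on one side only,
  shifting by a vertex of the other side does not change the family at all, and negative exponents on both sides
  contribute only numbers that are at most 0. This gives \<open>koszul_step\<close>: every number for
  \<open>I\<^sup>s\<close> is exceeded by one for \<open>I\<^sup>s\<^sup>+\<^sup>1\<close>.

  \<open>Tor\<close> is defined with an arbitrary graded free resolution of \<open>k\<close>. The Koszul complex is one
  (\<open>koszul_resolution\<close>), and \<open>tensor_homology_vanishes_transfer\<close> shows by chain maps and
  homotopies that every resolution leads to the same vanishing. As the values are integers bounded above, the
  regularity of \<open>I\<^sup>s\<close> is attained, and the strict inequality follows.
\<close>

section \<open>Cochains on families of subsets\<close>

text \<open>An arbitrary linear order of the vertices; it only serves to fix the signs of the coboundary.\<close>

definition vertex_index :: "'v::finite \<Rightarrow> nat" where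
  "vertex_index = (SOME f. inj f)"

lemma inj_vertex_index: "inj (vertex_index :: 'v::finite \<Rightarrow> nat)"
proof -
  have "\<exists>f :: 'v \<Rightarrow> nat. inj f" using finite_imp_inj_to_nat_seg[of "UNIV :: 'v set"] by auto
  then show ?thesis unfolding vertex_index_def by (rule someI_ex)
qed

lemma vertex_index_less_iff: "v \<noteq> w \<Longrightarrow> \<not> vertex_index v < vertex_index w \<longleftrightarrow> vertex_index w < vertex_index v"
  using inj_vertex_index by (metis injD linorder_neqE_nat order_less_asym)

definition face_sign :: "'v::finite \<Rightarrow> 'v set \<Rightarrow> 'k::comm_ring_1" where
  "face_sign v \<sigma> = (-1) ^ card {w \<in> \<sigma>. vertex_index w < vertex_index v}"

text \<open>The coboundary of the full simplex on \<open>V\<close>, augmented by the empty face. Cohomological degree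
  is the number of vertices.\<close>

definition coboundary :: "('v::finite set \<Rightarrow> 'k::comm_ring_1) \<Rightarrow> 'v set \<Rightarrow> 'k" where
  "coboundary z \<sigma> = (\<Sum>v\<in>\<sigma>. face_sign v \<sigma> * z (\<sigma> - {v}))"

text \<open>The cone construction with apex \<open>v\<close>.\<close>

definition contraction :: "'v::finite \<Rightarrow> ('v set \<Rightarrow> 'k::comm_ring_1) \<Rightarrow> 'v set \<Rightarrow> 'k" where
  "contraction v z \<sigma> = (if v \<in> \<sigma> then 0 else face_sign v \<sigma> * z (insert v \<sigma>))"

lemma face_sign_square [simp]: "face_sign v \<sigma> * face_sign v \<sigma> = (1 :: 'k::comm_ring_1)"
  by (simp add: face_sign_def flip: power_add mult_2)

lemma face_sign_square_left [simp]: "face_sign v \<sigma> * (face_sign v \<sigma> * x) = (x :: 'k::comm_ring_1)"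
  by (simp flip: mult.assoc)

lemma face_sign_insert:
  assumes "w \<notin> \<sigma>"
  shows "face_sign v (insert w \<sigma>) =
    (if vertex_index w < vertex_index v then - face_sign v \<sigma> else (face_sign v \<sigma> :: 'k::comm_ring_1))"
proof -
  have "{x \<in> insert w \<sigma>. vertex_index x < vertex_index v} =
    (if vertex_index w < vertex_index v then insert w {x \<in> \<sigma>. vertex_index x < vertex_index v}
     else {x \<in> \<sigma>. vertex_index x < vertex_index v})" by auto
  then show ?thesis using assms by (simp add: face_sign_def)
qed

lemma face_sign_insert_self [simp]: "face_sign v (insert v \<sigma>) = (face_sign v \<sigma> :: 'k::comm_ring_1)"
  by (cases "v \<in> \<sigma>") (simp_all add: insert_absorb face_sign_insert)

lemma face_sign_remove_self [simp]: "face_sign v (\<sigma> - {v}) = (face_sign v \<sigma> :: 'k::comm_ring_1)"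
  by (metis face_sign_insert_self insert_Diff_single)

lemma face_sign_exchange:
  assumes "v \<notin> \<sigma>" "w \<in> \<sigma>"
  shows "face_sign w \<sigma> * face_sign v (\<sigma> - {w}) = - (face_sign v \<sigma> * face_sign w (insert v \<sigma>) :: 'k::comm_ring_1)"
proof -
  have vw: "v \<noteq> w" using assms by auto
  have "face_sign v \<sigma> = (if vertex_index w < vertex_index v then - face_sign v (\<sigma> - {w}) else (face_sign v (\<sigma> - {w}) :: 'k))"
    using face_sign_insert[of w "\<sigma> - {w}" v] assms(2) by (simp add: insert_absorb)
  moreover have "face_sign w (insert v \<sigma>) = (if vertex_index v < vertex_index w then - face_sign w \<sigma> else (face_sign w \<sigma> :: 'k))"
    using face_sign_insert[OF assms(1)] .
  ultimately show ?thesis using vertex_index_less_iff[OF vw]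
    by (auto simp: mult.commute)
qed

text \<open>The homotopy that contracts the full simplex onto \<open>v\<close>. Because it holds for functions on all
  subsets, it replaces explicit sign computations in everything that follows.\<close>

lemma contraction_homotopy:
  "coboundary (contraction v z) \<sigma> + contraction v (coboundary z) \<sigma> = (z \<sigma> :: 'k::comm_ring_1)"
proof (cases "v \<in> \<sigma>")
  case True
  have "coboundary (contraction v z) \<sigma> = (\<Sum>w\<in>{v}. face_sign w \<sigma> * contraction v z (\<sigma> - {w}))"
    unfolding coboundary_def by (rule sum.mono_neutral_right) (use True in \<open>auto simp: contraction_def\<close>)
  also have "\<dots> = z \<sigma>" using True by (simp add: contraction_def insert_absorb)
  finally show ?thesis using True by (simp add: contraction_def)
next
  case False
  have "contraction v (coboundary z) \<sigma>
      = face_sign v \<sigma> * (face_sign v \<sigma> * z \<sigma> + (\<Sum>w\<in>\<sigma>. face_sign w (insert v \<sigma>) * z (insert v \<sigma> - {w})))"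
    using False by (simp add: contraction_def coboundary_def)
  also have "\<dots> = z \<sigma> + (\<Sum>w\<in>\<sigma>. (face_sign v \<sigma> * face_sign w (insert v \<sigma>)) * z (insert v \<sigma> - {w}))"
    by (simp add: distrib_left sum_distrib_left mult.assoc)
  finally have 1: "contraction v (coboundary z) \<sigma> = \<dots>" .
  have "coboundary (contraction v z) \<sigma> = (\<Sum>w\<in>\<sigma>. (face_sign w \<sigma> * face_sign v (\<sigma> - {w})) * z (insert v (\<sigma> - {w})))"
    using False by (simp add: coboundary_def contraction_def mult.assoc)
  also have "\<dots> = (\<Sum>w\<in>\<sigma>. - ((face_sign v \<sigma> * face_sign w (insert v \<sigma>)) * z (insert v \<sigma> - {w})))"
  proof (rule sum.cong[OF refl])
    fix w assume w: "w \<in> \<sigma>"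
    then have "insert v (\<sigma> - {w}) = insert v \<sigma> - {w}" using False by auto
    then show "(face_sign w \<sigma> * face_sign v (\<sigma> - {w})) * z (insert v (\<sigma> - {w})) =
       - ((face_sign v \<sigma> * face_sign w (insert v \<sigma>)) * z (insert v \<sigma> - {w}))"
      using face_sign_exchange[OF False w, where 'k='k] by simp
  qed
  finally show ?thesis using 1 by (simp add: sum_negf)
qed

lemma coboundary_add: "coboundary (\<lambda>\<sigma>. f \<sigma> + g \<sigma>) = (\<lambda>\<sigma>. coboundary f \<sigma> + (coboundary g \<sigma> :: 'k::comm_ring_1))"
  by (rule ext) (simp add: coboundary_def algebra_simps sum.distrib)

lemma coboundary_diff: "coboundary (\<lambda>\<sigma>. f \<sigma> - g \<sigma>) = (\<lambda>\<sigma>. coboundary f \<sigma> - (coboundary g \<sigma> :: 'k::comm_ring_1))"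
  by (rule ext) (simp add: coboundary_def algebra_simps sum_subtractf)

lemma coboundary_zero [simp]: "coboundary (\<lambda>\<sigma>. 0) = (\<lambda>\<sigma>. 0 :: 'k::comm_ring_1)"
  by (rule ext) (simp add: coboundary_def)

lemma coboundary_contraction:
  "coboundary (contraction v z) = (\<lambda>\<sigma>. z \<sigma> - (contraction v (coboundary z) \<sigma> :: 'k::comm_ring_1))"
  using contraction_homotopy[of v z] by (auto simp: fun_eq_iff algebra_simps)

lemma contraction_diff: "contraction v (\<lambda>\<sigma>. f \<sigma> - g \<sigma>) = (\<lambda>\<sigma>. contraction v f \<sigma> - (contraction v g \<sigma> :: 'k::comm_ring_1))"
  by (rule ext) (simp add: contraction_def algebra_simps)

text \<open>By the homotopy formula, the square of the coboundary commutes with every \<open>contraction v\<close>, so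
  its value at \<open>insert v \<tau>\<close> is determined by a value at \<open>\<tau>\<close>; induction on the face
  then works in every characteristic.\<close>

lemma coboundary_coboundary: "coboundary (coboundary z) = (\<lambda>\<sigma>. 0 :: 'k::comm_ring_1)"
proof
  fix \<sigma> :: "'a set"
  have "finite \<sigma>" by simp
  then show "coboundary (coboundary z) \<sigma> = 0"
  proof (induction \<sigma> arbitrary: z)
    case empty
    then show ?case by (simp add: coboundary_def)
  next
    case (insert v \<tau>)
    \<comment> \<open>The induction hypothesis is applied to \<open>contraction v z\<close> at \<open>\<tau>\<close>.\<close>
    have "coboundary (coboundary (contraction v z)) = contraction v (coboundary (coboundary z))"
      by (simp add: coboundary_contraction coboundary_diff contraction_diff)
    then have "contraction v (coboundary (coboundary z)) \<tau> = 0" using insert.IH by metis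
    then have "face_sign v \<tau> * (face_sign v \<tau> * coboundary (coboundary z) (insert v \<tau>)) = 0"
      using insert.hyps by (simp add: contraction_def)
    then show ?case by simp
  qed
qed

definition up_closed :: "'v set set \<Rightarrow> bool" where
  "up_closed S \<longleftrightarrow> (\<forall>\<sigma>\<in>S. \<forall>\<tau>. \<sigma> \<subseteq> \<tau> \<longrightarrow> \<tau> \<in> S)"

text \<open>The coboundary moves upwards, so the cochains supported on an up-closed family \<open>S\<close> form a
  complex. The degree is an integer, which makes \<open>m - 1\<close> meaningful for \<open>m = 0\<close>.\<close>

definition cochains :: "'v set set \<Rightarrow> int \<Rightarrow> ('v::finite set \<Rightarrow> 'k::comm_ring_1) set" where
  "cochains S m = {z. \<forall>\<sigma>. z \<sigma> \<noteq> 0 \<longrightarrow> \<sigma> \<in> S \<and> int (card \<sigma>) = m}"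

text \<open>The complexes are finite-dimensional over a field and only the vanishing of their cohomology matters, so
  no quotient space is formed. The argument \<open>K\<close> only carries the type of the field.\<close>

definition cohomology_nonzero :: "'k::field itself \<Rightarrow> 'v::finite set set \<Rightarrow> int \<Rightarrow> bool" where
  "cohomology_nonzero K S m \<longleftrightarrow>
    (\<exists>z \<in> cochains S m. coboundary z = (\<lambda>\<sigma>. 0 :: 'k) \<and> z \<notin> coboundary ` cochains S (m - 1))"

lemma up_closedD: "up_closed S \<Longrightarrow> \<sigma> \<in> S \<Longrightarrow> \<sigma> \<subseteq> \<tau> \<Longrightarrow> \<tau> \<in> S"
  by (auto simp: up_closed_def)

lemma cochains_add: "f \<in> cochains S m \<Longrightarrow> g \<in> cochains S m \<Longrightarrow> (\<lambda>\<sigma>. f \<sigma> + g \<sigma>) \<in> cochains S m"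
  by (force simp: cochains_def)

lemma cochains_diff: "f \<in> cochains S m \<Longrightarrow> g \<in> cochains S m \<Longrightarrow> (\<lambda>\<sigma>. f \<sigma> - g \<sigma>) \<in> cochains S m"
  by (force simp: cochains_def)

lemma cochainsD: "z \<in> cochains S m \<Longrightarrow> z \<sigma> \<noteq> 0 \<Longrightarrow> \<sigma> \<in> S \<and> int (card \<sigma>) = m"
  by (auto simp: cochains_def)

lemma cohomology_nonzero_face:
  assumes "cohomology_nonzero (K :: 'k::field itself) S m"
  obtains \<sigma> where "\<sigma> \<in> S" "m = int (card \<sigma>)"
proof -
  obtain z :: "'a set \<Rightarrow> 'k" where z: "z \<in> cochains S m" "z \<notin> coboundary ` cochains S (m - 1)"
    using assms by (auto simp: cohomology_nonzero_def)
  have "(\<lambda>\<sigma>. 0) \<in> coboundary ` cochains S (m - 1)"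
    by (rule image_eqI[of _ _ "\<lambda>\<sigma>. 0"]) (auto simp: cochains_def)
  then have "z \<noteq> (\<lambda>\<sigma>. 0)" using z by metis
  then obtain \<sigma> where "z \<sigma> \<noteq> 0" by auto
  then show ?thesis using cochainsD[OF z(1)] that by metis
qed

lemma coboundary_nonzeroE:
  fixes z :: "'v::finite set \<Rightarrow> 'k::comm_ring_1"
  assumes "coboundary z \<sigma> \<noteq> 0"
  obtains v where "v \<in> \<sigma>" "z (\<sigma> - {v}) \<noteq> 0"
proof -
  have "\<exists>v\<in>\<sigma>. z (\<sigma> - {v}) \<noteq> 0"
  proof (rule ccontr)
    assume "\<not> ?thesis"
    then have "coboundary z \<sigma> = 0" unfolding coboundary_def by (intro sum.neutral) auto
    then show False using assms by simp
  qed
  then show ?thesis using that by blast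
qed

lemma card_remove_int:
  fixes \<sigma> :: "'v::finite set"
  shows "v \<in> \<sigma> \<Longrightarrow> int (card (\<sigma> - {v})) = int (card \<sigma>) - 1"
  by (subst card.remove[of \<sigma> v]) auto

lemma coboundary_in_cochains:
  assumes "up_closed S" "z \<in> cochains S m"
  shows "coboundary z \<in> cochains S (m + 1)"
  unfolding cochains_def
proof (safe)
  fix \<sigma> assume "coboundary z \<sigma> \<noteq> 0"
  then obtain v where v: "v \<in> \<sigma>" "z (\<sigma> - {v}) \<noteq> 0" by (rule coboundary_nonzeroE)
  then show "\<sigma> \<in> S" "int (card \<sigma>) = m + 1"
    using cochainsD[OF assms(2) v(2)] up_closedD[OF assms(1)] card_remove_int[OF v(1)] by auto
qed

lemma contraction_in_cochains:
  assumes "z \<in> cochains S m" "\<And>\<sigma>. v \<notin> \<sigma> \<Longrightarrow> insert v \<sigma> \<in> S \<Longrightarrow> \<sigma> \<in> T"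
  shows "contraction v z \<in> cochains T (m - 1)"
  unfolding cochains_def
proof (safe)
  fix \<sigma> assume "contraction v z \<sigma> \<noteq> 0"
  then have v: "v \<notin> \<sigma>" "z (insert v \<sigma>) \<noteq> 0" by (auto simp: contraction_def split: if_splits)
  then show "\<sigma> \<in> T" "int (card \<sigma>) = m - 1"
    using cochainsD[OF assms(1) v(2)] assms(2) by auto
qed

lemma coboundary_contraction_cocycle:
  "coboundary z = (\<lambda>\<sigma>. 0) \<Longrightarrow> coboundary (contraction v z) = (z :: 'v::finite set \<Rightarrow> 'k::comm_ring_1)"
  by (simp add: coboundary_contraction contraction_def fun_eq_iff)

text \<open>A family that is a cone with apex \<open>v\<close> is acyclic: contraction stays inside it.\<close>

lemma cohomology_cone_zero:
  assumes "\<And>\<sigma>. v \<notin> \<sigma> \<Longrightarrow> insert v \<sigma> \<in> S \<Longrightarrow> \<sigma> \<in> S"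
  shows "\<not> cohomology_nonzero K S m"
  unfolding cohomology_nonzero_def
  using contraction_in_cochains[where S = S and T = S and v = v, OF _ assms] coboundary_contraction_cocycle
  by (metis image_eqI)

text \<open>Write the three families as mapping cones in the direction \<open>v\<close>: the faces that do not contain
  \<open>v\<close> and the links of \<open>v\<close> are the pairs \<open>A \<subseteq> B\<close>,
  \<open>B \<subseteq> C\<close> and \<open>A \<subseteq> C\<close>. The two lemmas \<open>nonzero_AB\<close> and
  \<open>nonzero_AC\<close> are the parts that are used of the long exact sequence
  \<open>H\<^sup>m\<^sup>-\<^sup>1[B,C] \<rightarrow> H\<^sup>m[A,B] \<rightarrow> H\<^sup>m[A,C] \<rightarrow> H\<^sup>m[B,C]\<close>
  of this triangle.\<close>

locale family_triangle =
  fixes v :: "'v::finite" and SAB SBC SAC :: "'v set set"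
  assumes up: "up_closed SAB" "up_closed SBC" "up_closed SAC"
    and low: "\<And>\<sigma>. v \<notin> \<sigma> \<Longrightarrow> \<sigma> \<in> SAB \<longleftrightarrow> \<sigma> \<in> SAC"
    and mid: "\<And>\<sigma>. v \<notin> \<sigma> \<Longrightarrow> insert v \<sigma> \<in> SAB \<longleftrightarrow> \<sigma> \<in> SBC"
    and high: "\<And>\<sigma>. v \<in> \<sigma> \<Longrightarrow> \<sigma> \<in> SAC \<longleftrightarrow> \<sigma> \<in> SBC"
begin

lemma SAB_subset_SAC: "SAB \<subseteq> SAC"
proof
  fix \<sigma> assume s: "\<sigma> \<in> SAB"
  show "\<sigma> \<in> SAC"
  proof (cases "v \<in> \<sigma>")
    case True
    then have "\<sigma> - {v} \<in> SBC" using mid[of "\<sigma> - {v}"] s by (simp add: insert_absorb)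
    then show ?thesis using up_closedD[OF up(2)] high[OF True] by blast
  qed (use s low in blast)
qed

lemma SAC_subset_SBC: "SAC \<subseteq> SBC"
proof
  fix \<sigma> assume s: "\<sigma> \<in> SAC"
  show "\<sigma> \<in> SBC"
  proof (cases "v \<in> \<sigma>")
    case False
    then have "insert v \<sigma> \<in> SAB" using up_closedD[OF up(1)] low s by blast
    then show ?thesis using mid[OF False] by blast
  qed (use s high in blast)
qed

text \<open>Subtracting the coboundary of the part of \<open>t\<close> that contains \<open>v\<close> pushes a cochain
  of \<open>[A,C]\<close> into \<open>[A,B]\<close>: on faces through \<open>v\<close> only the part of
  \<open>t\<close> away from \<open>v\<close> is left, and it lives on \<open>B\<close>.\<close>

lemma split_correction:
  fixes t w :: "'v set \<Rightarrow> 'k::comm_ring_1"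
  assumes t: "t \<in> cochains SBC m"
  defines "t1 \<equiv> \<lambda>\<sigma>. if v \<in> \<sigma> then t \<sigma> else 0"
  assumes u: "u \<in> cochains SAC (m + 1)" and d: "\<And>\<sigma>. v \<in> \<sigma> \<Longrightarrow> u \<sigma> = coboundary t \<sigma>"
  shows "t1 \<in> cochains SAC m" "(\<lambda>\<sigma>. u \<sigma> - coboundary t1 \<sigma>) \<in> cochains SAB (m + 1)"
proof -
  show t1: "t1 \<in> cochains SAC m"
    using t high unfolding t1_def cochains_def by auto
  have c: "coboundary t1 \<in> cochains SAC (m + 1)"
    by (rule coboundary_in_cochains[OF up(3) t1])
  have d0: "(\<lambda>\<sigma>. u \<sigma> - coboundary t1 \<sigma>) \<in> cochains SAC (m + 1)"
    by (rule cochains_diff[OF u c])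
  show "(\<lambda>\<sigma>. u \<sigma> - coboundary t1 \<sigma>) \<in> cochains SAB (m + 1)"
    unfolding cochains_def
  proof (intro CollectI allI impI conjI)
    fix \<sigma> assume n: "u \<sigma> - coboundary t1 \<sigma> \<noteq> 0"
    show "int (card \<sigma>) = m + 1" using cochainsD[OF d0 n] by simp
    show "\<sigma> \<in> SAB"
    proof (cases "v \<in> \<sigma>")
      case False
      then show ?thesis using cochainsD[OF d0 n] low by blast
    next
      case True
      have "coboundary t \<sigma> - coboundary t1 \<sigma> = coboundary (\<lambda>\<sigma>. t \<sigma> - t1 \<sigma>) \<sigma>" by (simp add: coboundary_diff)
      then have "coboundary (\<lambda>\<sigma>. t \<sigma> - t1 \<sigma>) \<sigma> \<noteq> 0" using n d[OF True] by simp
      then obtain x where x: "x \<in> \<sigma>" "t (\<sigma> - {x}) - t1 (\<sigma> - {x}) \<noteq> 0" by (rule coboundary_nonzeroE)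
      then have "v \<notin> \<sigma> - {x}" "t (\<sigma> - {x}) \<noteq> 0" by (auto simp: t1_def split: if_splits)
      then have "x = v" "\<sigma> - {v} \<in> SBC" using True cochainsD[OF t] by auto
      then show ?thesis using mid[of "\<sigma> - {v}"] True by (simp add: insert_absorb)
    qed
  qed
qed

text \<open>A cocycle \<open>z\<close> of \<open>[A,B]\<close> that bounds \<open>w\<close> in \<open>[A,C]\<close>
  bounds the contraction of \<open>z\<close> in \<open>[B,C]\<close> as well, so \<open>w - contraction v z\<close> is
  a cocycle of \<open>[B,C]\<close>; if that one bounds too, then \<open>w\<close> can be corrected to a cochain of
  \<open>[A,B]\<close>.\<close>

lemma nonzero_AB:
  assumes "cohomology_nonzero K SAB m"
  shows "cohomology_nonzero K SAC m \<or> cohomology_nonzero K SBC (m - 1)"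
proof (rule ccontr)
  assume "\<not> ?thesis"
  then have AC: "\<And>z. z \<in> cochains SAC m \<Longrightarrow> coboundary z = (\<lambda>\<sigma>. 0 :: 'a) \<Longrightarrow> z \<in> coboundary ` cochains SAC (m - 1)"
    and BC: "\<And>z. z \<in> cochains SBC (m - 1) \<Longrightarrow> coboundary z = (\<lambda>\<sigma>. 0 :: 'a) \<Longrightarrow> z \<in> coboundary ` cochains SBC (m - 1 - 1)"
    by (auto simp: cohomology_nonzero_def)
  from assms obtain z where z: "z \<in> cochains SAB m" "coboundary z = (\<lambda>\<sigma>. 0 :: 'a)"
    and nz: "z \<notin> coboundary ` cochains SAB (m - 1)" by (auto simp: cohomology_nonzero_def)
  have "z \<in> cochains SAC m" using z(1) SAB_subset_SAC by (auto simp: cochains_def)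
  then obtain w where w: "w \<in> cochains SAC (m - 1)" "coboundary w = z" using AC z(2) by force
  have wB: "w \<in> cochains SBC (m - 1)" using w(1) SAC_subset_SBC by (auto simp: cochains_def)
  \<comment> \<open>The contraction of \<open>z\<close> lives on faces without \<open>v\<close>, whose join with \<open>v\<close> is in \<open>[A,B]\<close>.\<close>
  have Dz: "contraction v z \<in> cochains SBC (m - 1)"
    by (rule contraction_in_cochains[OF z(1)]) (use mid in auto)
  have "coboundary (\<lambda>\<sigma>. w \<sigma> - contraction v z \<sigma>) = (\<lambda>\<sigma>. 0)"
    by (simp add: coboundary_diff coboundary_contraction_cocycle[OF z(2)] w(2))
  then obtain t where t: "t \<in> cochains SBC (m - 1 - 1)" "coboundary t = (\<lambda>\<sigma>. w \<sigma> - contraction v z \<sigma>)"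
    using BC[OF cochains_diff[OF wB Dz]] by force
  define t1 where "t1 = (\<lambda>\<sigma>. if v \<in> \<sigma> then t \<sigma> else 0)"
  have "(\<lambda>\<sigma>. w \<sigma> - coboundary t1 \<sigma>) \<in> cochains SAB (m - 1 - 1 + 1)"
    unfolding t1_def
    by (rule split_correction(2)[OF t(1)]) (use w(1) in \<open>auto simp: t(2) contraction_def\<close>)
  moreover have "coboundary (\<lambda>\<sigma>. w \<sigma> - coboundary t1 \<sigma>) = z"
    by (simp add: coboundary_diff coboundary_coboundary w(2))
  ultimately show False using nz by (metis diff_add_cancel image_eqI)
qed

lemma nonzero_AC:
  assumes "cohomology_nonzero K SAC m"
  shows "cohomology_nonzero K SAB m \<or> cohomology_nonzero K SBC m"
proof (rule ccontr)
  assume "\<not> ?thesis"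
  then have AB: "\<And>z. z \<in> cochains SAB m \<Longrightarrow> coboundary z = (\<lambda>\<sigma>. 0 :: 'a) \<Longrightarrow> z \<in> coboundary ` cochains SAB (m - 1)"
    and BC: "\<And>z. z \<in> cochains SBC m \<Longrightarrow> coboundary z = (\<lambda>\<sigma>. 0 :: 'a) \<Longrightarrow> z \<in> coboundary ` cochains SBC (m - 1)"
    by (auto simp: cohomology_nonzero_def)
  from assms obtain z where z: "z \<in> cochains SAC m" "coboundary z = (\<lambda>\<sigma>. 0 :: 'a)"
    and nz: "z \<notin> coboundary ` cochains SAC (m - 1)" by (auto simp: cohomology_nonzero_def)
  have "z \<in> cochains SBC m" using z(1) SAC_subset_SBC by (auto simp: cochains_def)
  then obtain t where t: "t \<in> cochains SBC (m - 1)" "coboundary t = z" using BC z(2) by force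
  define t1 where "t1 = (\<lambda>\<sigma>. if v \<in> \<sigma> then t \<sigma> else 0)"
  have u: "(\<lambda>\<sigma>. z \<sigma> - coboundary t1 \<sigma>) \<in> cochains SAB (m - 1 + 1)"
    unfolding t1_def by (rule split_correction(2)[OF t(1)]) (use z t in auto)
  have t1: "t1 \<in> cochains SAC (m - 1)"
    unfolding t1_def by (rule split_correction(1)[OF t(1)]) (use z t in auto)
  have "coboundary (\<lambda>\<sigma>. z \<sigma> - coboundary t1 \<sigma>) = (\<lambda>\<sigma>. 0)"
    by (simp add: coboundary_diff coboundary_coboundary z(2))
  then obtain s where s: "s \<in> cochains SAB (m - 1)" "coboundary s = (\<lambda>\<sigma>. z \<sigma> - coboundary t1 \<sigma>)"
    using AB u by force
  have "(\<lambda>\<sigma>. t1 \<sigma> + s \<sigma>) \<in> cochains SAC (m - 1)"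
    by (rule cochains_add[OF t1]) (use s(1) SAB_subset_SAC in \<open>auto simp: cochains_def\<close>)
  moreover have "coboundary (\<lambda>\<sigma>. t1 \<sigma> + s \<sigma>) = z" by (simp add: coboundary_add s(2))
  ultimately show False using nz by (metis image_eqI)
qed

end

section \<open>From Koszul to Cech one variable at a time\<close>

text \<open>\<open>P\<close> stands for the exponents of the monomials in a monomial ideal \<open>J\<close>. Taking
  \<open>hi = lo + 1\<close> everywhere gives the Koszul complex of \<open>J\<close> in multidegree \<open>hi\<close>,
  where \<open>\<sigma>\<close> is the complement of the usual index set. Taking \<open>hi\<close> infinite everywhere
  gives the Cech complex that computes the local cohomology of \<open>J\<close> in multidegree \<open>lo\<close>: the
  variables in \<open>\<sigma>\<close> are inverted. A large integer \<open>N\<close> plays the role of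
  infinity.\<close>

definition cube_family :: "(('v \<Rightarrow> int) \<Rightarrow> bool) \<Rightarrow> ('v \<Rightarrow> int) \<Rightarrow> ('v \<Rightarrow> int) \<Rightarrow> 'v set set" where
  "cube_family P lo hi = {\<sigma>. P (\<lambda>v. if v \<in> \<sigma> then hi v else lo v)}"

text \<open>\<open>W\<close> is the set of variables in Cech position; the others are in Koszul position. If
  \<open>W\<close> is empty and \<open>m = n - i\<close> for \<open>n\<close> variables, then
  \<open>\<Sum>lo + m\<close> is the number \<open>j - i\<close> attached to a nonzero \<open>Tor\<^sub>i\<close> in
  degree \<open>j\<close>. If \<open>W\<close> is everything, it is the number \<open>|a| + m\<close> attached to a
  nonzero local cohomology group of index \<open>m\<close> in degree \<open>a\<close>. The maximum of either set is
  the regularity.\<close>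

definition cube_values :: "'k::field itself \<Rightarrow> (('v::finite \<Rightarrow> int) \<Rightarrow> bool) \<Rightarrow> int \<Rightarrow> 'v set \<Rightarrow> int set" where
  "cube_values K P N W = {(\<Sum>v\<in>UNIV. lo v) + m | lo m. (\<forall>v\<in>W. lo v \<le> N) \<and>
     cohomology_nonzero K (cube_family P lo (\<lambda>v. if v \<in> W then N else lo v + 1)) m}"

text \<open>\<open>N\<close> bounds the exponents of the generators, so that raising an exponent beyond
  \<open>N\<close> does not affect membership.\<close>

locale exponent_predicate =
  fixes P :: "('v::finite \<Rightarrow> int) \<Rightarrow> bool" and N :: int
  assumes mono: "P e \<Longrightarrow> (\<And>v. e v \<le> f v) \<Longrightarrow> P f"
    and truncate: "P e \<Longrightarrow> P (\<lambda>v. min (e v) N)"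
begin

lemma up_closed_cube_family:
  assumes "\<And>v. lo v \<le> hi v"
  shows "up_closed (cube_family P lo hi)"
  unfolding up_closed_def cube_family_def
  using assms by (auto elim!: mono)

text \<open>Beyond \<open>N\<close> both ends of the interval of \<open>v\<close> give the same condition, so the
  family is a cone.\<close>

lemma cube_family_acyclic:
  assumes "lo v \<ge> N" "hi v \<ge> N"
  shows "\<not> cohomology_nonzero K (cube_family P lo hi) m"
proof (rule cohomology_cone_zero[of v])
  fix \<sigma> assume "insert v \<sigma> \<in> cube_family P lo hi"
  then have "P (\<lambda>w. min (if w \<in> insert v \<sigma> then hi w else lo w) N)"
    by (auto simp: cube_family_def intro: truncate)
  then have "P (\<lambda>w. if w \<in> \<sigma> then hi w else lo w)"
    by (rule mono) (use assms in auto)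
  then show "\<sigma> \<in> cube_family P lo hi" by (simp add: cube_family_def)
qed

text \<open>Cutting the interval of \<open>v\<close> at \<open>\<beta>\<close> gives an instance of the
  triangle.\<close>

lemma cube_triangle:
  fixes lo hi :: "'v \<Rightarrow> int"
  assumes le: "\<And>w. lo w \<le> hi w" and b: "lo v \<le> \<beta>" "\<beta> \<le> hi v"
  shows "family_triangle v (cube_family P lo (hi(v := \<beta>))) (cube_family P (lo(v := \<beta>)) hi) (cube_family P lo hi)"
proof
  show "up_closed (cube_family P lo (hi(v := \<beta>)))" "up_closed (cube_family P (lo(v := \<beta>)) hi)"
    "up_closed (cube_family P lo hi)"
    by (rule up_closed_cube_family; use le b in simp)+
next
  fix \<sigma> assume v: "v \<notin> \<sigma>"
  have "(\<lambda>w. if w \<in> \<sigma> then (hi(v := \<beta>)) w else lo w) = (\<lambda>w. if w \<in> \<sigma> then hi w else lo w)"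
    "(\<lambda>w. if w \<in> insert v \<sigma> then (hi(v := \<beta>)) w else lo w) = (\<lambda>w. if w \<in> \<sigma> then hi w else (lo(v := \<beta>)) w)"
    using v by auto
  then show "\<sigma> \<in> cube_family P lo (hi(v := \<beta>)) \<longleftrightarrow> \<sigma> \<in> cube_family P lo hi"
    "insert v \<sigma> \<in> cube_family P lo (hi(v := \<beta>)) \<longleftrightarrow> \<sigma> \<in> cube_family P (lo(v := \<beta>)) hi"
    by (simp_all only: cube_family_def mem_Collect_eq)
next
  fix \<sigma> assume v: "v \<in> \<sigma>"
  have "(\<lambda>w. if w \<in> \<sigma> then hi w else (lo(v := \<beta>)) w) = (\<lambda>w. if w \<in> \<sigma> then hi w else lo w)"
    using v by auto
  then show "\<sigma> \<in> cube_family P lo hi \<longleftrightarrow> \<sigma> \<in> cube_family P (lo(v := \<beta>)) hi"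
    by (simp only: cube_family_def mem_Collect_eq)
qed

lemma sum_fun_upd:
  fixes lo :: "'v \<Rightarrow> int"
  shows "(\<Sum>w\<in>UNIV. (lo(v := x)) w) = (\<Sum>w\<in>UNIV. lo w) - lo v + x"
proof -
  have "(\<Sum>w\<in>UNIV. (lo(v := x)) w) = x + (\<Sum>w\<in>UNIV - {v}. (lo(v := x)) w)"
    by (subst sum.remove[of _ v]) auto
  also have "(\<Sum>w\<in>UNIV - {v}. (lo(v := x)) w) = (\<Sum>w\<in>UNIV - {v}. lo w)"
    by (rule sum.cong) auto
  finally show ?thesis by (simp add: sum.remove[of UNIV v lo])
qed

text \<open>Cut the Cech interval \<open>[lo v, N]\<close> at \<open>lo v + 1\<close>: its lower piece is the Koszul
  interval, so a class on that piece gives one on the whole interval in the same degree, or one on the upper piece,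
  where \<open>lo\<close> is one larger and \<open>m\<close> one smaller. The value \<open>\<Sum>lo + m\<close> is the
  same in both cases.\<close>

lemma cube_values_insert:
  assumes v: "v \<notin> W" and r: "r \<in> cube_values K P N W"
  shows "r \<in> cube_values K P N (insert v W)"
proof -
  obtain lo m where lo: "\<forall>v\<in>W. lo v \<le> N" "r = (\<Sum>v\<in>UNIV. lo v) + m"
    and nz: "cohomology_nonzero K (cube_family P lo (\<lambda>v. if v \<in> W then N else lo v + 1)) m"
    using r by (auto simp: cube_values_def)
  have lt: "lo v < N"
    using nz cube_family_acyclic[of lo v "\<lambda>v. if v \<in> W then N else lo v + 1" K m] v by fastforce
  let ?hi = "\<lambda>w. if w \<in> insert v W then N else lo w + 1"
  interpret family_triangle v "cube_family P lo (?hi(v := lo v + 1))"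
    "cube_family P (lo(v := lo v + 1)) ?hi" "cube_family P lo ?hi"
    by (rule cube_triangle) (use lo lt in auto)
  have e1: "?hi(v := lo v + 1) = (\<lambda>v. if v \<in> W then N else lo v + 1)" using v by auto
  have e2: "?hi = (\<lambda>w. if w \<in> insert v W then N else (lo(v := lo v + 1)) w + 1)" by auto
  from nonzero_AB[unfolded e1, OF nz] show ?thesis
  proof
    assume "cohomology_nonzero K (cube_family P lo ?hi) m"
    then show ?thesis unfolding cube_values_def
      by (intro CollectI exI[of _ lo] exI[of _ m]) (use lo lt in auto)
  next
    assume "cohomology_nonzero K (cube_family P (lo(v := lo v + 1)) ?hi) (m - 1)"
    then have "cohomology_nonzero K (cube_family P (lo(v := lo v + 1))
        (\<lambda>w. if w \<in> insert v W then N else (lo(v := lo v + 1)) w + 1)) (m - 1)" using e2 by simp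
    moreover have "r = (\<Sum>w\<in>UNIV. (lo(v := lo v + 1)) w) + (m - 1)" using lo(2) by (simp only: sum_fun_upd)
    moreover have "\<forall>w\<in>insert v W. (lo(v := lo v + 1)) w \<le> N" using lo(1) lt by auto
    ultimately show ?thesis unfolding cube_values_def by blast
  qed
qed

text \<open>The same triangle read in the other direction: either the class is seen on the Koszul piece, or it
  survives when \<open>lo v\<close> is raised by one. The latter cannot go on beyond \<open>N\<close>, where the
  family is acyclic.\<close>

lemma cube_values_remove:
  assumes v: "v \<notin> W" and r: "r \<in> cube_values K P N (insert v W)"
  shows "\<exists>r'\<in>cube_values K P N W. r \<le> r'"
proof -
  have "\<exists>r'\<in>cube_values K P N W. (\<Sum>v\<in>UNIV. lo v) + m \<le> r'"
    if "\<forall>v\<in>insert v W. lo v \<le> N"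
      "cohomology_nonzero K (cube_family P lo (\<lambda>w. if w \<in> insert v W then N else lo w + 1)) m" for lo m
    using that
  proof (induction "nat (N - lo v)" arbitrary: lo)
    case 0
    then have "lo v \<ge> N" by simp
    then have False using cube_family_acyclic[of lo v "\<lambda>w. if w \<in> insert v W then N else lo w + 1" K m] 0(3) by simp
    then show ?case ..
  next
    case (Suc d)
    let ?hi = "\<lambda>w. if w \<in> insert v W then N else lo w + 1"
    have lt: "lo v < N" using Suc.hyps(2) by linarith
    interpret family_triangle v "cube_family P lo (?hi(v := lo v + 1))"
      "cube_family P (lo(v := lo v + 1)) ?hi" "cube_family P lo ?hi"
      by (rule cube_triangle) (use Suc.prems lt in auto)
    have e1: "?hi(v := lo v + 1) = (\<lambda>v. if v \<in> W then N else lo v + 1)" using v by auto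
    have e2: "?hi = (\<lambda>w. if w \<in> insert v W then N else (lo(v := lo v + 1)) w + 1)" by auto
    from nonzero_AC[unfolded e1, OF Suc.prems(2)] show ?case
    proof
      assume "cohomology_nonzero K (cube_family P lo (\<lambda>v. if v \<in> W then N else lo v + 1)) m"
      then have "(\<Sum>v\<in>UNIV. lo v) + m \<in> cube_values K P N W" unfolding cube_values_def
        by (intro CollectI exI[of _ lo] exI[of _ m]) (use Suc.prems in auto)
      then show ?thesis by blast
    next
      assume "cohomology_nonzero K (cube_family P (lo(v := lo v + 1)) ?hi) m"
      then have "cohomology_nonzero K (cube_family P (lo(v := lo v + 1))
          (\<lambda>w. if w \<in> insert v W then N else (lo(v := lo v + 1)) w + 1)) m" using e2 by simp
      then have "\<exists>r'\<in>cube_values K P N W. (\<Sum>w\<in>UNIV. (lo(v := lo v + 1)) w) + m \<le> r'"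
        by (rule Suc.hyps(1)[rotated 2]) (use Suc.hyps Suc.prems lt in auto)
      then obtain r' where "r' \<in> cube_values K P N W" "(\<Sum>w\<in>UNIV. (lo(v := lo v + 1)) w) + m \<le> r'" by blast
      moreover from this(2) have "(\<Sum>w\<in>UNIV. lo w) + m \<le> r'" unfolding sum_fun_upd by linarith
      ultimately show ?thesis by blast
    qed
  qed
  then show ?thesis using r by (auto simp: cube_values_def)
qed

lemma koszul_value_imp_cech_value:
  assumes "r \<in> cube_values K P N {}"
  shows "r \<in> cube_values K P N UNIV"
proof -
  have "finite W \<Longrightarrow> r \<in> cube_values K P N W" for W
    by (induction W rule: finite_induct) (use assms cube_values_insert in auto)
  then show ?thesis by simp
qed

lemma cech_value_le_koszul_value:
  assumes "r \<in> cube_values K P N UNIV"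
  shows "\<exists>r'\<in>cube_values K P N {}. r \<le> r'"
proof -
  have "finite W \<Longrightarrow> r \<in> cube_values K P N W \<Longrightarrow> \<exists>r'\<in>cube_values K P N {}. r \<le> r'" for W r
  proof (induction W arbitrary: r rule: finite_induct)
    case (insert v W)
    then show ?case using cube_values_remove by (meson order_trans)
  qed auto
  then show ?thesis using assms by simp
qed

lemma cech_value_bounded:
  assumes "r \<in> cube_values K P N UNIV"
  shows "r \<le> (N + 1) * int (card (UNIV :: 'v set))"
proof -
  obtain lo m where lo: "\<forall>v. lo v \<le> N" "r = (\<Sum>v\<in>UNIV. lo v) + m"
    and nz: "cohomology_nonzero K (cube_family P lo (\<lambda>v. N)) m"
    using assms by (auto simp: cube_values_def)
  obtain \<sigma> where "\<sigma> \<in> cube_family P lo (\<lambda>v. N)" "m = int (card \<sigma>)"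
    using cohomology_nonzero_face[OF nz] .
  then have "m \<le> int (card (UNIV :: 'v set))" by (simp add: card_mono)
  moreover have "(\<Sum>v\<in>UNIV. lo v) \<le> (\<Sum>v\<in>(UNIV::'v set). N)" by (rule sum_mono) (use lo in auto)
  ultimately show ?thesis using lo by (simp add: algebra_simps)
qed

end

section \<open>The complementary simplicial complex\<close>

text \<open>For a simplicial complex \<open>D\<close> this is reduced simplicial cohomology over the field, indexed by
  the number of vertices. Restriction of cochains to \<open>D\<close> is expressed by comparing values on the faces in
  \<open>D\<close> only.\<close>

definition complex_cohomology_nonzero :: "'k::field itself \<Rightarrow> 'v::finite set set \<Rightarrow> int \<Rightarrow> bool" where
  "complex_cohomology_nonzero K D m \<longleftrightarrow>
    (\<exists>w\<in>cochains D m. (\<forall>\<sigma>\<in>D. coboundary w \<sigma> = (0 :: 'k)) \<and>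
      \<not> (\<exists>t\<in>cochains UNIV (m - 1). \<forall>\<sigma>\<in>D. w \<sigma> = coboundary t \<sigma>))"

lemma cocycle_is_coboundary:
  fixes z :: "'v::finite set \<Rightarrow> 'k::comm_ring_1"
  assumes "z \<in> cochains UNIV m" "coboundary z = (\<lambda>\<sigma>. 0)"
  shows "\<exists>t\<in>cochains UNIV (m - 1). coboundary t = z"
  using contraction_in_cochains[OF assms(1), of undefined UNIV] coboundary_contraction_cocycle[OF assms(2)]
  by blast

lemma up_closed_UNIV [simp]: "up_closed UNIV"
  by (simp add: up_closed_def)

lemma cochains_mono: "z \<in> cochains S m \<Longrightarrow> S \<subseteq> T \<Longrightarrow> z \<in> cochains T m"
  by (auto simp: cochains_def)

text \<open>The full simplex is acyclic, so the connecting homomorphism from the cohomology of the complement to that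
  of the up-closed family is an isomorphism.\<close>

lemma cohomology_nonzero_iff_complement:
  fixes S :: "'v::finite set set" and K :: "'k::field itself"
  assumes S: "up_closed S"
  shows "cohomology_nonzero K S m \<longleftrightarrow> complex_cohomology_nonzero K (- S) (m - 1)"
proof
  assume "cohomology_nonzero K S m"
  then obtain z where z: "z \<in> cochains S m" "coboundary z = (\<lambda>\<sigma>. 0 :: 'k)"
    and nz: "z \<notin> coboundary ` cochains S (m - 1)" by (auto simp: cohomology_nonzero_def)
  obtain x where x: "x \<in> cochains UNIV (m - 1)" "coboundary x = z"
    using cocycle_is_coboundary[OF cochains_mono[OF z(1)] z(2)] by auto
  define u where "u = (\<lambda>\<sigma>. if \<sigma> \<in> S then x \<sigma> else 0)"
  define w where "w = (\<lambda>\<sigma>. if \<sigma> \<in> S then 0 else x \<sigma>)"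
  \<comment> \<open>\<open>x\<close> is a primitive of \<open>z\<close> on the full simplex; \<open>w\<close> is its restriction to the complement.\<close>
  have u: "u \<in> cochains S (m - 1)" and w: "w \<in> cochains (- S) (m - 1)"
    using x(1) by (auto simp: u_def w_def cochains_def)
  have "w = (\<lambda>\<sigma>. x \<sigma> - u \<sigma>)" by (auto simp: u_def w_def)
  then have cw: "coboundary w = (\<lambda>\<sigma>. z \<sigma> - coboundary u \<sigma>)" by (simp add: coboundary_diff x(2))
  have "coboundary w \<in> cochains S m"
    unfolding cw using cochains_diff[OF z(1)] coboundary_in_cochains[OF S u] by simp
  then have "\<forall>\<sigma>\<in>-S. coboundary w \<sigma> = 0" by (auto simp: cochains_def)
  moreover have False if t: "t \<in> cochains UNIV (m - 1 - 1)" "\<forall>\<sigma>\<in>-S. w \<sigma> = coboundary t \<sigma>" for t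
  proof -
    define y where "y = (\<lambda>\<sigma>. x \<sigma> - coboundary t \<sigma>)"
    have "y \<in> cochains UNIV (m - 1)"
      unfolding y_def using cochains_diff[OF x(1)] coboundary_in_cochains[OF up_closed_UNIV t(1)] by simp
    moreover have "y \<sigma> = 0" if "\<sigma> \<notin> S" for \<sigma> using t(2) that by (auto simp: y_def w_def)
    ultimately have "y \<in> cochains S (m - 1)" by (auto simp: cochains_def)
    moreover have "coboundary y = z" by (simp add: y_def coboundary_diff coboundary_coboundary x(2))
    ultimately show False using nz by blast
  qed
  ultimately show "complex_cohomology_nonzero K (- S) (m - 1)"
    using w unfolding complex_cohomology_nonzero_def by blast
next
  assume "complex_cohomology_nonzero K (- S) (m - 1)"
  then obtain w where w: "w \<in> cochains (- S) (m - 1)" "\<forall>\<sigma>\<in>-S. coboundary w \<sigma> = (0 :: 'k)"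
    and nt: "\<And>t. t \<in> cochains UNIV (m - 1 - 1) \<Longrightarrow> \<exists>\<sigma>\<in>-S. w \<sigma> \<noteq> coboundary t \<sigma>"
    unfolding complex_cohomology_nonzero_def by metis
  have wU: "w \<in> cochains UNIV (m - 1)" using cochains_mono[OF w(1)] by simp
  then have "coboundary w \<in> cochains UNIV (m - 1 + 1)"
    by (rule coboundary_in_cochains[OF up_closed_UNIV])
  then have z: "coboundary w \<in> cochains S m" using w(2) by (auto simp: cochains_def)
  have "coboundary w \<noteq> coboundary u" if u: "u \<in> cochains S (m - 1)" for u
  proof
    assume eq: "coboundary w = coboundary u"
    have "(\<lambda>\<sigma>. w \<sigma> - u \<sigma>) \<in> cochains UNIV (m - 1)"
      by (rule cochains_diff[OF wU cochains_mono[OF u]]) simp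
    moreover have "coboundary (\<lambda>\<sigma>. w \<sigma> - u \<sigma>) = (\<lambda>\<sigma>. 0)" by (simp add: coboundary_diff eq)
    ultimately obtain t where t: "t \<in> cochains UNIV (m - 1 - 1)" "coboundary t = (\<lambda>\<sigma>. w \<sigma> - u \<sigma>)"
      using cocycle_is_coboundary by metis
    have "w \<sigma> = coboundary t \<sigma>" if "\<sigma> \<in> -S" for \<sigma>
      using that u t(2) by (auto simp: cochains_def)
    then show False using nt[OF t(1)] by blast
  qed
  then show "cohomology_nonzero K S m"
    unfolding cohomology_nonzero_def using z coboundary_coboundary by blast
qed

lemma coboundary_singleton [simp]: "coboundary t {p} = (t {} :: 'k::comm_ring_1)"
proof -
  have "{w \<in> {p}. vertex_index w < vertex_index p} = {}" by auto
  then have "face_sign p {p} = (1 :: 'k)" by (simp only: face_sign_def card.empty power_0)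
  then show ?thesis by (simp add: coboundary_def)
qed

lemma coboundary_empty [simp]: "coboundary t {} = 0"
  by (simp add: coboundary_def)

lemma coboundary_cong:
  "(\<And>v. v \<in> \<sigma> \<Longrightarrow> f (\<sigma> - {v}) = g (\<sigma> - {v})) \<Longrightarrow> coboundary f \<sigma> = coboundary g \<sigma>"
  by (simp add: coboundary_def)

lemma cochain_zero_card: "z \<in> cochains S m \<Longrightarrow> int (card \<sigma>) \<noteq> m \<Longrightarrow> z \<sigma> = 0"
  by (auto simp: cochains_def)

text \<open>The union of a complex on \<open>V1\<close> and a complex on \<open>V2\<close> that share at most the
  empty face. Its cohomology is the sum of those of the two parts, except for the extra class in degree 1 that
  separates the parts.\<close>

locale split_complex =
  fixes D :: "'v::finite set set" and V1 V2 :: "'v set"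
  assumes disjoint: "V1 \<inter> V2 = {}"
    and split: "D \<subseteq> Pow V1 \<union> Pow V2"
    and down_closed: "\<sigma> \<in> D \<Longrightarrow> \<tau> \<subseteq> \<sigma> \<Longrightarrow> \<tau> \<in> D"
begin

lemma face_side: "\<sigma> \<in> D \<Longrightarrow> \<sigma> \<subseteq> V1 \<or> \<sigma> \<subseteq> V2"
  using split by auto

text \<open>A class that is nonzero on the \<open>V1\<close>-part, extended by zero to the \<open>V2\<close>-part,
  remains nonzero in any larger complex with the same nonempty faces in \<open>V1\<close>, because every nonempty face
  lies on exactly one side.\<close>

lemma extend_class:
  assumes D0: "D0 \<subseteq> D" "\<And>\<sigma>. \<sigma> \<in> D \<Longrightarrow> \<sigma> \<subseteq> V1 \<Longrightarrow> \<sigma> \<noteq> {} \<Longrightarrow> \<sigma> \<in> D0"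
    and w: "w \<in> cochains D0 m" "\<forall>\<sigma>\<in>D0. coboundary w \<sigma> = (0 :: 'k::field)" and m: "m \<ge> 1"
    and nt: "\<not> (\<exists>t\<in>cochains UNIV (m - 1). \<forall>\<sigma>\<in>D0. \<sigma> \<subseteq> V1 \<longrightarrow> \<sigma> \<noteq> {} \<longrightarrow> w \<sigma> = coboundary t \<sigma>)"
  shows "complex_cohomology_nonzero (K :: 'k itself) D m"
proof -
  define w1 where "w1 = (\<lambda>\<sigma>. if \<sigma> \<subseteq> V1 then w \<sigma> else 0)"
  have w0: "w {} = 0" using cochain_zero_card[OF w(1), of "{}"] m by simp
  have "w1 \<in> cochains D m" using w(1) D0(1) by (auto simp: w1_def cochains_def)
  moreover have "coboundary w1 \<sigma> = 0" if s: "\<sigma> \<in> D" for \<sigma>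
  proof (cases "\<sigma> \<subseteq> V1")
    case True
    have "coboundary w1 \<sigma> = coboundary w \<sigma>"
      by (rule coboundary_cong) (use True in \<open>auto simp: w1_def\<close>)
    then show ?thesis using w(2) D0(2)[OF s True] by (cases "\<sigma> = {}") auto
  next
    case False
    then have "\<sigma> \<subseteq> V2" using face_side s by blast
    have "coboundary w1 \<sigma> = coboundary (\<lambda>\<sigma>. 0) \<sigma>"
    proof (rule coboundary_cong)
      fix v
      show "w1 (\<sigma> - {v}) = 0"
      proof (cases "\<sigma> - {v} = {}")
        case True
        show ?thesis unfolding True using w0 by (simp add: w1_def)
      next
        case False
        then have "\<not> \<sigma> - {v} \<subseteq> V1" using \<open>\<sigma> \<subseteq> V2\<close> disjoint by blast
        then show ?thesis by (simp add: w1_def)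
      qed
    qed
    then show ?thesis by simp
  qed
  moreover have False if "t \<in> cochains UNIV (m - 1)" "\<forall>\<sigma>\<in>D. w1 \<sigma> = coboundary t \<sigma>" for t
    using nt that D0(1) unfolding w1_def by (metis subsetD)
  ultimately show ?thesis unfolding complex_cohomology_nonzero_def by blast
qed

text \<open>The indicator function of the vertices in \<open>V1\<close> is a cocycle and is not constant.\<close>

lemma two_parts_nonzero:
  assumes "{p} \<in> D" "p \<in> V1" "{q} \<in> D" "q \<in> V2"
  shows "complex_cohomology_nonzero (K :: 'k::field itself) D 1"
proof -
  \<comment> \<open>On nonempty faces in \<open>V1\<close> the cochain \<open>w\<close> agrees with the coboundary of the empty face, which is constant 1 on vertices.\<close>
  define d :: "'v set \<Rightarrow> 'k" where "d = (\<lambda>\<tau>. if \<tau> = {} then 1 else 0)"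
  define w where "w = (\<lambda>\<tau>. if \<tau> \<in> D \<and> \<tau> \<subseteq> V1 then coboundary d \<tau> else 0)"
  have "d \<in> cochains UNIV 0" by (auto simp: d_def cochains_def)
  then have "coboundary d \<in> cochains UNIV 1" using coboundary_in_cochains[OF up_closed_UNIV, of d 0] by simp
  then have "w \<in> cochains D 1" by (auto simp: w_def cochains_def)
  moreover have "coboundary w \<sigma> = 0" if s: "\<sigma> \<in> D" for \<sigma>
  proof (cases "\<sigma> \<subseteq> V1")
    case True
    have "coboundary w \<sigma> = coboundary (coboundary d) \<sigma>"
      by (rule coboundary_cong) (use True s down_closed in \<open>auto simp: w_def\<close>)
    then show ?thesis by (simp add: coboundary_coboundary)
  next
    case False
    then have s2: "\<sigma> \<subseteq> V2" using face_side s by blast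
    have "coboundary w \<sigma> = coboundary (\<lambda>\<sigma>. 0) \<sigma>"
    proof (rule coboundary_cong)
      fix v
      show "w (\<sigma> - {v}) = 0"
      proof (cases "\<sigma> - {v} = {}")
        case False
        then have "\<not> \<sigma> - {v} \<subseteq> V1" using s2 disjoint by blast
        then show ?thesis by (simp add: w_def)
      next
        case True
        show ?thesis unfolding True by (simp add: w_def)
      qed
    qed
    then show ?thesis by simp
  qed
  moreover have False if t: "\<forall>\<sigma>\<in>D. w \<sigma> = coboundary t \<sigma>" for t
  proof -
    have "w {p} = t {}" "w {q} = t {}" using t assms by auto
    moreover have "w {p} = 1" "w {q} = 0" using assms disjoint by (auto simp: w_def d_def)
    ultimately show False by simp
  qed
  ultimately show ?thesis unfolding complex_cohomology_nonzero_def by blast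
qed

text \<open>If the class is trivial on both parts, the two primitives can be glued as soon as they do not involve the
  empty face, that is, for \<open>m > 1\<close>; for \<open>m = 1\<close> they are constants, which can differ only if
  both parts have a vertex.\<close>

lemma nonzero_cases:
  assumes nz: "complex_cohomology_nonzero (K :: 'k::field itself) D m" and m: "m \<ge> 1"
  obtains (part) w where "w \<in> cochains D m" "\<forall>\<sigma>\<in>D. coboundary w \<sigma> = (0 :: 'k)"
      "\<not> (\<exists>t\<in>cochains UNIV (m - 1). \<forall>\<sigma>\<in>D. \<sigma> \<subseteq> V1 \<longrightarrow> \<sigma> \<noteq> {} \<longrightarrow> w \<sigma> = coboundary t \<sigma>)
       \<or> \<not> (\<exists>t\<in>cochains UNIV (m - 1). \<forall>\<sigma>\<in>D. \<sigma> \<subseteq> V2 \<longrightarrow> \<sigma> \<noteq> {} \<longrightarrow> w \<sigma> = coboundary t \<sigma>)"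
    | (points) p q where "m = 1" "{p} \<in> D" "p \<in> V1" "{q} \<in> D" "q \<in> V2"
proof (rule ccontr)
  assume no: "\<not> thesis"
  from nz obtain w where w: "w \<in> cochains D m" "\<forall>\<sigma>\<in>D. coboundary w \<sigma> = (0 :: 'k)"
    and nt: "\<not> (\<exists>t\<in>cochains UNIV (m - 1). \<forall>\<sigma>\<in>D. w \<sigma> = coboundary t \<sigma>)"
    unfolding complex_cohomology_nonzero_def by blast
  have w0: "w {} = 0" using cochain_zero_card[OF w(1), of "{}"] m by simp
  let ?A = "\<lambda>V. \<exists>t\<in>cochains UNIV (m - 1). \<forall>\<sigma>\<in>D. \<sigma> \<subseteq> V \<longrightarrow> \<sigma> \<noteq> {} \<longrightarrow> w \<sigma> = coboundary t \<sigma>"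
  have no_part: "?A V1 \<and> ?A V2"
  proof (rule ccontr)
    assume "\<not> (?A V1 \<and> ?A V2)"
    then have "\<not> ?A V1 \<or> \<not> ?A V2" by (simp only: de_Morgan_conj)
    from part[OF w this] no show False by contradiction
  qed
  from no_part obtain t1 t2 where t1: "t1 \<in> cochains UNIV (m - 1)"
    "\<forall>\<sigma>\<in>D. \<sigma> \<subseteq> V1 \<longrightarrow> \<sigma> \<noteq> {} \<longrightarrow> w \<sigma> = coboundary t1 \<sigma>"
    and t2: "t2 \<in> cochains UNIV (m - 1)"
    "\<forall>\<sigma>\<in>D. \<sigma> \<subseteq> V2 \<longrightarrow> \<sigma> \<noteq> {} \<longrightarrow> w \<sigma> = coboundary t2 \<sigma>"
    by (elim conjE bexE)
  show False
  proof (cases "m = 1")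
    case False
    define t where "t = (\<lambda>\<sigma>. if \<sigma> \<subseteq> V1 then t1 \<sigma> else t2 \<sigma>)"
    have "t \<in> cochains UNIV (m - 1)" using t1(1) t2(1) by (auto simp: t_def cochains_def)
    moreover have "w \<sigma> = coboundary t \<sigma>" if s: "\<sigma> \<in> D" for \<sigma>
    proof (cases "\<sigma> = {}")
      case True
      then show ?thesis using w0 by simp
    next
      case ne: False
      have z: "t {} = 0" "t2 {} = 0"
        using False t1(1) t2(1) cochain_zero_card[of _ UNIV "m - 1" "{}"] by (auto simp: t_def)
      show ?thesis
      proof (cases "\<sigma> \<subseteq> V1")
        case True
        have "coboundary t \<sigma> = coboundary t1 \<sigma>"
          by (rule coboundary_cong) (use True in \<open>auto simp: t_def\<close>)
        then show ?thesis using t1(2) s True ne by simp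
      next
        case V1: False
        then have s2: "\<sigma> \<subseteq> V2" using face_side s by blast
        have "coboundary t \<sigma> = coboundary t2 \<sigma>"
        proof (rule coboundary_cong)
          fix v
          show "t (\<sigma> - {v}) = t2 (\<sigma> - {v})"
          proof (cases "\<sigma> - {v} = {}")
            case True
            show ?thesis unfolding True using z by simp
          next
            case False
            then have "\<not> \<sigma> - {v} \<subseteq> V1" using s2 disjoint by blast
            then show ?thesis by (simp add: t_def)
          qed
        qed
        then show ?thesis using t2(2) s s2 ne by simp
      qed
    qed
    ultimately show False using nt by blast
  next
    case True
    have sing: "\<exists>\<sigma>\<in>D. card \<sigma> = 1 \<and> w \<sigma> \<noteq> coboundary t \<sigma>" if "t \<in> cochains UNIV (m - 1)" for t
    proof -
      obtain \<sigma> where s: "\<sigma> \<in> D" "w \<sigma> \<noteq> coboundary t \<sigma>" using nt \<open>t \<in> _\<close> by blast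
      moreover have "coboundary t \<in> cochains UNIV m"
        using coboundary_in_cochains[OF up_closed_UNIV that] by simp
      ultimately have "int (card \<sigma>) = 1"
        using cochain_zero_card[OF w(1)] cochain_zero_card[of "coboundary t" UNIV m] True by metis
      then show ?thesis using s by auto
    qed
    obtain \<sigma> where s: "\<sigma> \<in> D" "card \<sigma> = 1" "w \<sigma> \<noteq> coboundary t2 \<sigma>" using sing[OF t2(1)] by blast
    obtain p where p: "\<sigma> = {p}" using s(2) card_1_singletonE by blast
    have pV: "p \<in> V1" using face_side[OF s(1)] t2(2) s p by blast
    obtain \<tau> where s': "\<tau> \<in> D" "card \<tau> = 1" "w \<tau> \<noteq> coboundary t1 \<tau>" using sing[OF t1(1)] by blast
    obtain q where q: "\<tau> = {q}" using s'(2) card_1_singletonE by blast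
    have qV: "q \<in> V2" using face_side[OF s'(1)] t1(2) s' q by blast
    show False using points[OF True _ pV _ qV] no s(1) s'(1) p q by simp
  qed
qed

end

section \<open>Powers of the edge ideal of a join\<close>

abbreviation unit_exponent :: "'v \<Rightarrow> 'v \<Rightarrow> int" where
  "unit_exponent i \<equiv> (\<lambda>v. if v = i then 1 else 0)"

text \<open>The monomials in the \<open>s\<close>-th power of the edge ideal. Exponents are integers, so that the
  shifted degrees of Koszul and Cech complexes can be inserted; a negative exponent is never accepted.\<close>

primrec power_exponent :: "'v set set \<Rightarrow> nat \<Rightarrow> ('v \<Rightarrow> int) \<Rightarrow> bool" where
  "power_exponent E 0 e \<longleftrightarrow> (\<forall>v. 0 \<le> e v)"
| "power_exponent E (Suc s) e \<longleftrightarrow>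
    (\<exists>i j. {i, j} \<in> E \<and> power_exponent E s (\<lambda>v. e v - unit_exponent i v - unit_exponent j v))"

lemma power_exponent_mono:
  "power_exponent E s e \<Longrightarrow> (\<And>v. e v \<le> f v) \<Longrightarrow> power_exponent E s f"
proof (induction s arbitrary: e f)
  case 0
  then show ?case by (meson power_exponent.simps(1) order_trans)
next
  case (Suc s)
  then obtain i j where ij: "{i, j} \<in> E" "power_exponent E s (\<lambda>v. e v - unit_exponent i v - unit_exponent j v)"
    by auto
  have "power_exponent E s (\<lambda>v. f v - unit_exponent i v - unit_exponent j v)"
    by (rule Suc.IH[OF ij(2)]) (use Suc.prems(2) in simp)
  then show ?case using ij(1) by auto
qed

lemma power_exponent_nonneg: "power_exponent E s e \<Longrightarrow> 0 \<le> e v"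
proof (induction s arbitrary: e)
  case (Suc s)
  then obtain i j where "power_exponent E s (\<lambda>v. e v - unit_exponent i v - unit_exponent j v)" by auto
  from Suc.IH[OF this] show ?case by (auto split: if_splits)
qed simp

lemma power_exponent_Suc_imp: "power_exponent E (Suc s) e \<Longrightarrow> power_exponent E s e"
  by (auto elim!: power_exponent_mono)

lemma power_exponent_degree:
  fixes e :: "'v::finite \<Rightarrow> int"
  shows "power_exponent E s e \<Longrightarrow> 2 * int s \<le> (\<Sum>v\<in>UNIV. e v)"
proof (induction s arbitrary: e)
  case 0
  then show ?case by (simp add: sum_nonneg)
next
  case (Suc s)
  then obtain i j where "power_exponent E s (\<lambda>v. e v - unit_exponent i v - unit_exponent j v)" by auto
  from Suc.IH[OF this] show ?case by (simp add: sum_subtractf)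
qed

text \<open>Either one of the \<open>s + 1\<close> edges contains \<open>y\<close>, and the other \<open>s\<close>
  edges fit below \<open>e\<close>; or none does, and any \<open>s\<close> of them fit.\<close>

lemma power_exponent_cancel:
  assumes "power_exponent E (Suc s) (\<lambda>v. e v + unit_exponent y v)" "0 \<le> e y"
  shows "power_exponent E s e"
  using assms
proof (induction s arbitrary: e)
  case 0
  then obtain i j where ij: "\<forall>v. 0 \<le> e v + unit_exponent y v - unit_exponent i v - unit_exponent j v" by auto
  have "0 \<le> e v" for v using spec[OF ij, of v] 0(2) by (cases "v = y") (auto split: if_splits)
  then show ?case by simp
next
  case (Suc s)
  from Suc.prems(1) obtain i j where ij: "{i, j} \<in> E"
    "power_exponent E (Suc s) (\<lambda>v. e v + unit_exponent y v - unit_exponent i v - unit_exponent j v)"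
    unfolding power_exponent.simps(2)[of E "Suc s"] by blast
  show ?case
  proof (cases "y = i \<or> y = j")
    case True
    then show ?thesis by (intro power_exponent_mono[OF ij(2)]) (auto)
  next
    case False
    have "power_exponent E s (\<lambda>v. e v - unit_exponent i v - unit_exponent j v)"
      by (rule Suc.IH, rule power_exponent_mono[OF ij(2)]) (use False Suc.prems(2) in auto)
    then show ?thesis using ij(1) by auto
  qed
qed

locale join_graph =
  fixes E :: "'v::finite set set" and V1 V2 :: "'v set"
  assumes edges: "\<And>e. e \<in> E \<Longrightarrow> card e = 2"
    and cover: "V1 \<union> V2 = UNIV" and disjoint: "V1 \<inter> V2 = {}"
    and nonempty: "V1 \<noteq> {}" "V2 \<noteq> {}"
    and complete: "\<And>u v. u \<in> V1 \<Longrightarrow> v \<in> V2 \<Longrightarrow> {u, v} \<in> E"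
begin

lemma swap: "join_graph E V2 V1"
proof
  show "{u, v} \<in> E" if "u \<in> V2" "v \<in> V1" for u v
    using complete[OF that(2,1)] by (simp add: insert_commute)
qed (use edges cover disjoint nonempty in auto)

lemma edge_distinct: "{i, j} \<in> E \<Longrightarrow> i \<noteq> j"
  using edges[of "{i, j}"] by auto

text \<open>An edge uses a vertex at most once, so \<open>s\<close> edges use it at most \<open>s\<close>
  times.\<close>

lemma power_exponent_truncate:
  "power_exponent E s e \<Longrightarrow> int s \<le> N \<Longrightarrow> power_exponent E s (\<lambda>v. min (e v) N)"
proof (induction s arbitrary: e N)
  case (Suc s)
  then obtain i j where ij: "{i, j} \<in> E" "power_exponent E s (\<lambda>v. e v - unit_exponent i v - unit_exponent j v)"
    by auto
  have "power_exponent E s (\<lambda>v. min (e v - unit_exponent i v - unit_exponent j v) (N - 1))"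
    by (rule Suc.IH[OF ij(2)]) (use Suc.prems(2) in simp)
  then have "power_exponent E s (\<lambda>v. min (e v) N - unit_exponent i v - unit_exponent j v)"
    by (rule power_exponent_mono) (use edge_distinct[OF ij(1)] in auto)
  then show ?case using ij(1) by auto
qed simp

text \<open>After localization at \<open>u\<close> the exponent of \<open>u\<close> is unlimited and the edge ideal
  contains the neighbour \<open>y\<close>.\<close>

lemma power_exponent_add:
  assumes "power_exponent E s e" "{u, y} \<in> E" "int s < e u"
  shows "power_exponent E (Suc s) (\<lambda>v. e v + unit_exponent y v)"
proof -
  have "power_exponent E s (\<lambda>v. e v + unit_exponent y v - unit_exponent u v - unit_exponent y v)"
    by (rule power_exponent_mono[OF power_exponent_truncate[OF assms(1) order_refl]]) (use assms(3) in auto)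
  then show ?thesis using assms(2) unfolding power_exponent.simps by blast
qed

text \<open>Here \<open>s\<close> disjoint edges between the two sides can be chosen greedily.\<close>

lemma power_exponent_bipartite:
  assumes "\<And>v. 0 \<le> e v" "int s \<le> (\<Sum>v\<in>V1. e v)" "int s \<le> (\<Sum>v\<in>V2. e v)"
  shows "power_exponent E s e"
  using assms
proof (induction s arbitrary: e)
  case (Suc s)
  obtain u where u: "u \<in> V1" "0 < e u"
    using Suc.prems(2) sum_nonpos[of V1 e] by force
  obtain v where v: "v \<in> V2" "0 < e v"
    using Suc.prems(3) sum_nonpos[of V2 e] by force
  have uv: "u \<notin> V2" "v \<notin> V1" using u v disjoint by auto
  have "power_exponent E s (\<lambda>w. e w - unit_exponent u w - unit_exponent v w)"
  proof (rule Suc.IH)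
    show "0 \<le> e w - unit_exponent u w - unit_exponent v w" for w
      using u v uv Suc.prems(1)[of w] by auto
    show "int s \<le> (\<Sum>w\<in>V1. e w - unit_exponent u w - unit_exponent v w)"
      "int s \<le> (\<Sum>w\<in>V2. e w - unit_exponent u w - unit_exponent v w)"
      using u v uv Suc.prems(2,3) by (simp_all add: sum_subtractf sum.delta)
  qed
  then show ?case using complete[OF u(1) v(1)] by auto
qed simp

lemma exponent_predicate_power: "int s \<le> N \<Longrightarrow> exponent_predicate (power_exponent E s) N"
  using power_exponent_mono power_exponent_truncate by unfold_locales blast+

text \<open>The exponent \<open>N\<close> means that the variables in \<open>\<sigma>\<close> are inverted.\<close>

abbreviation localized :: "int \<Rightarrow> ('v \<Rightarrow> int) \<Rightarrow> 'v set \<Rightarrow> 'v \<Rightarrow> int" where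
  "localized N a \<sigma> \<equiv> (\<lambda>v. if v \<in> \<sigma> then N else a v)"

lemma power_exponent_localized_both:
  assumes "\<And>v. v \<notin> \<sigma> \<Longrightarrow> 0 \<le> a v" "int s \<le> N" "u \<in> \<sigma>" "u \<in> V1" "v \<in> \<sigma>" "v \<in> V2"
  shows "power_exponent E s (localized N a \<sigma>)"
proof (rule power_exponent_bipartite)
  show n: "0 \<le> localized N a \<sigma> w" for w using assms(1,2) by auto
  have "localized N a \<sigma> u \<le> (\<Sum>v\<in>V1. localized N a \<sigma> v)"
    by (rule member_le_sum) (use n assms in auto)
  moreover have "localized N a \<sigma> v \<le> (\<Sum>v\<in>V2. localized N a \<sigma> v)"
    by (rule member_le_sum) (use n assms in auto)
  ultimately show "int s \<le> (\<Sum>v\<in>V1. localized N a \<sigma> v)" "int s \<le> (\<Sum>v\<in>V2. localized N a \<sigma> v)"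
    using assms by simp_all
qed

text \<open>The key point: at a place where a neighbour of \<open>y\<close> is inverted, the powers of the ideal
  behave like the powers of an ideal that contains the variable \<open>y\<close>, and passing from \<open>s\<close> to
  \<open>s + 1\<close> is compensated exactly by multiplication with \<open>y\<close>.\<close>

lemma power_exponent_localized_shift:
  assumes "y \<notin> \<sigma>" "0 \<le> a y" "u \<in> \<sigma>" "{u, y} \<in> E" "int s < N"
  shows "power_exponent E (Suc s) (localized N (\<lambda>v. a v + unit_exponent y v) \<sigma>)
    \<longleftrightarrow> power_exponent E s (localized N a \<sigma>)"
proof -
  have eq: "localized N (\<lambda>v. a v + unit_exponent y v) \<sigma> = (\<lambda>v. localized N a \<sigma> v + unit_exponent y v)"
    using assms(1) by auto
  show ?thesis unfolding eq
    using power_exponent_cancel[of E s "localized N a \<sigma>" y] power_exponent_add[of s "localized N a \<sigma>" u y] assms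
    by auto
qed

lemma power_exponent_localized_cancel:
  assumes "power_exponent E (Suc s) (localized N (\<lambda>v. a v + unit_exponent y v) \<sigma>)" "0 \<le> a y"
  shows "power_exponent E s (localized N a \<sigma>)"
proof (cases "y \<in> \<sigma>")
  case True
  have eq: "localized N (\<lambda>v. a v + unit_exponent y v) \<sigma> = localized N a \<sigma>"
    using True by auto
  show ?thesis using assms(1) unfolding eq by (rule power_exponent_Suc_imp)
next
  case False
  have eq: "localized N (\<lambda>v. a v + unit_exponent y v) \<sigma> = (\<lambda>v. localized N a \<sigma> v + unit_exponent y v)"
    using False by auto
  show ?thesis by (rule power_exponent_cancel[of E s _ y]) (use assms False eq in auto)
qed

abbreviation cech_family :: "int \<Rightarrow> nat \<Rightarrow> ('v \<Rightarrow> int) \<Rightarrow> 'v set set" where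
  "cech_family N s a \<equiv> cube_family (power_exponent E s) a (\<lambda>v. N)"

lemma cech_value:
  "cohomology_nonzero K (cech_family N s a) m \<Longrightarrow> (\<And>v. a v \<le> N) \<Longrightarrow>
    (\<Sum>v\<in>UNIV. a v) + m \<in> cube_values K (power_exponent E s) N UNIV"
  unfolding cube_values_def by force

lemma cech_nonzero_less:
  assumes "cohomology_nonzero K (cech_family N s a) m" "int s \<le> N"
  shows "a v < N"
  using exponent_predicate.cube_family_acyclic[OF exponent_predicate_power[OF assms(2)], of a v "\<lambda>v. N" K m] assms(1)
  by (meson not_le order_refl)

lemma mem_cech_family: "\<sigma> \<in> cech_family N s a \<longleftrightarrow> power_exponent E s (localized N a \<sigma>)"
  by (simp add: cube_family_def)

lemma cech_family_up_closed: "int s \<le> N \<Longrightarrow> (\<And>v. a v \<le> N) \<Longrightarrow> up_closed (cech_family N s a)"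
  by (rule exponent_predicate.up_closed_cube_family[OF exponent_predicate_power])

lemma sum_shift: fixes a :: "'v \<Rightarrow> int" shows "(\<Sum>v\<in>UNIV. a v + unit_exponent y v) = (\<Sum>v\<in>UNIV. a v) + 1"
  by (simp add: sum.distrib)

lemma cech_value_shift:
  assumes "cohomology_nonzero K (cech_family N s (\<lambda>v. a v + unit_exponent y v)) m" "\<And>v. a v < N"
  shows "(\<Sum>v\<in>UNIV. a v) + m + 1 \<in> cube_values K (power_exponent E s) N UNIV"
proof -
  have "a v + unit_exponent y v \<le> N" for v using assms(2)[of v] by auto
  then have "(\<Sum>v\<in>UNIV. a v + unit_exponent y v) + m \<in> cube_values K (power_exponent E s) N UNIV"
    by (intro cech_value assms(1))
  then show ?thesis by (simp add: sum_shift algebra_simps)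
qed

text \<open>A negative exponent at \<open>u \<in> V1\<close> forces \<open>u\<close> to be inverted, so shifting by
  some \<open>y \<in> V2\<close> does not change the family.\<close>

lemma cech_step_negative:
  assumes nz: "cohomology_nonzero K (cech_family N s a) m" and N: "int s < N"
    and neg: "u \<in> V1" "a u < 0" and nonneg: "\<And>v. v \<in> V2 \<Longrightarrow> 0 \<le> a v"
  shows "(\<Sum>v\<in>UNIV. a v) + m + 1 \<in> cube_values K (power_exponent E (Suc s)) N UNIV"
proof -
  obtain y where y: "y \<in> V2" using nonempty by blast
  have less: "a v < N" for v using cech_nonzero_less[OF nz] N by simp
  have "\<sigma> \<in> cech_family N (Suc s) (\<lambda>v. a v + unit_exponent y v) \<longleftrightarrow> \<sigma> \<in> cech_family N s a" for \<sigma>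
  proof (cases "\<exists>w. w \<notin> \<sigma> \<and> a w < 0")
    case True
    then obtain w where w: "w \<notin> \<sigma>" "a w < 0" by blast
    then have "w \<noteq> y" using nonneg[OF y] by auto
    then show ?thesis
      using w power_exponent_nonneg[of E "Suc s" "localized N (\<lambda>v. a v + unit_exponent y v) \<sigma>" w]
        power_exponent_nonneg[of E s "localized N a \<sigma>" w] by (auto simp: mem_cech_family)
  next
    case False
    then have pos: "0 \<le> a w" if "w \<notin> \<sigma>" for w using that by force
    have u: "u \<in> \<sigma>" using False neg by blast
    show ?thesis
    proof (cases "\<exists>v\<in>\<sigma>. v \<in> V2")
      case True
      then obtain v where v: "v \<in> \<sigma>" "v \<in> V2" by blast
      have "power_exponent E (Suc s) (localized N (\<lambda>v. a v + unit_exponent y v) \<sigma>)"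
        by (rule power_exponent_localized_both[OF _ _ u neg(1) v]) (use pos N in force)+
      moreover have "power_exponent E s (localized N a \<sigma>)"
        by (rule power_exponent_localized_both[OF _ _ u neg(1) v]) (use pos N in auto)
      ultimately show ?thesis by (simp only: mem_cech_family)
    next
      case False
      then show ?thesis unfolding mem_cech_family
        using power_exponent_localized_shift[where a = a and y = y and \<sigma> = \<sigma> and u = u and N = N and s = s]
          nonneg[OF y] u complete[OF neg(1) y] N y by blast
    qed
  qed
  then have "cech_family N (Suc s) (\<lambda>v. a v + unit_exponent y v) = cech_family N s a" by blast
  then have "cohomology_nonzero K (cech_family N (Suc s) (\<lambda>v. a v + unit_exponent y v)) m" using nz by simp
  from cech_value_shift[OF this less] show ?thesis .
qed

text \<open>With negative exponents on both sides the localized ideal is the unit ideal, so the family is a cone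
  unless every exponent is negative. In that case \<open>\<Sum>a\<close> is at most \<open>- n\<close> and
  \<open>m\<close> at most \<open>n\<close>, for \<open>n\<close> vertices.\<close>

lemma cech_step_both_negative:
  assumes nz: "cohomology_nonzero K (cech_family N s a) m" and N: "int s < N"
    and neg: "u \<in> V1" "a u < 0" "v \<in> V2" "a v < 0"
  shows "(\<Sum>v\<in>UNIV. a v) + m \<le> 0"
proof -
  have mem: "\<sigma> \<in> cech_family N s a \<longleftrightarrow> {w. a w < 0} \<subseteq> \<sigma>" for \<sigma>
  proof
    assume "\<sigma> \<in> cech_family N s a"
    then have "0 \<le> localized N a \<sigma> w" for w
      unfolding mem_cech_family by (rule power_exponent_nonneg)
    then show "{w. a w < 0} \<subseteq> \<sigma>" by (smt (verit) mem_Collect_eq subsetI)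
  next
    assume s: "{w. a w < 0} \<subseteq> \<sigma>"
    have pos: "0 \<le> a w" if "w \<notin> \<sigma>" for w using s that by force
    have "u \<in> \<sigma>" "v \<in> \<sigma>" using s neg by auto
    then show "\<sigma> \<in> cech_family N s a" unfolding mem_cech_family
      using power_exponent_localized_both[of \<sigma> a s N u v] pos neg N by simp
  qed
  have all: "a w < 0" for w
  proof (rule ccontr)
    assume "\<not> a w < 0"
    then have "\<not> cohomology_nonzero K (cech_family N s a) m"
      by (intro cohomology_cone_zero[of w]) (auto simp: mem)
    then show False using nz by simp
  qed
  have "a w \<le> - 1" for w using all[of w] by simp
  then have "(\<Sum>v\<in>UNIV. a v) \<le> (\<Sum>v\<in>(UNIV :: 'v set). - 1)" by (intro sum_mono)
  moreover obtain \<sigma> where "\<sigma> \<in> cech_family N s a" "m = int (card \<sigma>)" using cohomology_nonzero_face[OF nz] .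
  then have "m \<le> int (card (UNIV :: 'v set))" by (simp add: card_mono)
  ultimately show ?thesis by simp
qed


text \<open>Inverting a vertex on each side inverts an edge. So the complement consists of faces inside one of the
  sides; it is the degree complex of the power of the ideal.\<close>

lemma split_complex_cech:
  assumes "int s \<le> N" "\<And>v. a v \<le> N" "\<And>v. 0 \<le> a v"
  shows "split_complex (- cech_family N s a) V1 V2"
proof
  show "- cech_family N s a \<subseteq> Pow V1 \<union> Pow V2"
  proof (rule subsetI, rule ccontr)
    fix \<sigma> assume s: "\<sigma> \<in> - cech_family N s a" "\<sigma> \<notin> Pow V1 \<union> Pow V2"
    then obtain u v where "u \<in> \<sigma>" "u \<in> V1" "v \<in> \<sigma>" "v \<in> V2" using cover by auto
    then have "power_exponent E s (localized N a \<sigma>)"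
      using power_exponent_localized_both[of \<sigma> a s N u v] assms by blast
    then show False using s(1) by (simp add: mem_cech_family)
  qed
  show "\<tau> \<in> - cech_family N s a" if "\<sigma> \<in> - cech_family N s a" "\<tau> \<subseteq> \<sigma>" for \<sigma> \<tau>
    using up_closedD[OF cech_family_up_closed[of s N a]] assms that by blast
qed (rule disjoint)

lemma cech_nonzero_iff_complement:
  "int s \<le> N \<Longrightarrow> (\<And>v. a v \<le> N) \<Longrightarrow> cohomology_nonzero K (cech_family N s a) m
    \<longleftrightarrow> complex_cohomology_nonzero K (- cech_family N s a) (m - 1)"
  by (rule cohomology_nonzero_iff_complement[OF cech_family_up_closed])

text \<open>A factor \<open>y\<close> of a monomial can be dropped together with one edge, so the degree complex can
  only grow.\<close>

lemma complement_shift_mono: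
  "0 \<le> a y \<Longrightarrow> - cech_family N s a \<subseteq> - cech_family N (Suc s) (\<lambda>v. a v + unit_exponent y v)"
  using power_exponent_localized_cancel[where s = s and N = N and a = a and y = y]
  unfolding subset_iff Compl_iff mem_cech_family by blast

text \<open>A class on the \<open>V1\<close>-part survives the shift by \<open>y \<in> V2\<close>, which leaves that
  part of the degree complex unchanged.\<close>

lemma cech_step_part:
  assumes N: "int s < N" and a: "\<And>v. 0 \<le> a v" "\<And>v. a v < N" and m: "1 \<le> m"
    and w: "w \<in> cochains (- cech_family N s a) m" "\<forall>\<sigma>\<in>- cech_family N s a. coboundary w \<sigma> = (0 :: 'k::field)"
    and nt: "\<not> (\<exists>t\<in>cochains UNIV (m - 1). \<forall>\<sigma>\<in>- cech_family N s a. \<sigma> \<subseteq> V1 \<longrightarrow> \<sigma> \<noteq> {} \<longrightarrow> w \<sigma> = coboundary t \<sigma>)"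
  shows "(\<Sum>v\<in>UNIV. a v) + (m + 1) + 1 \<in> cube_values (K :: 'k itself) (power_exponent E (Suc s)) N UNIV"
proof -
  obtain y where y: "y \<in> V2" using nonempty by blast
  define a' where "a' = (\<lambda>v. a v + unit_exponent y v)"
  have a': "a' v \<le> N" "0 \<le> a' v" for v using a[of v] by (auto simp: a'_def)
  have N': "int (Suc s) \<le> N" using N by simp
  interpret split_complex "- cech_family N (Suc s) a'" V1 V2
    by (rule split_complex_cech[OF N' a'])
  have "complex_cohomology_nonzero K (- cech_family N (Suc s) a') m"
  proof (rule extend_class[OF _ _ w m nt])
    show "- cech_family N s a \<subseteq> - cech_family N (Suc s) a'"
      unfolding a'_def by (rule complement_shift_mono[OF a(1)])
    show "\<sigma> \<in> - cech_family N s a" if s: "\<sigma> \<in> - cech_family N (Suc s) a'" "\<sigma> \<subseteq> V1" "\<sigma> \<noteq> {}" for \<sigma>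
    proof -
      obtain u where u: "u \<in> \<sigma>" using s(3) by blast
      have "y \<notin> \<sigma>" using y s(2) disjoint by auto
      then show ?thesis
        using power_exponent_localized_shift[of y \<sigma> a u s N] u complete[of u y] y s a(1)[of y] N
        unfolding a'_def Compl_iff mem_cech_family by blast
    qed
  qed
  then have "cohomology_nonzero K (cech_family N (Suc s) a') (m + 1)"
    using cech_nonzero_iff_complement[of "Suc s" N a' K "m + 1"] N' a'(1) by simp
  then show ?thesis unfolding a'_def by (rule cech_value_shift[OF _ a(2)])
qed

text \<open>The class that separates the two parts survives because neither part becomes empty.\<close>

lemma cech_step_points:
  assumes N: "int s < N" and a: "\<And>v. 0 \<le> a v" "\<And>v. a v < N"
    and pq: "{p} \<in> - cech_family N s a" "p \<in> V1" "{q} \<in> - cech_family N s a" "q \<in> V2"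
  shows "(\<Sum>v\<in>UNIV. a v) + 2 + 1 \<in> cube_values (K :: 'k::field itself) (power_exponent E (Suc s)) N UNIV"
proof -
  define a' where "a' = (\<lambda>v. a v + unit_exponent q v)"
  have a': "a' v \<le> N" "0 \<le> a' v" for v using a[of v] by (auto simp: a'_def)
  have N': "int (Suc s) \<le> N" using N by simp
  interpret split_complex "- cech_family N (Suc s) a'" V1 V2
    by (rule split_complex_cech[OF N' a'])
  have sub: "- cech_family N s a \<subseteq> - cech_family N (Suc s) a'"
    unfolding a'_def by (rule complement_shift_mono[OF a(1)])
  have "complex_cohomology_nonzero K (- cech_family N (Suc s) a') 1"
    by (rule two_parts_nonzero[OF subsetD[OF sub pq(1)] pq(2) subsetD[OF sub pq(3)] pq(4)])
  then have "cohomology_nonzero K (cech_family N (Suc s) a') 2"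
    using cech_nonzero_iff_complement[of "Suc s" N a' K 2] N' a'(1) by simp
  then show ?thesis unfolding a'_def by (rule cech_value_shift[OF _ a(2)])
qed

text \<open>The degree complex consists of the empty face: the monomial is in the saturation of the power but not in
  the power itself.\<close>

lemma empty_face_nonzero:
  assumes "{} \<in> - cech_family N s a" "\<And>v. {v} \<in> cech_family N s a" "int s \<le> N" "\<And>v. a v \<le> N"
  shows "cohomology_nonzero (K :: 'k::field itself) (cech_family N s a) 1"
proof -
  let ?D = "- cech_family N s a"
  have D: "?D = {{}}"
  proof -
    have "\<sigma> \<in> cech_family N s a" if ne: "\<sigma> \<noteq> {}" for \<sigma>
    proof -
      obtain v where "{v} \<subseteq> \<sigma>" using ne by blast
      then show ?thesis using up_closedD[OF cech_family_up_closed[of s N a] assms(2)] assms by blast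
    qed
    then show ?thesis using assms(1) by blast
  qed
  define w :: "'v set \<Rightarrow> 'k" where "w = (\<lambda>\<sigma>. if \<sigma> = {} then 1 else 0)"
  have "w \<in> cochains ?D 0" unfolding D by (auto simp: w_def cochains_def)
  moreover have "\<forall>\<sigma>\<in>?D. coboundary w \<sigma> = 0" unfolding D by simp
  moreover have "\<not> (\<exists>t\<in>cochains UNIV (0 - 1). \<forall>\<sigma>\<in>?D. w \<sigma> = coboundary t \<sigma>)"
    unfolding D by (simp add: w_def)
  ultimately have "complex_cohomology_nonzero K ?D 0" unfolding complex_cohomology_nonzero_def by blast
  then show ?thesis using cech_nonzero_iff_complement[of s N a K 1] assms by simp
qed

text \<open>Shifting by \<open>y \<in> V2\<close> keeps the monomial outside the next power. It stays in the
  saturation: localization at a vertex of \<open>V1\<close> is compensated by \<open>y\<close>, and after localization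
  at a vertex of \<open>V2\<close> there are \<open>s + 1\<close> edges between the sides, since the degree in
  \<open>V1\<close> exceeds \<open>s\<close>.\<close>

lemma cech_step_empty_large:
  assumes N: "int s < N" and a: "\<And>v. 0 \<le> a v" "\<And>v. a v < N"
    and empty: "{} \<in> - cech_family N s a" and points: "\<And>v. {v} \<in> cech_family N s a"
    and large: "int s < (\<Sum>v\<in>V1. a v)"
  shows "(\<Sum>v\<in>UNIV. a v) + 1 + 1 \<in> cube_values (K :: 'k::field itself) (power_exponent E (Suc s)) N UNIV"
proof -
  obtain y where y: "y \<in> V2" using nonempty by blast
  define a' where "a' = (\<lambda>v. a v + unit_exponent y v)"
  have a': "a' v \<le> N" "0 \<le> a' v" for v using a[of v] by (auto simp: a'_def)
  have "cohomology_nonzero K (cech_family N (Suc s) a') 1"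
  proof (rule empty_face_nonzero)
    show "{} \<in> - cech_family N (Suc s) a'"
      unfolding a'_def using subsetD[OF complement_shift_mono[where a = a and y = y, OF a(1)] empty] .
    show "{x} \<in> cech_family N (Suc s) a'" for x
    proof (cases "x \<in> V1")
      case True
      then have "y \<notin> {x}" using y disjoint by auto
      then show ?thesis
        using power_exponent_localized_shift[of y "{x}" a x s N] complete[OF True y] a(1)[of y] N points[of x]
        unfolding a'_def mem_cech_family by blast
    next
      case False
      then have x: "x \<in> V2" using cover by auto
      show ?thesis unfolding mem_cech_family
      proof (rule power_exponent_bipartite)
        show n: "0 \<le> localized N a' {x} v" for v using a' N by auto
        have "(\<Sum>v\<in>V1. localized N a' {x} v) = (\<Sum>v\<in>V1. a v)"
          by (rule sum.cong) (use False y disjoint in \<open>auto simp: a'_def\<close>)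
        then show "int (Suc s) \<le> (\<Sum>v\<in>V1. localized N a' {x} v)" using large by simp
        have "localized N a' {x} x \<le> (\<Sum>v\<in>V2. localized N a' {x} v)"
          by (rule member_le_sum[OF x n]) simp
        then show "int (Suc s) \<le> (\<Sum>v\<in>V2. localized N a' {x} v)" using N by simp
      qed
    qed
  qed (use N a' in auto)
  then show ?thesis unfolding a'_def by (rule cech_value_shift[OF _ a(2)])
qed

text \<open>Multiplication with a whole edge keeps the monomial in the saturation, and its degree remains below
  \<open>2 (s + 1)\<close>, the initial degree of the next power.\<close>

lemma cech_step_empty_small:
  assumes N: "int s < N" and a: "\<And>v. 0 \<le> a v" "\<And>v. a v < N"
    and points: "\<And>v. {v} \<in> cech_family N s a"
    and small: "(\<Sum>v\<in>UNIV. a v) < 2 * int s"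
  shows "(\<Sum>v\<in>UNIV. a v) + 1 + 2 \<in> cube_values (K :: 'k::field itself) (power_exponent E (Suc s)) N UNIV"
proof -
  obtain x y where xy: "x \<in> V1" "y \<in> V2" using nonempty by blast
  have ne: "x \<noteq> y" using xy disjoint by auto
  have edge: "{x, y} \<in> E" "{y, x} \<in> E" using complete[OF xy] by (auto simp: insert_commute)
  define a' where "a' = (\<lambda>v. a v + unit_exponent x v + unit_exponent y v)"
  have sum': "(\<Sum>v\<in>UNIV. a' v) = (\<Sum>v\<in>UNIV. a v) + 2" by (simp add: a'_def sum.distrib)
  have a': "a' v \<le> N" for v using a(2)[of v] ne by (auto simp: a'_def)
  have "cohomology_nonzero K (cech_family N (Suc s) a') 1"
  proof (rule empty_face_nonzero)
    show "{} \<in> - cech_family N (Suc s) a'"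
      using power_exponent_degree[of E "Suc s" a'] small sum' unfolding Compl_iff mem_cech_family by auto
    show "{z} \<in> cech_family N (Suc s) a'" for z
    proof -
      have p: "power_exponent E s (localized N a {z})" using points[of z] unfolding mem_cech_family .
      consider "z = x" | "z = y" | "z \<noteq> x" "z \<noteq> y" by blast
      then show ?thesis
      proof cases
        case 1
        have "localized N a' {z} = (\<lambda>v. localized N a {z} v + unit_exponent y v)"
          using 1 ne by (auto simp: a'_def)
        then show ?thesis unfolding mem_cech_family
          using power_exponent_add[OF p, of x y] edge 1 N by simp
      next
        case 2
        have "localized N a' {z} = (\<lambda>v. localized N a {z} v + unit_exponent x v)"
          using 2 ne by (auto simp: a'_def)
        then show ?thesis unfolding mem_cech_family
          using power_exponent_add[OF p, of y x] edge 2 N by simp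
      next
        case 3
        have eq: "(\<lambda>v. localized N a' {z} v - unit_exponent x v - unit_exponent y v) = localized N a {z}"
          using 3 by (auto simp: a'_def)
        have "power_exponent E s (\<lambda>v. localized N a' {z} v - unit_exponent x v - unit_exponent y v)"
          unfolding eq by (rule p)
        then show ?thesis unfolding mem_cech_family power_exponent.simps using edge(1) by blast
      qed
    qed
  qed (use N a' in auto)
  then have "(\<Sum>v\<in>UNIV. a' v) + 1 \<in> cube_values K (power_exponent E (Suc s)) N UNIV" by (rule cech_value[OF _ a'])
  then show ?thesis by (simp add: sum' algebra_simps)
qed

text \<open>In the case of the empty face, if both sides had degree at least \<open>s\<close>, then the monomial would
  lie in the \<open>s\<close>-th power. So either the total degree is less than \<open>2 s\<close> or one side has
  degree more than \<open>s\<close>.\<close>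

lemma cech_step_nonneg:
  assumes nz: "cohomology_nonzero (K :: 'k::field itself) (cech_family N s a) m" and N: "int s < N"
    and a: "\<And>v. 0 \<le> a v"
  shows "\<exists>r\<in>cube_values K (power_exponent E (Suc s)) N UNIV. (\<Sum>v\<in>UNIV. a v) + m + 1 \<le> r"
proof -
  interpret opposite: join_graph E V2 V1 by (rule swap)
  have less: "a v < N" for v using cech_nonzero_less[OF nz] N by simp
  have le: "a v \<le> N" for v using less[of v] by simp
  have N': "int s \<le> N" using N by simp
  let ?D = "- cech_family N s a"
  interpret split_complex ?D V1 V2 by (rule split_complex_cech[OF N' le a])
  have nzD: "complex_cohomology_nonzero K ?D (m - 1)"
    using nz cech_nonzero_iff_complement[of s N a K m] N' le by blast
  consider "m - 1 \<ge> 1" | "m = 1" | "m - 1 < 0" by linarith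
  then show ?thesis
  proof cases
    case 1
    from nzD 1 show ?thesis
    proof (cases rule: nonzero_cases)
      case (part w)
      from part(3) have "(\<Sum>v\<in>UNIV. a v) + (m - 1 + 1) + 1 \<in> cube_values K (power_exponent E (Suc s)) N UNIV"
      proof
        assume "\<not> (\<exists>t\<in>cochains UNIV (m - 1 - 1). \<forall>\<sigma>\<in>?D. \<sigma> \<subseteq> V1 \<longrightarrow> \<sigma> \<noteq> {} \<longrightarrow> w \<sigma> = coboundary t \<sigma>)"
        then show ?thesis by (rule cech_step_part[OF N a less 1 part(1,2)])
      next
        assume "\<not> (\<exists>t\<in>cochains UNIV (m - 1 - 1). \<forall>\<sigma>\<in>?D. \<sigma> \<subseteq> V2 \<longrightarrow> \<sigma> \<noteq> {} \<longrightarrow> w \<sigma> = coboundary t \<sigma>)"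
        then show ?thesis by (rule opposite.cech_step_part[OF N a less 1 part(1,2)])
      qed
      then show ?thesis by (intro bexI) simp_all
    next
      case (points p q)
      have "m = 2" using points(1) by simp
      then show ?thesis using cech_step_points[OF N a less points(2-), of K] by auto
    qed
  next
    case 2
    obtain w where w: "w \<in> cochains ?D 0" "\<forall>\<sigma>\<in>?D. coboundary w \<sigma> = (0 :: 'k)"
      and nt: "\<not> (\<exists>t\<in>cochains UNIV (0 - 1). \<forall>\<sigma>\<in>?D. w \<sigma> = coboundary t \<sigma>)"
      using nzD 2 unfolding complex_cohomology_nonzero_def by auto
    have "\<exists>\<sigma>\<in>?D. w \<sigma> \<noteq> coboundary (\<lambda>\<sigma>. 0) \<sigma>"
    proof -
      have "(\<lambda>\<sigma>. 0) \<in> cochains UNIV (0 - 1)" by (simp add: cochains_def)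
      then show ?thesis using nt by blast
    qed
    then obtain \<sigma> where s: "\<sigma> \<in> ?D" "w \<sigma> \<noteq> 0" by auto
    then have e: "\<sigma> = {}" using cochainsD[OF w(1) s(2)] by simp
    have points: "{v} \<in> cech_family N s a" for v
    proof (rule ccontr)
      assume "{v} \<notin> cech_family N s a"
      then have "coboundary w {v} = 0" using w(2) by blast
      then show False using s(2) e by simp
    qed
    have empty: "{} \<in> ?D" using s e by simp
    have npe: "\<not> power_exponent E s a" using empty by (simp add: mem_cech_family)
    have sums: "(\<Sum>v\<in>UNIV. a v) = (\<Sum>v\<in>V1. a v) + (\<Sum>v\<in>V2. a v)"
      using sum.union_disjoint[of V1 V2 a] join_graph.disjoint[OF join_graph_axioms] cover by simp
    have "\<not> (int s \<le> (\<Sum>v\<in>V1. a v) \<and> int s \<le> (\<Sum>v\<in>V2. a v))"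
      using power_exponent_bipartite[of a s] npe a by blast
    then consider "(\<Sum>v\<in>UNIV. a v) < 2 * int s" | "int s < (\<Sum>v\<in>V1. a v)" | "int s < (\<Sum>v\<in>V2. a v)"
      using sums by linarith
    then show ?thesis
    proof cases
      case 1
      then show ?thesis using cech_step_empty_small[OF N a less points 1, of K] 2 by (intro bexI) auto
    next
      case lg: 2
      then show ?thesis using cech_step_empty_large[OF N a less empty points lg, of K] 2 by (intro bexI) auto
    next
      case lg: 3
      then show ?thesis using opposite.cech_step_empty_large[OF N a less empty points lg, of K] 2 by (intro bexI) auto
    qed
  next
    case 3
    have "\<exists>t\<in>cochains UNIV (m - 1 - 1). \<forall>\<sigma>\<in>?D. w \<sigma> = coboundary t \<sigma>" if w: "w \<in> cochains ?D (m - 1)" for w :: "'v set \<Rightarrow> 'k"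
    proof -
      have "w \<sigma> = 0" for \<sigma> using cochain_zero_card[OF w, of \<sigma>] 3 by linarith
      then show ?thesis by (intro bexI[of _ "\<lambda>\<sigma>. 0"]) (auto simp: cochains_def)
    qed
    then show ?thesis using nzD unfolding complex_cohomology_nonzero_def by blast
  qed
qed

lemma cech_step:
  assumes r: "r \<in> cube_values (K :: 'k::field itself) (power_exponent E s) N UNIV" and N: "int s < N"
  shows "r \<le> 0 \<or> (\<exists>r'\<in>cube_values K (power_exponent E (Suc s)) N UNIV. r + 1 \<le> r')"
proof -
  interpret opposite: join_graph E V2 V1 by (rule swap)
  obtain a m where a: "r = (\<Sum>v\<in>UNIV. a v) + m" "cohomology_nonzero K (cech_family N s a) m"
    using r unfolding cube_values_def by auto
  consider "\<And>v. 0 \<le> a v" | u v where "u \<in> V1" "a u < 0" "v \<in> V2" "a v < 0"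
    | u where "u \<in> V1" "a u < 0" "\<And>v. v \<in> V2 \<Longrightarrow> 0 \<le> a v"
    | u where "u \<in> V2" "a u < 0" "\<And>v. v \<in> V1 \<Longrightarrow> 0 \<le> a v"
    using cover by (metis UNIV_I Un_iff not_le)
  then show ?thesis
  proof cases
    case 1
    then show ?thesis using cech_step_nonneg[OF a(2) N] a(1) by blast
  next
    case 2
    then show ?thesis using cech_step_both_negative[OF a(2) N] a(1) by blast
  next
    case 3
    then show ?thesis using cech_step_negative[OF a(2) N] a(1) by (metis order_refl)
  next
    case 4
    then show ?thesis using opposite.cech_step_negative[OF a(2) N] a(1) by (metis order_refl)
  qed
qed

text \<open>For \<open>W = {}\<close> the bound \<open>N\<close> does not occur in \<open>cube_values\<close>; 0 is a
  dummy.\<close>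

abbreviation koszul_values :: "'k::field itself \<Rightarrow> nat \<Rightarrow> int set" where
  "koszul_values K s \<equiv> cube_values K (power_exponent E s) 0 {}"

lemma cube_values_empty: "cube_values K P N {} = cube_values K P N' {}"
  by (simp add: cube_values_def)

text \<open>The minimal generator \<open>(x\<^sub>u x\<^sub>v)\<^sup>s\<close> gives a nonzero
  \<open>Tor\<^sub>0\<close>: in its multidegree the family consists of the full face only.\<close>

lemma generator_value: "2 * int s \<in> koszul_values (K :: 'k::field itself) s"
proof -
  obtain x y where xy: "x \<in> V1" "y \<in> V2" using nonempty by blast
  have ne: "x \<notin> V2" "y \<notin> V1" using xy disjoint by auto
  \<comment> \<open>The multidegree of the generator \<open>(x y)\<^sup>s\<close>; removing any vertex from the full face drops below the initial degree \<open>2 s\<close>.\<close>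
  define b where "b = (\<lambda>v. int s * (unit_exponent x v + unit_exponent y v))"
  have sum_b: "(\<Sum>v\<in>UNIV. b v) = 2 * int s"
    by (simp add: b_def sum.distrib flip: sum_distrib_left)
  let ?S = "cube_family (power_exponent E s) (\<lambda>v. b v - 1) b"
  have S: "?S = {UNIV}"
  proof -
    have "power_exponent E s b"
      by (rule power_exponent_bipartite) (use xy ne in \<open>simp_all add: b_def sum.distrib flip: sum_distrib_left\<close>)
    then have "UNIV \<in> ?S" by (simp add: cube_family_def)
    moreover have "\<sigma> = UNIV" if "\<sigma> \<in> ?S" for \<sigma>
    proof (rule ccontr)
      assume "\<sigma> \<noteq> UNIV"
      then obtain v where v: "v \<notin> \<sigma>" by blast
      have "2 * int s \<le> (\<Sum>v\<in>UNIV. if v \<in> \<sigma> then b v else b v - 1)"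
        using that power_exponent_degree unfolding cube_family_def by blast
      also have "\<dots> < (\<Sum>v\<in>UNIV. b v)"
        by (rule sum_strict_mono_ex1) (use v in auto)
      finally show False using sum_b by simp
    qed
    ultimately show ?thesis by blast
  qed
  define z :: "'v set \<Rightarrow> 'k" where "z = (\<lambda>\<sigma>. if \<sigma> = UNIV then 1 else 0)"
  have "coboundary z = (\<lambda>\<sigma>. 0)"
  proof
    fix \<sigma> :: "'v set"
    show "coboundary z \<sigma> = 0" unfolding coboundary_def by (rule sum.neutral) (auto simp: z_def)
  qed
  moreover have "z \<in> cochains ?S (int (card (UNIV :: 'v set)))" unfolding S by (auto simp: z_def cochains_def)
  moreover have "z \<noteq> coboundary t" if t: "t \<in> cochains ?S (int (card (UNIV :: 'v set)) - 1)" for t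
  proof -
    have "t = (\<lambda>\<sigma>. 0)" using t unfolding S cochains_def by fastforce
    moreover have "z UNIV \<noteq> 0" by (simp add: z_def)
    ultimately show ?thesis by auto
  qed
  ultimately have "cohomology_nonzero K ?S (int (card (UNIV :: 'v set)))"
    unfolding cohomology_nonzero_def by blast
  then have "(\<Sum>v\<in>UNIV. b v - 1) + int (card (UNIV :: 'v set)) \<in> koszul_values K s"
    unfolding cube_values_def by (intro CollectI exI conjI) auto
  then show ?thesis by (simp add: sum_subtractf sum_b)
qed

lemma koszul_values_bounded: "\<exists>B. \<forall>r\<in>koszul_values K s. r \<le> B"
  using exponent_predicate.koszul_value_imp_cech_value[OF exponent_predicate_power[of s "int s"]]
    exponent_predicate.cech_value_bounded[OF exponent_predicate_power[of s "int s"]]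
    cube_values_empty[of K _ 0 "int s"] by blast

text \<open>The values at most 0, which the Cech side does not control, are covered by the generators of the next
  power.\<close>

lemma koszul_step:
  assumes r: "r \<in> koszul_values K s"
  shows "\<exists>r'\<in>koszul_values K (Suc s). r < r'"
proof -
  \<comment> \<open>Large enough to stand for infinity for both powers.\<close>
  define N where "N = int s + 1"
  have N: "int s < N" by (simp add: N_def)
  interpret p: exponent_predicate "power_exponent E s" N by (rule exponent_predicate_power) (simp add: N_def)
  interpret q: exponent_predicate "power_exponent E (Suc s)" N by (rule exponent_predicate_power) (simp add: N_def)
  have "r \<in> cube_values K (power_exponent E s) N UNIV"
    using p.koszul_value_imp_cech_value r cube_values_empty by blast
  from cech_step[OF this N] show ?thesis
  proof
    assume "r \<le> 0"
    then show ?thesis using generator_value[of "Suc s" K] by (intro bexI[of _ "2 * int (Suc s)"]) simp_all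
  next
    assume "\<exists>r'\<in>cube_values K (power_exponent E (Suc s)) N UNIV. r + 1 \<le> r'"
    then obtain r' where r': "r' \<in> cube_values K (power_exponent E (Suc s)) N UNIV" "r < r'" by auto
    obtain r'' where "r'' \<in> cube_values K (power_exponent E (Suc s)) N {}" "r' \<le> r''"
      using q.cech_value_le_koszul_value[OF r'(1)] by blast
    then show ?thesis using r'(2) cube_values_empty by (metis order_less_le_trans)
  qed
qed

end

section \<open>Graded matrices and comparison of resolutions\<close>

lemma mono_degree_add: "mono_degree (m + m') = mono_degree m + mono_degree m'"
  by (simp add: mono_degree_def lookup_add sum.distrib)

lemma homogeneous_zero [simp]: "0 \<in> homogeneous j"
  by (simp add: homogeneous_def)

lemma homogeneous_add: "p \<in> homogeneous j \<Longrightarrow> q \<in> homogeneous j \<Longrightarrow> p + q \<in> homogeneous j"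
  using keys_add[of p q] by (auto simp: homogeneous_def)

lemma homogeneous_minus: "p \<in> homogeneous j \<Longrightarrow> - p \<in> homogeneous j"
  by (simp add: homogeneous_def)

lemma homogeneous_diff: "p \<in> homogeneous j \<Longrightarrow> q \<in> homogeneous j \<Longrightarrow> p - q \<in> homogeneous j"
  using homogeneous_add[of p j "- q"] homogeneous_minus[of q j] by simp

lemma homogeneous_mult:
  assumes "p \<in> homogeneous i" "q \<in> homogeneous j"
  shows "p * q \<in> homogeneous (i + j)"
proof -
  have "int (mono_degree m) = i + j" if m: "m \<in> Poly_Mapping.keys (p * q)" for m
  proof -
    obtain a b where "m = a + b" "a \<in> Poly_Mapping.keys p" "b \<in> Poly_Mapping.keys q"
      using m keys_mult[of p q] by auto
    then show ?thesis using assms by (simp add: homogeneous_def mono_degree_add)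
  qed
  then show ?thesis by (simp add: homogeneous_def)
qed

lemma homogeneous_sum: "(\<And>x. x \<in> A \<Longrightarrow> f x \<in> homogeneous j) \<Longrightarrow> sum f A \<in> homogeneous j"
  by (induction A rule: infinite_finite_induct) (auto intro: homogeneous_add)

lemma homogeneous_one: "1 \<in> homogeneous 0"
  by (auto simp: homogeneous_def mono_degree_def)

definition degree_part :: "int \<Rightarrow> ('v::finite, 'k::field) mpoly \<Rightarrow> ('v, 'k) mpoly" where
  "degree_part j p = Abs_poly_mapping (\<lambda>m. if int (mono_degree m) = j then Poly_Mapping.lookup p m else 0)"

lemma lookup_degree_part:
  "Poly_Mapping.lookup (degree_part j p) m = (if int (mono_degree m) = j then Poly_Mapping.lookup p m else 0)"
proof -
  have "finite {m. (if int (mono_degree m) = j then Poly_Mapping.lookup p m else 0) \<noteq> 0}"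
    by (rule finite_subset[OF _ finite_keys[of p]]) (auto simp: in_keys_iff)
  then show ?thesis by (simp add: degree_part_def)
qed

lemma degree_part_homogeneous: "degree_part j p \<in> homogeneous j"
  by (auto simp: homogeneous_def in_keys_iff lookup_degree_part split: if_splits)

lemma degree_part_add: "degree_part j (p + q) = degree_part j p + degree_part j q"
  by (rule poly_mapping_eqI) (simp add: lookup_degree_part lookup_add)

lemma degree_part_zero [simp]: "degree_part j 0 = 0"
  by (rule poly_mapping_eqI) (simp add: lookup_degree_part)

lemma degree_part_sum: "degree_part j (sum f A) = (\<Sum>x\<in>A. degree_part j (f x))"
  by (induction A rule: infinite_finite_induct) (auto simp: degree_part_add)

lemma degree_part_id: "p \<in> homogeneous j \<Longrightarrow> degree_part j p = p"
  by (rule poly_mapping_eqI) (auto simp: lookup_degree_part homogeneous_def in_keys_iff)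

lemma degree_part_mult:
  assumes q: "q \<in> homogeneous d"
  shows "degree_part j (q * p) = q * degree_part (j - d) p"
proof -
  have 1: "degree_part j (q * (p - degree_part (j - d) p)) = 0"
  proof (rule poly_mapping_eqI)
    fix m
    have "Poly_Mapping.lookup (q * (p - degree_part (j - d) p)) m = 0" if "int (mono_degree m) = j"
    proof (rule ccontr)
      assume "Poly_Mapping.lookup (q * (p - degree_part (j - d) p)) m \<noteq> 0"
      then have "m \<in> Poly_Mapping.keys (q * (p - degree_part (j - d) p))" by (simp add: in_keys_iff)
      then obtain a b where ab: "m = a + b" "a \<in> Poly_Mapping.keys q" "b \<in> Poly_Mapping.keys (p - degree_part (j - d) p)"
        using keys_mult[of q "p - degree_part (j - d) p"] by auto
      then have "int (mono_degree b) = j - d"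
        using that q by (auto simp: homogeneous_def mono_degree_add)
      then show False using ab(3) by (simp add: in_keys_iff lookup_minus lookup_degree_part)
    qed
    then show "Poly_Mapping.lookup (degree_part j (q * (p - degree_part (j - d) p))) m = Poly_Mapping.lookup 0 m"
      by (simp add: lookup_degree_part)
  qed
  have 2: "degree_part j (q * degree_part (j - d) p) = q * degree_part (j - d) p"
    using homogeneous_mult[OF q degree_part_homogeneous, of "j - d" p] by (intro degree_part_id) simp
  have "degree_part j (q * p) = degree_part j (q * (p - degree_part (j - d) p) + q * degree_part (j - d) p)"
    by (simp add: algebra_simps)
  also have "\<dots> = q * degree_part (j - d) p" by (simp only: degree_part_add 1 2 add_0)
  finally show ?thesis .
qed

text \<open>A homogeneous matrix of degree 0 between graded free modules whose generators sit in the degrees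
  \<open>u\<close> and \<open>t\<close>.\<close>

definition graded_mat :: "nat \<Rightarrow> (nat \<Rightarrow> int) \<Rightarrow> nat \<Rightarrow> (nat \<Rightarrow> int) \<Rightarrow> ('v::finite, 'k::field) mpoly mat \<Rightarrow> bool" where
  "graded_mat r t c u A \<longleftrightarrow> A \<in> carrier_mat r c \<and> (\<forall>a<r. \<forall>b<c. A $$ (a, b) \<in> homogeneous (u b - t a))"

lemma graded_mat_carrier: "graded_mat r t c u A \<Longrightarrow> A \<in> carrier_mat r c"
  by (simp add: graded_mat_def)

lemma graded_mat_mult:
  assumes A: "graded_mat r t c u A" and B: "graded_mat c u d v B"
  shows "graded_mat r t d v (A * B)"
  unfolding graded_mat_def
proof (intro conjI allI impI)
  show "A * B \<in> carrier_mat r d" using A B by (auto simp: graded_mat_def)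
  fix a b assume ab: "a < r" "b < d"
  have "(A * B) $$ (a, b) = (\<Sum>i<c. A $$ (a, i) * B $$ (i, b))"
    using A B ab by (auto simp: graded_mat_def scalar_prod_def lessThan_atLeast0 intro!: sum.cong)
  also have "\<dots> \<in> homogeneous (v b - t a)"
  proof (rule homogeneous_sum)
    fix i assume "i \<in> {..<c}"
    then have "A $$ (a, i) * B $$ (i, b) \<in> homogeneous ((u i - t a) + (v b - u i))"
      using A B ab by (intro homogeneous_mult) (auto simp: graded_mat_def)
    then show "A $$ (a, i) * B $$ (i, b) \<in> homogeneous (v b - t a)" by simp
  qed
  finally show "(A * B) $$ (a, b) \<in> homogeneous (v b - t a)" .
qed

lemma graded_mat_minus:
  "graded_mat r t c u A \<Longrightarrow> graded_mat r t c u B \<Longrightarrow> graded_mat r t c u (A - B)"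
  unfolding graded_mat_def by (auto intro!: homogeneous_diff)

lemma graded_mat_one: "graded_mat r t r t (1\<^sub>m r)"
  by (auto simp: graded_mat_def homogeneous_one)

lemma mult_mat_vec_index:
  "A \<in> carrier_mat r c \<Longrightarrow> x \<in> carrier_vec c \<Longrightarrow> a < r \<Longrightarrow> (A *\<^sub>v x) $ a = (\<Sum>b<c. A $$ (a, b) * x $ b)"
  by (auto simp: scalar_prod_def lessThan_atLeast0 intro!: sum.cong)

text \<open>Lift column by column; since \<open>D\<close> is homogeneous, replacing a preimage by its homogeneous
  component of the right degree does not change its image.\<close>

lemma graded_lift:
  assumes D: "graded_mat r t c u D" and A: "graded_mat r t d v A"
    and im: "\<And>b. b < d \<Longrightarrow> \<exists>y\<in>carrier_vec c. D *\<^sub>v y = col A b"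
  shows "\<exists>B. graded_mat c u d v B \<and> D * B = A"
proof -
  obtain y where y: "\<And>b. b < d \<Longrightarrow> y b \<in> carrier_vec c" "\<And>b. b < d \<Longrightarrow> D *\<^sub>v y b = col A b"
    using im by metis
  define B where "B = mat c d (\<lambda>(i, b). degree_part (v b - u i) (y b $ i))"
  have B: "graded_mat c u d v B" by (auto simp: graded_mat_def B_def degree_part_homogeneous)
  have "D * B = A"
  proof (rule eq_matI)
    fix a b assume "a < dim_row A" "b < dim_col A"
    then have ab: "a < r" "b < d" using A by (auto simp: graded_mat_def)
    have "(D * B) $$ (a, b) = (\<Sum>i<c. D $$ (a, i) * degree_part (v b - u i) (y b $ i))"
      using D ab by (auto simp: graded_mat_def B_def scalar_prod_def lessThan_atLeast0 intro!: sum.cong)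
    also have "\<dots> = (\<Sum>i<c. degree_part (v b - t a) (D $$ (a, i) * y b $ i))"
    proof (rule sum.cong[OF refl])
      fix i assume "i \<in> {..<c}"
      then have "D $$ (a, i) \<in> homogeneous (u i - t a)" using D ab by (simp add: graded_mat_def)
      from degree_part_mult[OF this, of "v b - t a" "y b $ i"]
      show "D $$ (a, i) * degree_part (v b - u i) (y b $ i) = degree_part (v b - t a) (D $$ (a, i) * y b $ i)" by simp
    qed
    also have "\<dots> = degree_part (v b - t a) ((D *\<^sub>v y b) $ a)"
      using mult_mat_vec_index[OF graded_mat_carrier[OF D] y(1)[OF ab(2)] ab(1)] by (simp add: degree_part_sum)
    also have "\<dots> = A $$ (a, b)"
      using A ab y(2)[OF ab(2)] by (auto simp: graded_mat_def intro!: degree_part_id)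
    finally show "(D * B) $$ (a, b) = A $$ (a, b)" .
  qed (use D A B in \<open>auto simp: graded_mat_def\<close>)
  then show ?thesis using B by blast
qed

text \<open>The augmentation takes the place of a differential out of \<open>F\<^sub>0\<close>, so that exactness has
  the same form in all degrees.\<close>

definition cycles :: "('v::finite, 'k::field) free_complex \<Rightarrow> nat \<Rightarrow> ('v, 'k) mpoly vec set" where
  "cycles F p = {x \<in> carrier_vec (rank F p).
     case p of 0 \<Rightarrow> augmentation F x = 0 | Suc q \<Rightarrow> diff F q *\<^sub>v x = 0\<^sub>v (rank F q)}"

abbreviation graded_map :: "('v::finite, 'k::field) free_complex \<Rightarrow> nat \<Rightarrow> ('v, 'k) free_complex \<Rightarrow> nat \<Rightarrow> ('v, 'k) mpoly mat \<Rightarrow> bool" where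
  "graded_map G p F q A \<equiv> graded_mat (rank G p) (twist G p) (rank F q) (twist F q) A"

locale graded_resolution =
  fixes F :: "('v::finite, 'k::field) free_complex"
  assumes resolution: "graded_free_resolution F"
begin

lemma diff_graded: "graded_map F p F (Suc p) (diff F p)"
  using resolution by (simp add: graded_free_resolution_def graded_mat_def)

lemma diff_carrier [simp]: "diff F p \<in> carrier_mat (rank F p) (rank F (Suc p))"
  using resolution by (simp add: graded_free_resolution_def)

lemma aug_carrier [simp]: "aug F \<in> carrier_vec (rank F 0)"
  using resolution by (simp add: graded_free_resolution_def)

lemma aug_degree: "a < rank F 0 \<Longrightarrow> aug F $ a \<noteq> 0 \<Longrightarrow> twist F 0 a = 0"
  using resolution by (simp add: graded_free_resolution_def)

lemma aug_surj: "\<exists>x\<in>carrier_vec (rank F 0). augmentation F x = c"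
proof -
  have "augmentation F ` carrier_vec (rank F 0) = UNIV"
    using resolution unfolding graded_free_resolution_def by (elim conjE)
  then have "c \<in> augmentation F ` carrier_vec (rank F 0)" by simp
  then show ?thesis by auto
qed

lemma cycles_eq_image: "cycles F p = (\<lambda>y. diff F p *\<^sub>v y) ` carrier_vec (rank F (Suc p))"
proof (cases p)
  case 0
  have "{x \<in> carrier_vec (rank F 0). augmentation F x = 0} = (\<lambda>y. diff F 0 *\<^sub>v y) ` carrier_vec (rank F 1)"
    using resolution unfolding graded_free_resolution_def by (elim conjE)
  then show ?thesis by (simp add: cycles_def 0)
next
  case (Suc q)
  have "\<forall>q. {x \<in> carrier_vec (rank F (Suc q)). diff F q *\<^sub>v x = 0\<^sub>v (rank F q)}
       = (\<lambda>y. diff F (Suc q) *\<^sub>v y) ` carrier_vec (rank F (Suc (Suc q)))"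
    using resolution unfolding graded_free_resolution_def by (elim conjE)
  then show ?thesis by (simp add: cycles_def Suc)
qed

lemma diff_in_cycles: "y \<in> carrier_vec (rank F (Suc p)) \<Longrightarrow> diff F p *\<^sub>v y \<in> cycles F p"
  using cycles_eq_image by auto

lemma diff_vec [simp]: "y \<in> carrier_vec (rank F (Suc p)) \<Longrightarrow> diff F p *\<^sub>v y \<in> carrier_vec (rank F p)"
  using mult_mat_vec_carrier diff_carrier by blast

lemma cycles_Suc: "x \<in> cycles F (Suc p) \<longleftrightarrow> x \<in> carrier_vec (rank F (Suc p)) \<and> diff F p *\<^sub>v x = 0\<^sub>v (rank F p)"
  by (auto simp: cycles_def)

lemma diff_diff: "y \<in> carrier_vec (rank F (Suc (Suc p))) \<Longrightarrow> diff F p *\<^sub>v (diff F (Suc p) *\<^sub>v y) = 0\<^sub>v (rank F p)"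
  using diff_in_cycles[of y "Suc p"] cycles_Suc by blast

end

lemma graded_map_vec: "graded_map G p F q A \<Longrightarrow> x \<in> carrier_vec (rank F q) \<Longrightarrow> A *\<^sub>v x \<in> carrier_vec (rank G p)"
  using graded_mat_carrier mult_mat_vec_carrier by blast

lemma graded_mat_mult_vec:
  "graded_mat r t c u A \<Longrightarrow> graded_mat c u d v B \<Longrightarrow> x \<in> carrier_vec d \<Longrightarrow> (A * B) *\<^sub>v x = A *\<^sub>v (B *\<^sub>v x)"
  by (meson assoc_mult_mat_vec graded_mat_carrier)

lemma augmentation_eq_sum:
  assumes "aug F \<in> carrier_vec (rank F 0)" "x \<in> carrier_vec (rank F 0)"
  shows "augmentation F x = (\<Sum>a<rank F 0. aug F $ a * const_coeff (x $ a))"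
  using assms by (auto simp: augmentation_def scalar_prod_def lessThan_atLeast0 intro!: sum.cong)

lemma const_coeff_sum: "const_coeff (sum f A) = (\<Sum>x\<in>A. const_coeff (f x))"
  by (simp add: const_coeff_def lookup_sum)

lemma const_coeff_add: "const_coeff (p + q) = const_coeff p + const_coeff q"
  by (simp add: const_coeff_def lookup_add)

text \<open>Taking constant coefficients is a ring homomorphism, since 0 is a sum of two exponent vectors in only one
  way.\<close>

lemma const_coeff_mult: "const_coeff (p * q :: ('v::finite, 'k::field) mpoly) = const_coeff p * const_coeff q"
proof -
  have decomp: "\<exists>r'. r = Poly_Mapping.single 0 (const_coeff r) + r' \<and> const_coeff r' = 0" for r :: "('v, 'k) mpoly"
    by (rule exI[of _ "r - Poly_Mapping.single 0 (const_coeff r)"]) (simp add: const_coeff_def lookup_minus)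
  have zero: "const_coeff (a * b) = 0" if "const_coeff a = 0 \<or> const_coeff b = 0" for a b :: "('v, 'k) mpoly"
  proof (rule ccontr)
    assume "const_coeff (a * b) \<noteq> 0"
    then have "0 \<in> Poly_Mapping.keys (a * b)" by (simp add: in_keys_iff const_coeff_def)
    then obtain x y where xy: "0 = x + y" "x \<in> Poly_Mapping.keys a" "y \<in> Poly_Mapping.keys b"
      using keys_mult[of a b] by auto
    have "x = 0 \<and> y = 0"
    proof -
      have "Poly_Mapping.lookup x v + Poly_Mapping.lookup y v = 0" for v
        using xy(1) by (metis lookup_add lookup_zero)
      then show ?thesis by (auto intro!: poly_mapping_eqI)
    qed
    then show False using xy that by (auto simp: in_keys_iff const_coeff_def)
  qed
  obtain p' q' where p: "p = Poly_Mapping.single 0 (const_coeff p) + p'" "const_coeff p' = 0"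
    and q: "q = Poly_Mapping.single 0 (const_coeff q) + q'" "const_coeff q' = 0" using decomp by meson
  have "p * q = Poly_Mapping.single 0 (const_coeff p) * Poly_Mapping.single 0 (const_coeff q)
      + Poly_Mapping.single 0 (const_coeff p) * q' + p' * (Poly_Mapping.single 0 (const_coeff q) + q')"
    using arg_cong2[OF p(1) q(1), of "(*)"] by (simp add: algebra_simps)
  then have "const_coeff (p * q) = const_coeff (Poly_Mapping.single 0 (const_coeff p * const_coeff q) :: ('v, 'k) mpoly)"
    by (simp only: const_coeff_add mult_single add_0 zero[OF disjI2[OF q(2)]] zero[OF disjI1[OF p(2)]] add_0_right)
  then show ?thesis by (simp add: const_coeff_def)
qed

lemma const_coeff_degree_part: "const_coeff (degree_part 0 p) = const_coeff p"
  by (simp add: const_coeff_def lookup_degree_part mono_degree_def)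

lemma mult_mat_vec_zero:
  "(A :: 'a::semiring_0 mat) \<in> carrier_mat r c \<Longrightarrow> A *\<^sub>v 0\<^sub>v c = 0\<^sub>v r"
  by (intro eq_vecI) auto

lemma chain_map_start:
  fixes F G :: "('v::finite, 'k::field) free_complex"
  assumes "graded_resolution F" "graded_resolution G"
  shows "\<exists>\<phi>. graded_map G 0 F 0 \<phi> \<and>
    (\<forall>x\<in>carrier_vec (rank F 0). augmentation G (\<phi> *\<^sub>v x) = augmentation F x)"
proof -
  interpret F: graded_resolution F by fact
  interpret G: graded_resolution G by fact
  have "\<exists>y\<in>carrier_vec (rank G 0). augmentation G y = aug F $ b \<and> (aug F $ b = 0 \<longrightarrow> y = 0\<^sub>v (rank G 0))" for b
  proof (cases "aug F $ b = 0")
    case True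
    then show ?thesis
      by (intro bexI[of _ "0\<^sub>v (rank G 0)"]) (auto simp: augmentation_eq_sum[OF G.aug_carrier] const_coeff_def)
  next
    case False
    then show ?thesis using G.aug_surj[of "aug F $ b"] by blast
  qed
  then obtain y where y: "\<And>b. y b \<in> carrier_vec (rank G 0)" "\<And>b. augmentation G (y b) = aug F $ b"
    "\<And>b. aug F $ b = 0 \<Longrightarrow> y b = 0\<^sub>v (rank G 0)" by metis
  define \<phi> where "\<phi> = mat (rank G 0) (rank F 0) (\<lambda>(i, b). degree_part (twist F 0 b - twist G 0 i) (y b $ i))"
  have \<phi>: "graded_map G 0 F 0 \<phi>" by (auto simp: graded_mat_def \<phi>_def degree_part_homogeneous)
  have col: "(\<Sum>a<rank G 0. aug G $ a * const_coeff (\<phi> $$ (a, b))) = aug F $ b" if b: "b < rank F 0" for b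
  proof (cases "aug F $ b = 0")
    case True
    have "aug G $ a * const_coeff (\<phi> $$ (a, b)) = 0" if "a < rank G 0" for a
      using that b by (simp add: \<phi>_def y(3)[OF True]) (simp add: const_coeff_def)
    then show ?thesis unfolding True by (intro sum.neutral) simp
  next
    case False
    have "(\<Sum>a<rank G 0. aug G $ a * const_coeff (\<phi> $$ (a, b))) = (\<Sum>a<rank G 0. aug G $ a * const_coeff (y b $ a))"
    proof (rule sum.cong[OF refl])
      fix a assume "a \<in> {..<rank G 0}"
      then show "aug G $ a * const_coeff (\<phi> $$ (a, b)) = aug G $ a * const_coeff (y b $ a)"
        using F.aug_degree[OF b False] G.aug_degree[of a] b
        by (cases "aug G $ a = 0") (simp_all add: \<phi>_def const_coeff_degree_part)
    qed
    also have "\<dots> = aug F $ b" using y(2)[of b] augmentation_eq_sum[OF G.aug_carrier y(1)[of b]] by simp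
    finally show ?thesis .
  qed
  have "augmentation G (\<phi> *\<^sub>v x) = augmentation F x" if x: "x \<in> carrier_vec (rank F 0)" for x
  proof -
    have "augmentation G (\<phi> *\<^sub>v x) = (\<Sum>a<rank G 0. \<Sum>b<rank F 0. aug G $ a * const_coeff (\<phi> $$ (a, b)) * const_coeff (x $ b))"
      unfolding augmentation_eq_sum[OF G.aug_carrier graded_map_vec[OF \<phi> x]]
      by (rule sum.cong[OF refl])
         (simp add: mult_mat_vec_index[OF graded_mat_carrier[OF \<phi>] x] const_coeff_sum const_coeff_mult sum_distrib_left mult.assoc)
    also have "\<dots> = (\<Sum>b<rank F 0. (\<Sum>a<rank G 0. aug G $ a * const_coeff (\<phi> $$ (a, b))) * const_coeff (x $ b))"
      by (subst sum.swap) (simp add: sum_distrib_right)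
    also have "\<dots> = augmentation F x"
      unfolding augmentation_eq_sum[OF F.aug_carrier x] by (rule sum.cong[OF refl]) (use col in simp)
    finally show ?thesis .
  qed
  then show ?thesis using \<phi> by blast
qed

lemma col_mult_graded:
  fixes A :: "('v::finite, 'k::field) mpoly mat"
  assumes "graded_mat r t c u A" "graded_mat c u d v B" "b < d"
  shows "col (A * B) b = A *\<^sub>v col B b" "col B b \<in> carrier_vec c"
  using assms by (auto simp: graded_mat_def)

lemma col_eq_mult_unit:
  fixes A :: "('v::finite, 'k::field) mpoly mat"
  assumes "A \<in> carrier_mat r c" "b < c"
  shows "col A b = A *\<^sub>v unit_vec c b"
  using assms by (intro eq_vecI) auto

lemma chain_map_step:
  fixes F G :: "('v::finite, 'k::field) free_complex"
  assumes "graded_resolution F" "graded_resolution G"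
    and \<phi>: "graded_map G n F n \<phi>" "\<And>x. x \<in> cycles F n \<Longrightarrow> \<phi> *\<^sub>v x \<in> cycles G n"
  shows "\<exists>\<phi>'. graded_map G (Suc n) F (Suc n) \<phi>' \<and> (\<forall>x\<in>cycles F (Suc n). \<phi>' *\<^sub>v x \<in> cycles G (Suc n))
    \<and> diff G n * \<phi>' = \<phi> * diff F n"
proof -
  interpret F: graded_resolution F by fact
  interpret G: graded_resolution G by fact
  have A: "graded_map G n F (Suc n) (\<phi> * diff F n)" by (rule graded_mat_mult[OF \<phi>(1) F.diff_graded])
  have "\<exists>y\<in>carrier_vec (rank G (Suc n)). diff G n *\<^sub>v y = col (\<phi> * diff F n) b" if b: "b < rank F (Suc n)" for b
  proof -
    have "col (\<phi> * diff F n) b = \<phi> *\<^sub>v (diff F n *\<^sub>v unit_vec (rank F (Suc n)) b)"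
      using col_mult_graded[OF \<phi>(1) F.diff_graded b] col_eq_mult_unit[OF F.diff_carrier b] by simp
    also have "\<dots> \<in> cycles G n" by (rule \<phi>(2), rule F.diff_in_cycles) simp
    finally show ?thesis unfolding G.cycles_eq_image by auto
  qed
  from graded_lift[OF G.diff_graded A this] obtain \<phi>' where
    \<phi>': "graded_map G (Suc n) F (Suc n) \<phi>'" "diff G n * \<phi>' = \<phi> * diff F n" by blast
  have "\<phi>' *\<^sub>v x \<in> cycles G (Suc n)" if x: "x \<in> cycles F (Suc n)" for x
  proof -
    have xc: "x \<in> carrier_vec (rank F (Suc n))" "diff F n *\<^sub>v x = 0\<^sub>v (rank F n)" using x by (auto simp: F.cycles_Suc)
    have "diff G n *\<^sub>v (\<phi>' *\<^sub>v x) = \<phi> *\<^sub>v (diff F n *\<^sub>v x)"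
      using graded_mat_mult_vec[OF G.diff_graded \<phi>'(1) xc(1)] graded_mat_mult_vec[OF \<phi>(1) F.diff_graded xc(1)] \<phi>'(2) by simp
    also have "\<dots> = 0\<^sub>v (rank G n)" by (simp add: xc(2) mult_mat_vec_zero[OF graded_mat_carrier[OF \<phi>(1)]])
    finally show ?thesis using graded_map_vec[OF \<phi>'(1) xc(1)] by (simp add: G.cycles_Suc)
  qed
  then show ?thesis using \<phi>' by blast
qed

text \<open>The comparison theorem: a chain map over the identity of \<open>k\<close> is built degree by degree with
  \<open>graded_lift\<close>.\<close>

lemma chain_map_exists:
  fixes F G :: "('v::finite, 'k::field) free_complex"
  assumes FG: "graded_resolution F" "graded_resolution G"
  shows "\<exists>\<phi>. (\<forall>n. graded_map G n F n (\<phi> n)) \<and> (\<forall>n. diff G n * \<phi> (Suc n) = \<phi> n * diff F n) \<and>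
    (\<forall>x\<in>carrier_vec (rank F 0). augmentation G (\<phi> 0 *\<^sub>v x) = augmentation F x)"
proof -
  let ?P = "\<lambda>n \<phi>. graded_map G n F n \<phi> \<and> (\<forall>x\<in>cycles F n. \<phi> *\<^sub>v x \<in> cycles G n) \<and>
    (n = 0 \<longrightarrow> (\<forall>x\<in>carrier_vec (rank F 0). augmentation G (\<phi> *\<^sub>v x) = augmentation F x))"
  have "\<exists>\<phi>. \<forall>n. ?P n (\<phi> n) \<and> diff G n * \<phi> (Suc n) = \<phi> n * diff F n"
  proof (rule dependent_nat_choice)
    obtain \<phi> where \<phi>: "graded_map G 0 F 0 \<phi>" "\<forall>x\<in>carrier_vec (rank F 0). augmentation G (\<phi> *\<^sub>v x) = augmentation F x"
      using chain_map_start[OF FG] by blast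
    moreover have "\<phi> *\<^sub>v x \<in> cycles G 0" if "x \<in> cycles F 0" for x
      using that \<phi>(2) graded_map_vec[OF \<phi>(1)] by (auto simp: cycles_def)
    ultimately show "\<exists>\<phi>. ?P 0 \<phi>" by blast
  next
    fix \<phi> n assume "?P n \<phi>"
    then show "\<exists>\<phi>'. ?P (Suc n) \<phi>' \<and> diff G n * \<phi>' = \<phi> * diff F n"
      using chain_map_step[OF FG, of n \<phi>] by auto
  qed
  then show ?thesis by metis
qed

context graded_resolution
begin

lemma homotopy_step:
  assumes A: "graded_map F n F n A" and im: "\<And>x. x \<in> carrier_vec (rank F n) \<Longrightarrow> A *\<^sub>v x \<in> cycles F n"
  shows "\<exists>h. graded_map F (Suc n) F n h \<and> diff F n * h = A"
proof -
  have "\<exists>y\<in>carrier_vec (rank F (Suc n)). diff F n *\<^sub>v y = col A b" if b: "b < rank F n" for b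
  proof -
    have "col A b = A *\<^sub>v unit_vec (rank F n) b" by (rule col_eq_mult_unit[OF graded_mat_carrier[OF A] b])
    also have "\<dots> \<in> cycles F n" by (rule im) simp
    finally show ?thesis unfolding cycles_eq_image by auto
  qed
  from graded_lift[OF diff_graded A this] show ?thesis .
qed

text \<open>The second half of the comparison theorem: an endomorphism over the identity of \<open>k\<close> is
  homotopic to the identity.\<close>

lemma homotopy_exists:
  assumes \<chi>: "\<And>n. graded_map F n F n (\<chi> n)" and comm: "\<And>n. diff F n * \<chi> (Suc n) = \<chi> n * diff F n"
    and aug: "\<And>x. x \<in> carrier_vec (rank F 0) \<Longrightarrow> augmentation F (\<chi> 0 *\<^sub>v x) = augmentation F x"
  shows "\<exists>h. (\<forall>n. graded_map F (Suc n) F n (h n)) \<and> diff F 0 * h 0 = \<chi> 0 - 1\<^sub>m (rank F 0) \<and>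
    (\<forall>n. diff F (Suc n) * h (Suc n) = \<chi> (Suc n) - 1\<^sub>m (rank F (Suc n)) - h n * diff F n)"
proof -
  let ?one = "\<lambda>n. 1\<^sub>m (rank F n)"
  have one: "graded_map F n F n (?one n)" for n by (rule graded_mat_one)
  have comm_vec: "diff F n *\<^sub>v (\<chi> (Suc n) *\<^sub>v x) = \<chi> n *\<^sub>v (diff F n *\<^sub>v x)" if "x \<in> carrier_vec (rank F (Suc n))" for n x
    using graded_mat_mult_vec[OF diff_graded \<chi> that] graded_mat_mult_vec[OF \<chi> diff_graded that] comm by metis
  have \<chi>_vec: "\<chi> n *\<^sub>v x \<in> carrier_vec (rank F n)" if "x \<in> carrier_vec (rank F n)" for n x
    using graded_map_vec[OF \<chi> that] .
  have \<chi>1: "(\<chi> n - ?one n) *\<^sub>v x = \<chi> n *\<^sub>v x - x" if "x \<in> carrier_vec (rank F n)" for n x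
    using minus_mult_distrib_mat_vec[OF graded_mat_carrier[OF \<chi>] graded_mat_carrier[OF one] that] that by simp
  have \<chi>h: "(\<chi> (Suc n) - ?one (Suc n) - h * diff F n) *\<^sub>v x = \<chi> (Suc n) *\<^sub>v x - x - h *\<^sub>v (diff F n *\<^sub>v x)"
    if x: "x \<in> carrier_vec (rank F (Suc n))" and h: "graded_map F (Suc n) F n h" for n x h
    using minus_mult_distrib_mat_vec[OF graded_mat_carrier[OF graded_mat_minus[OF \<chi> one]] graded_mat_carrier[OF graded_mat_mult[OF h diff_graded]] x]
      \<chi>1[OF x] graded_mat_mult_vec[OF h diff_graded x] by simp
  have d_minus: "diff F n *\<^sub>v (a - b) = diff F n *\<^sub>v a - diff F n *\<^sub>v b"
    if "a \<in> carrier_vec (rank F (Suc n))" "b \<in> carrier_vec (rank F (Suc n))" for n a b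
    by (rule mult_minus_distrib_mat_vec[OF diff_carrier that])
  let ?P = "\<lambda>n h. graded_map F (Suc n) F n h \<and>
    (\<forall>x\<in>carrier_vec (rank F (Suc n)). (\<chi> (Suc n) - ?one (Suc n) - h * diff F n) *\<^sub>v x \<in> cycles F (Suc n)) \<and>
    (n = 0 \<longrightarrow> diff F 0 * h = \<chi> 0 - ?one 0)"
  have cyc: "(\<chi> (Suc n) - ?one (Suc n) - h * diff F n) *\<^sub>v x \<in> cycles F (Suc n)"
    if h: "graded_map F (Suc n) F n h" and x: "x \<in> carrier_vec (rank F (Suc n))"
      and eq: "diff F n *\<^sub>v (h *\<^sub>v (diff F n *\<^sub>v x)) = \<chi> n *\<^sub>v (diff F n *\<^sub>v x) - diff F n *\<^sub>v x" for n h x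
  proof -
    have dx: "diff F n *\<^sub>v x \<in> carrier_vec (rank F n)" using x by simp
    have hx: "h *\<^sub>v (diff F n *\<^sub>v x) \<in> carrier_vec (rank F (Suc n))" by (rule graded_map_vec[OF h dx])
    have "diff F n *\<^sub>v (\<chi> (Suc n) *\<^sub>v x - x - h *\<^sub>v (diff F n *\<^sub>v x))
        = \<chi> n *\<^sub>v (diff F n *\<^sub>v x) - diff F n *\<^sub>v x - (\<chi> n *\<^sub>v (diff F n *\<^sub>v x) - diff F n *\<^sub>v x)"
      using x \<chi>_vec[OF x] hx by (simp add: d_minus comm_vec eq)
    also have "\<dots> = 0\<^sub>v (rank F n)" using dx \<chi>_vec[OF dx] by auto
    finally show ?thesis unfolding \<chi>h[OF x h] cycles_Suc using x \<chi>_vec[OF x] hx by simp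
  qed
  have "\<exists>h. \<forall>n. ?P n (h n) \<and> diff F (Suc n) * h (Suc n) = \<chi> (Suc n) - ?one (Suc n) - h n * diff F n"
  proof (rule dependent_nat_choice)
    have "(\<chi> 0 - ?one 0) *\<^sub>v x \<in> cycles F 0" if x: "x \<in> carrier_vec (rank F 0)" for x
    proof -
      have "augmentation F (\<chi> 0 *\<^sub>v x - x) = augmentation F (\<chi> 0 *\<^sub>v x) - augmentation F x"
        using x \<chi>_vec[OF x]
        by (auto simp: augmentation_eq_sum const_coeff_def lookup_minus algebra_simps sum_subtractf)
      then show ?thesis using \<chi>1[OF x] aug[OF x] x \<chi>_vec[OF x] by (simp add: cycles_def)
    qed
    from homotopy_step[OF graded_mat_minus[OF \<chi> one] this] obtain h
      where h: "graded_map F (Suc 0) F 0 h" "diff F 0 * h = \<chi> 0 - ?one 0" by blast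
    have "(\<chi> (Suc 0) - ?one (Suc 0) - h * diff F 0) *\<^sub>v x \<in> cycles F (Suc 0)" if x: "x \<in> carrier_vec (rank F (Suc 0))" for x
    proof (rule cyc[OF h(1) x])
      have dx: "diff F 0 *\<^sub>v x \<in> carrier_vec (rank F 0)" using x by simp
      show "diff F 0 *\<^sub>v (h *\<^sub>v (diff F 0 *\<^sub>v x)) = \<chi> 0 *\<^sub>v (diff F 0 *\<^sub>v x) - diff F 0 *\<^sub>v x"
        using graded_mat_mult_vec[OF diff_graded h(1) dx] \<chi>1[OF dx] h(2) by simp
    qed
    then show "\<exists>h. ?P 0 h" using h by blast
  next
    fix h n assume P: "?P n h"
    then have h: "graded_map F (Suc n) F n h" by blast
    from homotopy_step[OF graded_mat_minus[OF graded_mat_minus[OF \<chi> one] graded_mat_mult[OF h diff_graded]]] P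
    obtain h' where h': "graded_map F (Suc (Suc n)) F (Suc n) h'"
      "diff F (Suc n) * h' = \<chi> (Suc n) - ?one (Suc n) - h * diff F n" by blast
    have "(\<chi> (Suc (Suc n)) - ?one (Suc (Suc n)) - h' * diff F (Suc n)) *\<^sub>v x \<in> cycles F (Suc (Suc n))"
      if x: "x \<in> carrier_vec (rank F (Suc (Suc n)))" for x
    proof (rule cyc[OF h'(1) x])
      have dx: "diff F (Suc n) *\<^sub>v x \<in> carrier_vec (rank F (Suc n))" using x by simp
      have "diff F (Suc n) *\<^sub>v (h' *\<^sub>v (diff F (Suc n) *\<^sub>v x))
        = \<chi> (Suc n) *\<^sub>v (diff F (Suc n) *\<^sub>v x) - diff F (Suc n) *\<^sub>v x - h *\<^sub>v (diff F n *\<^sub>v (diff F (Suc n) *\<^sub>v x))"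
        using graded_mat_mult_vec[OF diff_graded h'(1) dx] \<chi>h[OF dx h] h'(2) by simp
      also have "h *\<^sub>v (diff F n *\<^sub>v (diff F (Suc n) *\<^sub>v x)) = 0\<^sub>v (rank F (Suc n))"
        by (simp add: diff_diff[OF x] mult_mat_vec_zero[OF graded_mat_carrier[OF h]])
      finally show "diff F (Suc n) *\<^sub>v (h' *\<^sub>v (diff F (Suc n) *\<^sub>v x)) = \<chi> (Suc n) *\<^sub>v (diff F (Suc n) *\<^sub>v x) - diff F (Suc n) *\<^sub>v x"
        using dx \<chi>_vec[OF dx] by simp
    qed
    then show "\<exists>h'. ?P (Suc n) h' \<and> diff F (Suc n) * h' = \<chi> (Suc n) - ?one (Suc n) - h * diff F n"
      using h' by blast
  qed
  then show ?thesis by metis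
qed

end

definition ring_ideal :: "('v, 'k::field) mpoly set \<Rightarrow> bool" where
  "ring_ideal M \<longleftrightarrow> 0 \<in> M \<and> (\<forall>a\<in>M. \<forall>b\<in>M. a + b \<in> M) \<and> (\<forall>r. \<forall>a\<in>M. r * a \<in> M)"

lemma ring_ideal_sum: "ring_ideal M \<Longrightarrow> (\<And>x. x \<in> A \<Longrightarrow> f x \<in> M) \<Longrightarrow> sum f A \<in> M"
  by (induction A rule: infinite_finite_induct) (auto simp: ring_ideal_def)

lemma ring_ideal_diff: "ring_ideal M \<Longrightarrow> a \<in> M \<Longrightarrow> b \<in> M \<Longrightarrow> a - b \<in> M"
  unfolding ring_ideal_def by (metis add_uminus_conv_diff mult_minus1)

lemma tensor_component_carrier: "x \<in> tensor_component F M p j \<Longrightarrow> x \<in> carrier_vec (rank F p)"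
  by (simp add: tensor_component_def)

lemma tensor_component_map:
  fixes F G :: "('v::finite, 'k::field) free_complex"
  assumes M: "ring_ideal M" and A: "graded_map G p F q A" and x: "x \<in> tensor_component F M q j"
  shows "A *\<^sub>v x \<in> tensor_component G M p j"
  unfolding tensor_component_def
proof (intro CollectI conjI allI impI)
  have xc: "x \<in> carrier_vec (rank F q)" by (rule tensor_component_carrier[OF x])
  show "A *\<^sub>v x \<in> carrier_vec (rank G p)" by (rule graded_map_vec[OF A xc])
  fix a assume a: "a < rank G p"
  have "A $$ (a, b) * x $ b \<in> M \<inter> homogeneous (j - twist G p a)" if b: "b < rank F q" for b
  proof -
    have "x $ b \<in> M" "x $ b \<in> homogeneous (j - twist F q b)" using x b by (auto simp: tensor_component_def)
    moreover have "A $$ (a, b) \<in> homogeneous (twist F q b - twist G p a)" using A a b by (simp add: graded_mat_def)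
    ultimately show ?thesis using M homogeneous_mult[of "A $$ (a, b)" "twist F q b - twist G p a" "x $ b" "j - twist F q b"]
      by (simp add: ring_ideal_def)
  qed
  then show "(A *\<^sub>v x) $ a \<in> M \<inter> homogeneous (j - twist G p a)"
    unfolding mult_mat_vec_index[OF graded_mat_carrier[OF A] xc a]
    by (intro IntI ring_ideal_sum[OF M] homogeneous_sum) auto
qed

lemma tensor_component_diff:
  "ring_ideal M \<Longrightarrow> x \<in> tensor_component F M p j \<Longrightarrow> y \<in> tensor_component F M p j \<Longrightarrow> x - y \<in> tensor_component F M p j"
  by (auto simp: tensor_component_def intro!: ring_ideal_diff homogeneous_diff)

text \<open>Chain maps \<open>\<phi>\<close> and \<open>\<psi>\<close> between the resolutions and a homotopy
  \<open>h\<close> from \<open>\<psi> \<phi>\<close> to the identity are matrices, so they act on vectors with entries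
  in \<open>M\<close>. If \<open>\<phi> x\<close> bounds \<open>y\<close>, then \<open>x\<close> bounds
  \<open>\<psi> y - h x\<close>.\<close>

theorem tensor_homology_vanishes_transfer:
  fixes F G :: "('v::finite, 'k::field) free_complex"
  assumes F: "graded_resolution F" and G: "graded_resolution G" and M: "ring_ideal M"
    and van: "tensor_cycles G M i j \<subseteq> tensor_boundaries G M i j"
  shows "tensor_cycles F M i j \<subseteq> tensor_boundaries F M i j"
proof
  interpret F: graded_resolution F by fact
  interpret G: graded_resolution G by fact
  fix x assume x: "x \<in> tensor_cycles F M i j"
  obtain \<phi> where \<phi>: "\<And>n. graded_map G n F n (\<phi> n)" "\<And>n. diff G n * \<phi> (Suc n) = \<phi> n * diff F n"
    "\<And>x. x \<in> carrier_vec (rank F 0) \<Longrightarrow> augmentation G (\<phi> 0 *\<^sub>v x) = augmentation F x"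
    using chain_map_exists[OF F G] by blast
  obtain \<psi> where \<psi>: "\<And>n. graded_map F n G n (\<psi> n)" "\<And>n. diff F n * \<psi> (Suc n) = \<psi> n * diff G n"
    "\<And>x. x \<in> carrier_vec (rank G 0) \<Longrightarrow> augmentation F (\<psi> 0 *\<^sub>v x) = augmentation G x"
    using chain_map_exists[OF G F] by blast
  define \<chi> where "\<chi> n = \<psi> n * \<phi> n" for n
  have \<chi>: "graded_map F n F n (\<chi> n)" for n unfolding \<chi>_def by (rule graded_mat_mult[OF \<psi>(1) \<phi>(1)])
  have comm: "diff F n * \<chi> (Suc n) = \<chi> n * diff F n" for n
  proof -
    note c = graded_mat_carrier[OF \<phi>(1)] graded_mat_carrier[OF \<psi>(1)] F.diff_carrier G.diff_carrier
    have "diff F n * \<chi> (Suc n) = (diff F n * \<psi> (Suc n)) * \<phi> (Suc n)"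
      unfolding \<chi>_def by (rule assoc_mult_mat[symmetric, OF c(3) c(2) c(1)])
    also have "\<dots> = \<psi> n * (diff G n * \<phi> (Suc n))"
      unfolding \<psi>(2) by (rule assoc_mult_mat[OF c(2) c(4) c(1)])
    also have "\<dots> = \<chi> n * diff F n"
      unfolding \<phi>(2) \<chi>_def by (rule assoc_mult_mat[symmetric, OF c(2) c(1) c(3)])
    finally show ?thesis .
  qed
  have \<chi>_vec: "\<chi> n *\<^sub>v y = \<psi> n *\<^sub>v (\<phi> n *\<^sub>v y)" if "y \<in> carrier_vec (rank F n)" for n y
    unfolding \<chi>_def by (rule graded_mat_mult_vec[OF \<psi>(1) \<phi>(1) that])
  have aug: "augmentation F (\<chi> 0 *\<^sub>v y) = augmentation F y" if y: "y \<in> carrier_vec (rank F 0)" for y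
    using \<psi>(3)[OF graded_map_vec[OF \<phi>(1) y]] \<phi>(3)[OF y] \<chi>_vec[OF y] by simp
  obtain h where h: "\<And>n. graded_map F (Suc n) F n (h n)" "diff F 0 * h 0 = \<chi> 0 - 1\<^sub>m (rank F 0)"
    "\<And>n. diff F (Suc n) * h (Suc n) = \<chi> (Suc n) - 1\<^sub>m (rank F (Suc n)) - h n * diff F n"
    using F.homotopy_exists[OF \<chi> comm aug] by blast
  have xt: "x \<in> tensor_component F M i j" using x by (simp add: tensor_cycles_def)
  have xc: "x \<in> carrier_vec (rank F i)" by (rule tensor_component_carrier[OF xt])
  have "\<phi> i *\<^sub>v x \<in> tensor_cycles G M i j"
    unfolding tensor_cycles_def
  proof (intro CollectI conjI allI impI)
    show "\<phi> i *\<^sub>v x \<in> tensor_component G M i j" by (rule tensor_component_map[OF M \<phi>(1) xt])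
    fix p assume i: "i = Suc p"
    have "diff G p *\<^sub>v (\<phi> i *\<^sub>v x) = \<phi> p *\<^sub>v (diff F p *\<^sub>v x)"
      using graded_mat_mult_vec[OF G.diff_graded \<phi>(1)] graded_mat_mult_vec[OF \<phi>(1) F.diff_graded] \<phi>(2) xc i by metis
    also have "\<dots> = 0\<^sub>v (rank G p)"
      using x i by (simp add: tensor_cycles_def mult_mat_vec_zero[OF graded_mat_carrier[OF \<phi>(1)]])
    finally show "diff G p *\<^sub>v (\<phi> i *\<^sub>v x) = 0\<^sub>v (rank G p)" .
  qed
  then obtain y where y: "y \<in> tensor_component G M (Suc i) j" "\<phi> i *\<^sub>v x = diff G i *\<^sub>v y"
    using van by (auto simp: tensor_boundaries_def)
  have yc: "y \<in> carrier_vec (rank G (Suc i))" by (rule tensor_component_carrier[OF y(1)])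
  define w where "w = \<psi> (Suc i) *\<^sub>v y - h i *\<^sub>v x"
  have w: "w \<in> tensor_component F M (Suc i) j"
    unfolding w_def by (rule tensor_component_diff[OF M tensor_component_map[OF M \<psi>(1) y(1)] tensor_component_map[OF M h(1) xt]])
  have hx: "diff F i *\<^sub>v (h i *\<^sub>v x) = \<chi> i *\<^sub>v x - x"
  proof (cases i)
    case 0
    have "(\<chi> i - 1\<^sub>m (rank F i)) *\<^sub>v x = \<chi> i *\<^sub>v x - x"
      using minus_mult_distrib_mat_vec[OF graded_mat_carrier[OF \<chi>] one_carrier_mat xc] xc by simp
    then show ?thesis using h(2) graded_mat_mult_vec[OF F.diff_graded h(1) xc] 0 by simp
  next
    case (Suc p)
    have x0: "diff F p *\<^sub>v x = 0\<^sub>v (rank F p)" using x Suc by (simp add: tensor_cycles_def)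
    have "(h p * diff F p) *\<^sub>v x = 0\<^sub>v (rank F i)"
      using graded_mat_mult_vec[OF h(1) F.diff_graded, of x p] xc Suc x0 mult_mat_vec_zero[OF graded_mat_carrier[OF h(1)[of p]]] by simp
    moreover have "(\<chi> i - 1\<^sub>m (rank F i) - h p * diff F p) *\<^sub>v x = (\<chi> i - 1\<^sub>m (rank F i)) *\<^sub>v x - (h p * diff F p) *\<^sub>v x"
      using graded_mat_carrier[OF graded_mat_mult[OF h(1)[of p] F.diff_graded[of p]]] Suc
      by (intro minus_mult_distrib_mat_vec[OF graded_mat_carrier[OF graded_mat_minus[OF \<chi> graded_mat_one]] _ xc]) simp
    moreover have "(\<chi> i - 1\<^sub>m (rank F i)) *\<^sub>v x = \<chi> i *\<^sub>v x - x"
      using minus_mult_distrib_mat_vec[OF graded_mat_carrier[OF \<chi>] one_carrier_mat xc] xc by simp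
    ultimately show ?thesis
      using h(3)[of p] graded_mat_mult_vec[OF F.diff_graded h(1) xc] Suc graded_map_vec[OF \<chi> xc] xc by simp
  qed
  have "diff F i *\<^sub>v (\<psi> (Suc i) *\<^sub>v y) = \<chi> i *\<^sub>v x"
    using graded_mat_mult_vec[OF F.diff_graded \<psi>(1) yc] graded_mat_mult_vec[OF \<psi>(1) G.diff_graded yc] \<psi>(2) y(2) \<chi>_vec[OF xc]
    by metis
  then have "diff F i *\<^sub>v w = \<chi> i *\<^sub>v x - (\<chi> i *\<^sub>v x - x)"
    unfolding w_def using mult_minus_distrib_mat_vec[OF F.diff_carrier graded_map_vec[OF \<psi>(1) yc] graded_map_vec[OF h(1) xc]] hx
    by simp
  also have "\<dots> = x" using graded_map_vec[OF \<chi> xc] xc by auto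
  finally show "x \<in> tensor_boundaries F M i j" using w unfolding tensor_boundaries_def by blast
qed

section \<open>The Koszul complex\<close>

definition exponent_of :: "('v \<Rightarrow>\<^sub>0 nat) \<Rightarrow> 'v \<Rightarrow> int" where
  "exponent_of m = (\<lambda>v. int (Poly_Mapping.lookup m v))"

definition monomial_of :: "('v::finite \<Rightarrow> int) \<Rightarrow> ('v \<Rightarrow>\<^sub>0 nat)" where
  "monomial_of e = Abs_poly_mapping (\<lambda>v. nat (e v))"

lemma lookup_monomial_of [simp]: "Poly_Mapping.lookup (monomial_of e) v = nat (e v)"
  by (simp add: monomial_of_def)

lemma monomial_of_exponent_of [simp]: "monomial_of (exponent_of m) = m"
  by (rule poly_mapping_eqI) (simp add: exponent_of_def)

lemma exponent_of_monomial_of: "(\<And>v. 0 \<le> e v) \<Longrightarrow> exponent_of (monomial_of e) = e"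
  by (simp add: exponent_of_def)

lemma exponent_of_nonneg [simp]: "0 \<le> exponent_of m v"
  by (simp add: exponent_of_def)

lemma inj_exponent_of: "exponent_of (m :: 'v::finite \<Rightarrow>\<^sub>0 nat) = exponent_of m' \<longleftrightarrow> m = m'"
  by (metis monomial_of_exponent_of)

lemma sum_exponent_of: "(\<Sum>v\<in>UNIV. exponent_of m v) = int (mono_degree m)"
  by (simp add: exponent_of_def mono_degree_def)

lemma poly_mapping_sum_single:
  "(\<Sum>k\<in>Poly_Mapping.keys q. Poly_Mapping.single k (Poly_Mapping.lookup q k)) = q"
  by (rule poly_mapping_eqI)
     (simp add: lookup_sum lookup_single when_def in_keys_iff sum.delta)

lemma lookup_single_mult:
  fixes q :: "('v \<Rightarrow>\<^sub>0 nat) \<Rightarrow>\<^sub>0 'k::comm_ring_1"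
  shows "Poly_Mapping.lookup (Poly_Mapping.single t c * q) m
    = (\<Sum>k\<in>Poly_Mapping.keys q. (c * Poly_Mapping.lookup q k when t + k = m))"
proof -
  have "Poly_Mapping.single t c * q =
    (\<Sum>k\<in>Poly_Mapping.keys q. Poly_Mapping.single (t + k) (c * Poly_Mapping.lookup q k))"
    by (subst poly_mapping_sum_single[of q, symmetric]) (simp add: sum_distrib_left mult_single del: poly_mapping_sum_single)
  then show ?thesis by (simp add: lookup_sum lookup_single)
qed

lemma lookup_single_mult_add:
  fixes q :: "('v \<Rightarrow>\<^sub>0 nat) \<Rightarrow>\<^sub>0 'k::comm_ring_1"
  shows "Poly_Mapping.lookup (Poly_Mapping.single t c * q) (t + k) = c * Poly_Mapping.lookup q k"
  by (simp add: lookup_single_mult when_def in_keys_iff sum.delta)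

lemma lookup_var_mult:
  fixes q :: "('v::finite, 'k::field) mpoly"
  assumes e: "\<And>w. 0 \<le> e w"
  shows "Poly_Mapping.lookup (var v * q) (monomial_of e) =
    (if 1 \<le> e v then Poly_Mapping.lookup q (monomial_of (\<lambda>w. e w - (if w = v then 1 else 0))) else 0)"
proof (cases "1 \<le> e v")
  case True
  have "monomial_of e = Poly_Mapping.single v 1 + monomial_of (\<lambda>w. e w - (if w = v then 1 else 0))"
    by (rule poly_mapping_eqI) (use True e in \<open>auto simp: lookup_add lookup_single when_def nat_diff_distrib\<close>)
  then show ?thesis using True by (simp add: var_def lookup_single_mult_add)
next
  case False
  have "Poly_Mapping.single v 1 + k \<noteq> monomial_of e" for k
  proof
    assume "Poly_Mapping.single v 1 + k = monomial_of e"
    then have "Poly_Mapping.lookup (Poly_Mapping.single v 1 + k) v = nat (e v)" by simp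
    then show False using False by (simp add: lookup_add)
  qed
  then show ?thesis using False by (simp add: var_def lookup_single_mult)
qed

lemma lookup_face_sign_mult:
  fixes q :: "('v::finite, 'k::field) mpoly"
  shows "Poly_Mapping.lookup (face_sign v \<sigma> * q) m = face_sign v \<sigma> * Poly_Mapping.lookup q m"
  by (cases "even (card {w \<in> \<sigma>. vertex_index w < vertex_index v})") (simp_all add: face_sign_def)

text \<open>The Koszul differential, with chains written as functions of the complement \<open>\<sigma>\<close> of the
  usual index set. In this form it has the shape of a coboundary.\<close>

definition koszul_diff :: "('v::finite set \<Rightarrow> ('v, 'k::field) mpoly) \<Rightarrow> 'v set \<Rightarrow> ('v, 'k) mpoly" where
  "koszul_diff X \<sigma> = (\<Sum>v\<in>\<sigma>. face_sign v \<sigma> * var v * X (\<sigma> - {v}))"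

text \<open>The exponent of the monomial that goes with \<open>\<sigma>\<close> in multidegree
  \<open>b\<close>.\<close>

abbreviation face_exponent :: "('v \<Rightarrow> int) \<Rightarrow> 'v set \<Rightarrow> 'v \<Rightarrow> int" where
  "face_exponent b \<sigma> \<equiv> (\<lambda>v. if v \<in> \<sigma> then b v else b v - 1)"

text \<open>The component of a Koszul chain in multidegree \<open>b\<close>.\<close>

definition slice :: "('v::finite \<Rightarrow> int) \<Rightarrow> ('v set \<Rightarrow> ('v, 'k::field) mpoly) \<Rightarrow> 'v set \<Rightarrow> 'k" where
  "slice b X \<sigma> = (if \<forall>v. 0 \<le> face_exponent b \<sigma> v
     then Poly_Mapping.lookup (X \<sigma>) (monomial_of (face_exponent b \<sigma>)) else 0)"

text \<open>Multiplication by \<open>var v\<close> raises the exponent of \<open>v\<close> by one, which is the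
  difference between the positions \<open>\<sigma> - {v}\<close> and \<open>\<sigma>\<close> in one
  multidegree.\<close>

lemma slice_koszul_diff:
  fixes X :: "'v::finite set \<Rightarrow> ('v, 'k::field) mpoly"
  shows "slice b (koszul_diff X) = coboundary (slice b X)"
proof
  fix \<sigma> :: "'v set"
  have shift: "face_exponent b (\<sigma> - {v}) = (\<lambda>w. face_exponent b \<sigma> w - (if w = v then 1 else 0))" if "v \<in> \<sigma>" for v
    using that by auto
  show "slice b (koszul_diff X) \<sigma> = coboundary (slice b X) \<sigma>"
  proof (cases "\<forall>v. 0 \<le> face_exponent b \<sigma> v")
    case True
    have "slice b (koszul_diff X) \<sigma> = (\<Sum>v\<in>\<sigma>. face_sign v \<sigma> * Poly_Mapping.lookup (var v * X (\<sigma> - {v})) (monomial_of (face_exponent b \<sigma>)))"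
      unfolding slice_def if_P[OF True] koszul_diff_def by (simp add: lookup_sum mult.assoc lookup_face_sign_mult)
    also have "\<dots> = coboundary (slice b X) \<sigma>"
      unfolding coboundary_def
    proof (rule sum.cong[OF refl])
      fix v assume v: "v \<in> \<sigma>"
      have iff: "(\<forall>w. 0 \<le> face_exponent b (\<sigma> - {v}) w) \<longleftrightarrow> 1 \<le> face_exponent b \<sigma> v"
      proof
        assume "\<forall>w. 0 \<le> face_exponent b (\<sigma> - {v}) w"
        from spec[OF this, of v] v show "1 \<le> face_exponent b \<sigma> v" by simp
      next
        assume "1 \<le> face_exponent b \<sigma> v"
        then show "\<forall>w. 0 \<le> face_exponent b (\<sigma> - {v}) w"
          using v True by (metis DiffI Diff_iff diff_ge_0_iff_ge singletonD)
      qed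
      have "Poly_Mapping.lookup (var v * X (\<sigma> - {v})) (monomial_of (face_exponent b \<sigma>)) = slice b X (\<sigma> - {v})"
        unfolding slice_def iff lookup_var_mult[OF True[rule_format]] shift[OF v] ..
      then show "face_sign v \<sigma> * Poly_Mapping.lookup (var v * X (\<sigma> - {v})) (monomial_of (face_exponent b \<sigma>))
        = face_sign v \<sigma> * slice b X (\<sigma> - {v})" by simp
    qed
    finally show ?thesis .
  next
    case False
    then obtain w where w: "\<not> 0 \<le> face_exponent b \<sigma> w" by blast
    have "slice b X (\<sigma> - {v}) = 0" if v: "v \<in> \<sigma>" for v
    proof -
      have "\<not> 0 \<le> face_exponent b (\<sigma> - {v}) w" using w by (auto split: if_splits)
      then have "\<not> (\<forall>w. 0 \<le> face_exponent b (\<sigma> - {v}) w)" by blast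
      then show ?thesis unfolding slice_def by (rule if_not_P)
    qed
    then have "coboundary (slice b X) \<sigma> = 0" unfolding coboundary_def by (intro sum.neutral) simp
    then show ?thesis unfolding slice_def if_not_P[OF False] by simp
  qed
qed

text \<open>The multidegree of the monomial \<open>m\<close> at position \<open>\<sigma>\<close>.\<close>

definition multidegree :: "('v \<Rightarrow>\<^sub>0 nat) \<Rightarrow> 'v set \<Rightarrow> 'v \<Rightarrow> int" where
  "multidegree m \<sigma> = (\<lambda>v. exponent_of m v + (if v \<in> \<sigma> then 0 else 1))"

lemma face_exponent_multidegree [simp]: "face_exponent (multidegree m \<sigma>) \<sigma> = exponent_of m"
  by (auto simp: multidegree_def)

lemma multidegree_monomial_of:
  assumes "\<And>v. 0 \<le> face_exponent b \<sigma> v"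
  shows "multidegree (monomial_of (face_exponent b \<sigma>)) \<sigma> = b"
  unfolding multidegree_def exponent_of_monomial_of[OF assms] by auto

lemma slice_multidegree: "slice (multidegree m \<sigma>) X \<sigma> = Poly_Mapping.lookup (X \<sigma>) m"
proof -
  have c: "\<forall>v. 0 \<le> face_exponent (multidegree m \<sigma>) \<sigma> v" by (simp add: multidegree_def)
  show ?thesis unfolding slice_def if_P[OF c] face_exponent_multidegree monomial_of_exponent_of ..
qed

lemma slice_eqI: "(\<And>b. slice b X = slice b Y) \<Longrightarrow> X = Y"
  by (intro ext poly_mapping_eqI) (metis slice_multidegree)

lemma slice_nonzeroD:
  assumes "slice b X \<sigma> \<noteq> 0"
  shows "\<And>v. 0 \<le> face_exponent b \<sigma> v" "monomial_of (face_exponent b \<sigma>) \<in> Poly_Mapping.keys (X \<sigma>)"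
  using assms unfolding slice_def in_keys_iff by (metis, metis)

lemma finite_slices:
  fixes X :: "'v::finite set \<Rightarrow> ('v, 'k::field) mpoly"
  shows "finite {b. slice b X \<noteq> (\<lambda>\<sigma>. 0)}"
proof (rule finite_subset)
  show "{b. slice b X \<noteq> (\<lambda>\<sigma>. 0)} \<subseteq> (\<Union>\<sigma>. (\<lambda>m. multidegree m \<sigma>) ` Poly_Mapping.keys (X \<sigma>))"
  proof
    fix b assume "b \<in> {b. slice b X \<noteq> (\<lambda>\<sigma>. 0)}"
    then obtain \<sigma> where s: "slice b X \<sigma> \<noteq> 0" by auto
    have "b = multidegree (monomial_of (face_exponent b \<sigma>)) \<sigma>"
      by (rule multidegree_monomial_of[symmetric, OF slice_nonzeroD(1)[OF s]])
    with slice_nonzeroD(2)[OF s] show "b \<in> (\<Union>\<sigma>. (\<lambda>m. multidegree m \<sigma>) ` Poly_Mapping.keys (X \<sigma>))"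
      by blast
  qed
qed simp

lemma slices_assemble:
  fixes w :: "('v::finite \<Rightarrow> int) \<Rightarrow> 'v set \<Rightarrow> 'k::field"
  assumes fin: "finite {b. w b \<noteq> (\<lambda>\<sigma>. 0)}" and nonneg: "\<And>b \<sigma> v. w b \<sigma> \<noteq> 0 \<Longrightarrow> 0 \<le> face_exponent b \<sigma> v"
  shows "\<exists>X. \<forall>b. slice b X = w b"
proof -
  define X :: "'v set \<Rightarrow> ('v, 'k) mpoly" where "X \<sigma> = Abs_poly_mapping (\<lambda>m. w (multidegree m \<sigma>) \<sigma>)" for \<sigma>
  have look: "Poly_Mapping.lookup (X \<sigma>) m = w (multidegree m \<sigma>) \<sigma>" for \<sigma> m
  proof -
    have "inj (\<lambda>m. multidegree m \<sigma>)"
      by (rule injI) (metis face_exponent_multidegree inj_exponent_of)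
    then have "finite ((\<lambda>m. multidegree m \<sigma>) -` {b. w b \<noteq> (\<lambda>\<sigma>. 0)})" by (rule finite_vimageI[OF fin])
    then have "finite {m. w (multidegree m \<sigma>) \<sigma> \<noteq> 0}" by (rule rev_finite_subset) auto
    then show ?thesis by (simp add: X_def)
  qed
  have "slice b X \<sigma> = w b \<sigma>" for b \<sigma>
  proof (cases "\<forall>v. 0 \<le> face_exponent b \<sigma> v")
    case True
    then show ?thesis unfolding slice_def if_P[OF True] look using multidegree_monomial_of[of \<sigma> b] by simp
  next
    case False
    have "w b \<sigma> = 0"
    proof (rule ccontr)
      assume n: "w b \<sigma> \<noteq> 0"
      have "\<forall>v. 0 \<le> face_exponent b \<sigma> v" by (intro allI nonneg[OF n])
      then show False using False by contradiction
    qed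
    then show ?thesis unfolding slice_def if_not_P[OF False] by simp
  qed
  then show ?thesis by auto
qed

text \<open>Positions in homological degree \<open>p\<close>; the set is empty for \<open>p > n\<close>.\<close>

definition faces :: "nat \<Rightarrow> 'v::finite set set" where
  "faces p = {\<sigma>. card \<sigma> + p = card (UNIV :: 'v set)}"

lemma faces_iff:
  fixes \<sigma> :: "'v::finite set"
  shows "\<sigma> \<in> faces p \<longleftrightarrow> int (card \<sigma>) = int (card (UNIV :: 'v set)) - int p"
  by (auto simp: faces_def)

lemma faces_remove:
  fixes \<sigma> :: "'v::finite set"
  shows "v \<in> \<sigma> \<Longrightarrow> \<sigma> - {v} \<in> faces (Suc p) \<longleftrightarrow> \<sigma> \<in> faces p"
  unfolding faces_iff by (subst card_remove_int) auto

lemma koszul_diff_supported: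
  fixes X :: "'v::finite set \<Rightarrow> ('v, 'k::field) mpoly"
  assumes "\<And>\<sigma>. \<sigma> \<notin> faces (Suc p) \<Longrightarrow> X \<sigma> = 0" "\<sigma> \<notin> faces p"
  shows "koszul_diff X \<sigma> = 0"
  unfolding koszul_diff_def using assms faces_remove by (intro sum.neutral) fastforce

text \<open>Primitives of the finitely many nonzero slices are assembled to a Koszul chain.\<close>

lemma koszul_boundary:
  fixes X :: "'v::finite set \<Rightarrow> ('v, 'k::field) mpoly"
  assumes S: "\<And>b \<sigma> v. \<sigma> \<in> S b \<Longrightarrow> 0 \<le> face_exponent b \<sigma> v"
    and X: "\<And>b. slice b X \<noteq> (\<lambda>\<sigma>. 0) \<Longrightarrow> slice b X \<in> coboundary ` cochains (S b) m"
  shows "\<exists>Y. koszul_diff Y = X \<and> (\<forall>b. slice b Y \<in> cochains (S b) m)"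
proof -
  have "\<exists>w. w \<in> cochains (S b) m \<and> coboundary w = slice b X \<and> (slice b X = (\<lambda>\<sigma>. 0) \<longrightarrow> w = (\<lambda>\<sigma>. 0))" for b
  proof (cases "slice b X = (\<lambda>\<sigma>. 0)")
    case True
    then show ?thesis by (intro exI[of _ "\<lambda>\<sigma>. 0"]) (simp add: cochains_def)
  next
    case False
    then show ?thesis using X[OF False] by auto
  qed
  then obtain w where w: "\<And>b. w b \<in> cochains (S b) m" "\<And>b. coboundary (w b) = slice b X"
    "\<And>b. slice b X = (\<lambda>\<sigma>. 0) \<Longrightarrow> w b = (\<lambda>\<sigma>. 0)" by metis
  have "finite {b. w b \<noteq> (\<lambda>\<sigma>. 0)}"
    by (rule finite_subset[OF _ finite_slices[of X]]) (use w(3) in auto)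
  moreover have "0 \<le> face_exponent b \<sigma> v" if "w b \<sigma> \<noteq> 0" for b \<sigma> v
    by (rule S) (use cochainsD[OF w(1) that] in simp)
  ultimately obtain Y where Y: "\<And>b. slice b Y = w b" using slices_assemble[of w] by blast
  have "koszul_diff Y = X"
    by (rule slice_eqI) (simp add: slice_koszul_diff Y w(2))
  then show ?thesis using Y w(1) by auto
qed

text \<open>An arbitrary enumeration, needed because free complexes are given by matrices with numbered rows and
  columns.\<close>

definition nth_face :: "nat \<Rightarrow> nat \<Rightarrow> 'v::finite set" where
  "nth_face p = (SOME f. bij_betw f {..<card (faces p :: 'v set set)} (faces p))"

lemma nth_face_bij: "bij_betw (nth_face p) {..<card (faces p :: 'v::finite set set)} (faces p :: 'v set set)"
proof -
  have "\<exists>f. bij_betw f {..<card (faces p :: 'v set set)} (faces p :: 'v set set)"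
    using ex_bij_betw_nat_finite[of "faces p :: 'v set set"] by (simp add: lessThan_atLeast0)
  then show ?thesis unfolding nth_face_def by (rule someI_ex)
qed

definition koszul :: "('v::finite, 'k::field) free_complex" where
  "koszul = \<lparr>
     rank = (\<lambda>p. card (faces p :: 'v set set)),
     twist = (\<lambda>p a. int p),
     diff = (\<lambda>p. mat (card (faces p :: 'v set set)) (card (faces (Suc p) :: 'v set set))
       (\<lambda>(a, b). \<Sum>v\<in>nth_face p a. if nth_face p a - {v} = nth_face (Suc p) b then face_sign v (nth_face p a) * var v else 0)),
     aug = vec (card (faces 0 :: 'v set set)) (\<lambda>_. 1)\<rparr>"

lemma koszul_simps [simp]:
  "rank (koszul :: ('v::finite, 'k::field) free_complex) p = card (faces p :: 'v set set)"
  "twist (koszul :: ('v, 'k) free_complex) p a = int p"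
  by (simp_all add: koszul_def)

definition face_function :: "nat \<Rightarrow> ('v::finite, 'k::field) mpoly vec \<Rightarrow> 'v set \<Rightarrow> ('v, 'k) mpoly" where
  "face_function p x \<sigma> = (if \<sigma> \<in> faces p then x $ inv_into {..<card (faces p :: 'v set set)} (nth_face p) \<sigma> else 0)"

definition face_vec :: "nat \<Rightarrow> ('v::finite set \<Rightarrow> ('v, 'k::field) mpoly) \<Rightarrow> ('v, 'k) mpoly vec" where
  "face_vec p X = vec (card (faces p :: 'v set set)) (\<lambda>a. X (nth_face p a))"

lemma nth_face_in [simp]: "a < card (faces p :: 'v::finite set set) \<Longrightarrow> (nth_face p a :: 'v set) \<in> faces p"
  using nth_face_bij[where 'v='v, of p] by (auto simp: bij_betw_def)

lemma face_function_nth: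
  fixes x :: "('v::finite, 'k::field) mpoly vec"
  assumes "a < card (faces p :: 'v set set)"
  shows "face_function p x (nth_face p a) = x $ a"
  using assms nth_face_bij[where 'v='v, of p]
  by (simp add: face_function_def bij_betw_def inv_into_f_f)

lemma faces_nthE:
  assumes "(\<sigma> :: 'v::finite set) \<in> faces p"
  obtains a where "a < card (faces p :: 'v set set)" "\<sigma> = nth_face p a"
  using assms nth_face_bij[where 'v='v, of p] unfolding bij_betw_def by blast

lemma face_function_supported: "\<sigma> \<notin> faces p \<Longrightarrow> face_function p x \<sigma> = 0"
  by (simp add: face_function_def)

lemma face_vec_carrier [simp]: "face_vec p (X :: 'v::finite set \<Rightarrow> ('v, 'k::field) mpoly) \<in> carrier_vec (card (faces p :: 'v set set))"
  by (simp add: face_vec_def)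

lemma face_function_vec:
  fixes X :: "'v::finite set \<Rightarrow> ('v, 'k::field) mpoly"
  assumes "\<And>\<sigma>. \<sigma> \<notin> faces p \<Longrightarrow> X \<sigma> = 0"
  shows "face_function p (face_vec p X) = X"
proof
  fix \<sigma> :: "'v set"
  show "face_function p (face_vec p X) \<sigma> = X \<sigma>"
  proof (cases "\<sigma> \<in> faces p")
    case True
    then obtain a where "a < card (faces p :: 'v set set)" "\<sigma> = nth_face p a" by (rule faces_nthE)
    then show ?thesis by (simp add: face_function_nth) (simp add: face_vec_def)
  qed (simp add: assms face_function_supported)
qed

lemma face_function_eqI:
  fixes x y :: "('v::finite, 'k::field) mpoly vec"
  assumes "x \<in> carrier_vec (card (faces p :: 'v set set))" "y \<in> carrier_vec (card (faces p :: 'v set set))"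
    "face_function p x = face_function p y"
  shows "x = y"
proof (rule eq_vecI)
  fix a assume "a < dim_vec y"
  then have "a < card (faces p :: 'v set set)" using assms(2) by simp
  from face_function_nth[OF this, of x] face_function_nth[OF this, of y] show "x $ a = y $ a"
    by (simp add: assms(3))
qed (use assms in simp)

lemma koszul_diff_carrier: "diff (koszul :: ('v::finite, 'k::field) free_complex) p
  \<in> carrier_mat (card (faces p :: 'v set set)) (card (faces (Suc p) :: 'v set set))"
  by (simp add: koszul_def)

lemma face_function_diff:
  fixes x :: "('v::finite, 'k::field) mpoly vec"
  assumes x: "x \<in> carrier_vec (card (faces (Suc p) :: 'v set set))"
  shows "face_function p (diff koszul p *\<^sub>v x) = koszul_diff (face_function (Suc p) x)"
proof
  fix \<sigma> :: "'v set"
  show "face_function p (diff koszul p *\<^sub>v x) \<sigma> = koszul_diff (face_function (Suc p) x) \<sigma>"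
  proof (cases "\<sigma> \<in> faces p")
    case False
    then show ?thesis using koszul_diff_supported[of p "face_function (Suc p) x" \<sigma>]
      by (simp add: face_function_supported)
  next
    case True
    then obtain a where a: "a < card (faces p :: 'v set set)" "\<sigma> = nth_face p a" by (rule faces_nthE)
    let ?n = "card (faces (Suc p) :: 'v set set)"
    let ?c = "\<lambda>\<tau>. \<Sum>v\<in>\<sigma>. if \<sigma> - {v} = \<tau> then face_sign v \<sigma> * var v else 0"
    have "face_function p (diff koszul p *\<^sub>v x) \<sigma> = (diff koszul p *\<^sub>v x) $ a"
      unfolding a(2) by (rule face_function_nth[OF a(1)])
    also have "\<dots> = (\<Sum>b<?n. ?c (nth_face (Suc p) b) * x $ b)"
      using a x by (auto simp: koszul_def scalar_prod_def lessThan_atLeast0 intro!: sum.cong)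
    also have "\<dots> = (\<Sum>b<?n. ?c (nth_face (Suc p) b) * face_function (Suc p) x (nth_face (Suc p) b))"
      by (rule sum.cong) (auto simp: face_function_nth)
    also have "\<dots> = (\<Sum>\<tau>\<in>faces (Suc p). ?c \<tau> * face_function (Suc p) x \<tau>)"
      by (rule sum.reindex_bij_betw[OF nth_face_bij])
    also have "\<dots> = (\<Sum>\<tau>\<in>faces (Suc p). \<Sum>v\<in>\<sigma>. if \<sigma> - {v} = \<tau> then face_sign v \<sigma> * var v * face_function (Suc p) x \<tau> else 0)"
      by (rule sum.cong[OF refl]) (auto simp: sum_distrib_right intro!: sum.cong)
    also have "\<dots> = (\<Sum>v\<in>\<sigma>. \<Sum>\<tau>\<in>faces (Suc p). if \<sigma> - {v} = \<tau> then face_sign v \<sigma> * var v * face_function (Suc p) x \<tau> else 0)"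
      by (rule sum.swap)
    also have "\<dots> = koszul_diff (face_function (Suc p) x) \<sigma>"
      unfolding koszul_diff_def
    proof (rule sum.cong[OF refl])
      fix v assume "v \<in> \<sigma>"
      then have "\<sigma> - {v} \<in> faces (Suc p)" using faces_remove True by blast
      then show "(\<Sum>\<tau>\<in>faces (Suc p). if \<sigma> - {v} = \<tau> then face_sign v \<sigma> * var v * face_function (Suc p) x \<tau> else 0)
        = face_sign v \<sigma> * var v * face_function (Suc p) x (\<sigma> - {v})"
        by (subst sum.delta') auto
    qed
    finally show ?thesis .
  qed
qed

definition koszul_family :: "(('v \<Rightarrow> int) \<Rightarrow> bool) \<Rightarrow> ('v \<Rightarrow> int) \<Rightarrow> 'v set set" where
  "koszul_family P b = cube_family P (\<lambda>v. b v - 1) b"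

lemma mem_koszul_family: "\<sigma> \<in> koszul_family P b \<longleftrightarrow> P (face_exponent b \<sigma>)"
  by (simp add: koszul_family_def cube_family_def)

definition monomial_ideal :: "(('v \<Rightarrow> int) \<Rightarrow> bool) \<Rightarrow> ('v, 'k::field) mpoly set" where
  "monomial_ideal P = {p. \<forall>m\<in>Poly_Mapping.keys p. P (exponent_of m)}"

lemma sum_face_exponent:
  fixes b :: "'v::finite \<Rightarrow> int"
  assumes "\<sigma> \<in> faces p"
  shows "(\<Sum>v\<in>UNIV. face_exponent b \<sigma> v) = (\<Sum>v\<in>UNIV. b v) - int p"
proof -
  have "(\<Sum>v\<in>UNIV. face_exponent b \<sigma> v) = (\<Sum>v\<in>UNIV. b v - (if v \<in> - \<sigma> then 1 else 0))"
    by (rule sum.cong) auto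
  also have "\<dots> = (\<Sum>v\<in>UNIV. b v) - int (card (- \<sigma>))"
    by (simp add: sum_subtractf sum.If_cases Compl_eq)
  also have "card (- \<sigma>) = p" using assms by (simp add: faces_def Compl_eq_Diff_UNIV card_Diff_subset)
  finally show ?thesis .
qed

lemma mono_degree_monomial_of:
  "(\<And>v. 0 \<le> e v) \<Longrightarrow> int (mono_degree (monomial_of e)) = (\<Sum>v\<in>UNIV. e v)"
  by (simp add: exponent_of_monomial_of flip: sum_exponent_of)

text \<open>Membership in a monomial ideal and homogeneity are both conditions on the monomials that occur, so they
  are conditions on the slices.\<close>

lemma tensor_component_koszul:
  fixes x :: "('v::finite, 'k::field) mpoly vec"
  assumes x: "x \<in> carrier_vec (card (faces p :: 'v set set))"
  shows "x \<in> tensor_component koszul (monomial_ideal P) p j \<longleftrightarrow>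
    (\<forall>b. slice b (face_function p x) \<in>
      cochains (if (\<Sum>v\<in>UNIV. b v) = j then koszul_family P b else {}) (int (card (UNIV :: 'v set)) - int p))"
    (is "?L \<longleftrightarrow> ?R")
proof
  assume L: ?L
  show ?R
  proof (rule allI)
    fix b :: "'v \<Rightarrow> int"
    have "(\<Sum>v\<in>UNIV. b v) = j \<and> \<sigma> \<in> koszul_family P b \<and> \<sigma> \<in> faces p" if n: "slice b (face_function p x) \<sigma> \<noteq> 0" for \<sigma>
    proof -
      note k = slice_nonzeroD[OF n]
      have f: "\<sigma> \<in> faces p" using k(2) face_function_supported[of \<sigma> p x] by force
      then obtain a where a: "a < card (faces p :: 'v set set)" "\<sigma> = nth_face p a" by (rule faces_nthE)
      have "x $ a \<in> monomial_ideal P \<inter> homogeneous (j - int p)"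
        using L a by (simp add: tensor_component_def)
      moreover have "monomial_of (face_exponent b \<sigma>) \<in> Poly_Mapping.keys (x $ a)"
        using k(2) face_function_nth[OF a(1), of x] a(2) by simp
      ultimately have "P (exponent_of (monomial_of (face_exponent b \<sigma>)))"
        "int (mono_degree (monomial_of (face_exponent b \<sigma>))) = j - int p"
        by (auto simp: monomial_ideal_def homogeneous_def)
      then have "P (face_exponent b \<sigma>)" "(\<Sum>v\<in>UNIV. face_exponent b \<sigma> v) = j - int p"
        unfolding exponent_of_monomial_of[OF k(1)] mono_degree_monomial_of[OF k(1)] .
      then show ?thesis unfolding sum_face_exponent[OF f] mem_koszul_family using f by simp
    qed
    then show "slice b (face_function p x) \<in>
      cochains (if (\<Sum>v\<in>UNIV. b v) = j then koszul_family P b else {}) (int (card (UNIV :: 'v set)) - int p)"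
      unfolding cochains_def faces_iff by auto
  qed
next
  assume R: ?R
  have "x $ a \<in> monomial_ideal P \<inter> homogeneous (j - int p)" if a: "a < card (faces p :: 'v set set)" for a
  proof -
    let ?\<sigma> = "nth_face p a :: 'v set"
    have "P (exponent_of m) \<and> int (mono_degree m) = j - int p" if m: "m \<in> Poly_Mapping.keys (x $ a)" for m
    proof -
      have "slice (multidegree m ?\<sigma>) (face_function p x) ?\<sigma> \<noteq> 0"
        unfolding slice_multidegree face_function_nth[OF a] using m by (simp add: in_keys_iff)
      then have s: "(\<Sum>v\<in>UNIV. multidegree m ?\<sigma> v) = j" "?\<sigma> \<in> koszul_family P (multidegree m ?\<sigma>)"
        using cochainsD[OF R[rule_format]] by (metis empty_iff)+
      have "(\<Sum>v\<in>UNIV. exponent_of m v) = j - int p"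
        using sum_face_exponent[OF nth_face_in[OF a], of "multidegree m ?\<sigma>"] s(1)
        unfolding face_exponent_multidegree by simp
      moreover have "P (exponent_of m)" using s(2) unfolding mem_koszul_family face_exponent_multidegree .
      ultimately show ?thesis by (simp add: sum_exponent_of)
    qed
    then show ?thesis by (auto simp: monomial_ideal_def homogeneous_def)
  qed
  then show ?L using x by (simp add: tensor_component_def)
qed

lemma face_function_zero [simp]: "face_function p (0\<^sub>v (card (faces p :: 'v::finite set set))) = (\<lambda>\<sigma>. 0 :: ('v, 'k::field) mpoly)"
proof
  fix \<sigma> :: "'v set"
  show "face_function p (0\<^sub>v (card (faces p :: 'v set set))) \<sigma> = (0 :: ('v, 'k) mpoly)"
  proof (cases "\<sigma> \<in> faces p")
    case True
    then obtain a where "a < card (faces p :: 'v set set)" "\<sigma> = nth_face p a" by (rule faces_nthE)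
    then show ?thesis by (simp add: face_function_nth)
  qed (simp add: face_function_supported)
qed

lemma faces_zero: "faces 0 = {UNIV :: 'v::finite set}"
  using card_subset_eq[of "UNIV :: 'v set"] by (auto simp: faces_def)

text \<open>In homological degree 0 every chain is a cycle, and \<open>koszul_diff\<close> vanishes because
  \<open>\<sigma> - {v}\<close> is never the full set.\<close>

lemma koszul_cycle_iff:
  fixes x :: "('v::finite, 'k::field) mpoly vec"
  assumes x: "x \<in> carrier_vec (card (faces i :: 'v set set))"
  shows "(\<forall>p. i = Suc p \<longrightarrow> diff koszul p *\<^sub>v x = 0\<^sub>v (card (faces p :: 'v set set)))
    \<longleftrightarrow> koszul_diff (face_function i x) = (\<lambda>\<sigma>. 0)"
proof (cases i)
  case 0
  have "koszul_diff (face_function 0 x) \<sigma> = 0" for \<sigma>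
    unfolding koszul_diff_def
    by (rule sum.neutral) (auto simp: face_function_def faces_zero)
  then show ?thesis using 0 by auto
next
  case (Suc p)
  have x': "x \<in> carrier_vec (card (faces (Suc p) :: 'v set set))" using x Suc by simp
  have "diff koszul p *\<^sub>v x = 0\<^sub>v (card (faces p :: 'v set set)) \<longleftrightarrow> face_function p (diff koszul p *\<^sub>v x) = (\<lambda>\<sigma>. 0)"
    using face_function_eqI[OF mult_mat_vec_carrier[OF koszul_diff_carrier x'], of "0\<^sub>v (card (faces p :: 'v set set))"] by auto
  then show ?thesis unfolding Suc face_function_diff[OF x'] by simp
qed

lemma koszul_boundary_vec:
  fixes x :: "('v::finite, 'k::field) mpoly vec"
  assumes x: "x \<in> carrier_vec (card (faces i :: 'v set set))"
    and cyc: "koszul_diff (face_function i x) = (\<lambda>\<sigma>. 0)"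
    and T: "\<And>b \<sigma> v. \<sigma> \<in> T b \<Longrightarrow> 0 \<le> face_exponent b \<sigma> v"
    and sl: "\<And>b. slice b (face_function i x) \<in> cochains (T b) (int (card (UNIV :: 'v set)) - int i)"
    and van: "\<And>b. slice b (face_function i x) \<noteq> (\<lambda>\<sigma>. 0) \<Longrightarrow>
      \<not> cohomology_nonzero TYPE('k) (T b) (int (card (UNIV :: 'v set)) - int i)"
  shows "\<exists>y\<in>carrier_vec (card (faces (Suc i) :: 'v set set)). diff koszul i *\<^sub>v y = x \<and>
    (\<forall>b. slice b (face_function (Suc i) y) \<in> cochains (T b) (int (card (UNIV :: 'v set)) - int (Suc i)))"
proof -
  let ?X = "face_function i x"
  have m: "int (card (UNIV :: 'v set)) - int i - 1 = int (card (UNIV :: 'v set)) - int (Suc i)" by simp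
  have "slice b ?X \<in> coboundary ` cochains (T b) (int (card (UNIV :: 'v set)) - int (Suc i))"
    if "slice b ?X \<noteq> (\<lambda>\<sigma>. 0)" for b
  proof -
    have "coboundary (slice b ?X) = (\<lambda>\<sigma>. 0)"
      unfolding slice_koszul_diff[symmetric] cyc by (auto simp: slice_def fun_eq_iff)
    then show ?thesis using van[OF that] sl[of b] unfolding cohomology_nonzero_def m by blast
  qed
  note bd = this
  have "\<exists>Y. koszul_diff Y = ?X \<and> (\<forall>b. slice b Y \<in> cochains (T b) (int (card (UNIV :: 'v set)) - int (Suc i)))"
    by (rule koszul_boundary, erule T, erule bd)
  then obtain Y where Y: "koszul_diff Y = ?X"
    "\<And>b. slice b Y \<in> cochains (T b) (int (card (UNIV :: 'v set)) - int (Suc i))" by blast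
  have supp: "Y \<sigma> = 0" if "\<sigma> \<notin> faces (Suc i)" for \<sigma>
  proof (rule poly_mapping_eqI)
    fix m
    have "slice (multidegree m \<sigma>) Y \<sigma> = 0"
      using cochain_zero_card[OF Y(2)] that unfolding faces_iff by blast
    then show "Poly_Mapping.lookup (Y \<sigma>) m = Poly_Mapping.lookup 0 m" by (simp add: slice_multidegree)
  qed
  have ff: "face_function (Suc i) (face_vec (Suc i) Y) = Y" by (rule face_function_vec[OF supp])
  have "diff koszul i *\<^sub>v face_vec (Suc i) Y = x"
    by (rule face_function_eqI[OF mult_mat_vec_carrier[OF koszul_diff_carrier face_vec_carrier] x])
       (simp add: face_function_diff ff Y(1))
  then show ?thesis using Y(2) ff by (intro bexI[of _ "face_vec (Suc i) Y"]) auto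
qed

text \<open>A Koszul chain of the ideal is the sum of its slices, and each slice is a cochain on the family of its
  multidegree.\<close>

theorem koszul_homology_vanishes_iff:
  fixes P :: "('v::finite \<Rightarrow> int) \<Rightarrow> bool"
  assumes P: "\<And>e v. P e \<Longrightarrow> 0 \<le> e v"
  shows "tensor_cycles koszul (monomial_ideal P :: ('v, 'k::field) mpoly set) i j
      \<subseteq> tensor_boundaries koszul (monomial_ideal P) i j \<longleftrightarrow>
    (\<forall>b. (\<Sum>v\<in>UNIV. b v) = j \<longrightarrow>
      \<not> cohomology_nonzero TYPE('k) (koszul_family P b) (int (card (UNIV :: 'v set)) - int i))"
    (is "?L \<longleftrightarrow> ?R")
proof
  let ?M = "monomial_ideal P :: ('v, 'k) mpoly set"
  let ?n = "int (card (UNIV :: 'v set))"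
  let ?T = "\<lambda>b. if (\<Sum>v\<in>UNIV. b v) = j then koszul_family P b else {}"
  have T: "0 \<le> face_exponent b \<sigma> v" if "\<sigma> \<in> ?T b" for b :: "'v \<Rightarrow> int" and \<sigma> v
    using that P[of "face_exponent b \<sigma>" v] by (auto simp: mem_koszul_family split: if_splits)
  {
    assume R: ?R
    show ?L
    proof
      fix x assume "x \<in> tensor_cycles koszul ?M i j"
      then have x: "x \<in> tensor_component koszul ?M i j"
        "\<forall>p. i = Suc p \<longrightarrow> diff koszul p *\<^sub>v x = 0\<^sub>v (card (faces p :: 'v set set))"
        by (auto simp: tensor_cycles_def)
      have xc: "x \<in> carrier_vec (card (faces i :: 'v set set))"
        using tensor_component_carrier[OF x(1)] by simp
      have sl: "\<And>b. slice b (face_function i x) \<in> cochains (?T b) (?n - int i)"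
        using x(1) unfolding tensor_component_koszul[OF xc] by blast
      have "\<not> cohomology_nonzero TYPE('k) (?T b) (?n - int i)" if n: "slice b (face_function i x) \<noteq> (\<lambda>\<sigma>. 0)" for b
      proof -
        obtain \<sigma> where "slice b (face_function i x) \<sigma> \<noteq> 0" using n by auto
        then have "(\<Sum>v\<in>UNIV. b v) = j" using cochainsD[OF sl] by (metis empty_iff)
        then show ?thesis using R by simp
      qed
      note van = this
      have "\<exists>y\<in>carrier_vec (card (faces (Suc i) :: 'v set set)). diff koszul i *\<^sub>v y = x \<and>
          (\<forall>b. slice b (face_function (Suc i) y) \<in> cochains (?T b) (?n - int (Suc i)))"
        by (rule koszul_boundary_vec[OF xc iffD1[OF koszul_cycle_iff[OF xc] x(2)]], erule T, rule sl, erule van)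
      then
      obtain y where y: "y \<in> carrier_vec (card (faces (Suc i) :: 'v set set))" "diff koszul i *\<^sub>v y = x"
        "\<forall>b. slice b (face_function (Suc i) y) \<in> cochains (?T b) (?n - int (Suc i))" by blast
      have "y \<in> tensor_component koszul ?M (Suc i) j"
        unfolding tensor_component_koszul[OF y(1)] by (rule y(3))
      then show "x \<in> tensor_boundaries koszul ?M i j"
        unfolding tensor_boundaries_def using y(2) by blast
    qed
  }
  {
    assume L: ?L
    show ?R
    proof (intro allI impI notI)
      fix b :: "'v \<Rightarrow> int"
      assume b: "(\<Sum>v\<in>UNIV. b v) = j" and nz: "cohomology_nonzero TYPE('k) (koszul_family P b) (?n - int i)"
      then obtain z :: "'v set \<Rightarrow> 'k" where z: "z \<in> cochains (koszul_family P b) (?n - int i)"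
        "coboundary z = (\<lambda>\<sigma>. 0)" "z \<notin> coboundary ` cochains (koszul_family P b) (?n - int i - 1)"
        unfolding cohomology_nonzero_def by blast
      define w where "w c = (if c = b then z else (\<lambda>\<sigma>. 0))" for c
      have "{c. w c \<noteq> (\<lambda>\<sigma>. 0)} \<subseteq> {b}" by (auto simp: w_def)
      then have "finite {c. w c \<noteq> (\<lambda>\<sigma>. 0)}" by (rule finite_subset) simp
      moreover have "0 \<le> face_exponent c \<sigma> v" if "w c \<sigma> \<noteq> 0" for c \<sigma> v
        using that cochainsD[OF z(1), of \<sigma>] T[of \<sigma> b v] b unfolding w_def by (metis (full_types))
      ultimately obtain X where X: "\<And>c. slice c X = w c" using slices_assemble[of w] by blast
      have wc: "w c \<in> cochains (?T c) (?n - int i)" for c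
        using z(1) b by (auto simp: w_def cochains_def)
      have supp: "X \<sigma> = 0" if "\<sigma> \<notin> faces i" for \<sigma>
      proof (rule poly_mapping_eqI)
        fix m
        have "w (multidegree m \<sigma>) \<sigma> = 0" using cochain_zero_card[OF wc] that unfolding faces_iff by blast
        then show "Poly_Mapping.lookup (X \<sigma>) m = Poly_Mapping.lookup 0 m"
          using slice_multidegree[of m \<sigma> X] by (simp add: X)
      qed
      have ff: "face_function i (face_vec i X) = X" by (rule face_function_vec[OF supp])
      have "face_vec i X \<in> tensor_component koszul ?M i j"
        unfolding tensor_component_koszul[OF face_vec_carrier] ff X using wc by blast
      moreover have "koszul_diff X = (\<lambda>\<sigma>. 0)"
      proof (rule slice_eqI)
        fix c
        have "coboundary (w c) = (\<lambda>\<sigma>. 0)" using z(2) by (simp add: w_def)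
        then show "slice c (koszul_diff X) = slice c (\<lambda>\<sigma>. 0)"
          unfolding slice_koszul_diff X by (auto simp: slice_def fun_eq_iff)
      qed
      ultimately have "face_vec i X \<in> tensor_cycles koszul ?M i j"
        using koszul_cycle_iff[OF face_vec_carrier, of i X] unfolding tensor_cycles_def ff by simp
      then obtain y where y: "y \<in> tensor_component koszul ?M (Suc i) j" "face_vec i X = diff koszul i *\<^sub>v y"
        using L unfolding tensor_boundaries_def by blast
      have yc: "y \<in> carrier_vec (card (faces (Suc i) :: 'v set set))"
        using tensor_component_carrier[OF y(1)] by simp
      have "X = koszul_diff (face_function (Suc i) y)"
        using ff y(2) face_function_diff[OF yc] by simp
      then have "coboundary (slice b (face_function (Suc i) y)) = z"
        using X[of b] slice_koszul_diff[of b "face_function (Suc i) y"] by (simp add: w_def)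
      moreover have "slice b (face_function (Suc i) y) \<in> cochains (koszul_family P b) (?n - int i - 1)"
        using y(1)[unfolded tensor_component_koszul[OF yc], rule_format, of b] b by (simp add: algebra_simps)
      ultimately show False using z(3) by blast
    qed
  }
qed

lemma koszul_augmentation:
  fixes x :: "('v::finite, 'k::field) mpoly vec"
  assumes "x \<in> carrier_vec (card (faces 0 :: 'v set set))"
  shows "augmentation koszul x = slice (\<lambda>v. 0) (face_function 0 x) UNIV"
proof -
  have c: "card (faces 0 :: 'v set set) = 1" by (simp add: faces_zero)
  have n: "nth_face 0 0 = (UNIV :: 'v set)"
    using nth_face_in[where 'v='v, of 0 0] c faces_zero by auto
  have "augmentation koszul x = const_coeff (x $ 0)"
    using assms by (simp add: augmentation_def koszul_def scalar_prod_def c)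
  moreover have "x $ 0 = face_function 0 x UNIV"
    using face_function_nth[where 'v='v, of 0 0 x] c n by simp
  moreover have "monomial_of (\<lambda>v::'v. 0) = 0" by (rule poly_mapping_eqI) simp
  ultimately show ?thesis by (simp add: slice_def const_coeff_def)
qed

lemma var_homogeneous: "var v \<in> homogeneous 1"
proof -
  have "mono_degree (Poly_Mapping.single v 1) = 1"
    by (simp add: mono_degree_def lookup_single when_def)
  then show ?thesis by (simp add: var_def homogeneous_def)
qed

lemma face_sign_mult_homogeneous:
  "q \<in> homogeneous j \<Longrightarrow> face_sign v \<sigma> * q \<in> homogeneous j"
  by (auto simp: homogeneous_def in_keys_iff lookup_face_sign_mult)

text \<open>For the ring itself the family in multidegree \<open>b\<close> is a cone with apex any \<open>v\<close>
  with \<open>b v \<ge> 1\<close>; only \<open>b = 0\<close> has cohomology, and this is what the augmentation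
  detects.\<close>

lemma koszul_exact:
  fixes x :: "('v::finite, 'k::field) mpoly vec"
  assumes x: "x \<in> carrier_vec (card (faces p :: 'v set set))"
    and cyc: "koszul_diff (face_function p x) = (\<lambda>\<sigma>. 0)"
    and aug: "p = 0 \<Longrightarrow> slice (\<lambda>v. 0) (face_function p x) UNIV = 0"
  shows "\<exists>y\<in>carrier_vec (card (faces (Suc p) :: 'v set set)). diff koszul p *\<^sub>v y = x"
proof -
  let ?P = "\<lambda>e :: 'v \<Rightarrow> int. \<forall>v. 0 \<le> e v"
  let ?X = "face_function p x"
  have "slice b ?X \<in> cochains (koszul_family ?P b) (int (card (UNIV :: 'v set)) - int p)" for b
    unfolding cochains_def
  proof (intro CollectI allI impI)
    fix \<sigma> assume n: "slice b ?X \<sigma> \<noteq> 0"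
    have "\<sigma> \<in> faces p" using slice_nonzeroD(2)[OF n] face_function_supported[of \<sigma> p x] by force
    then show "\<sigma> \<in> koszul_family ?P b \<and> int (card \<sigma>) = int (card (UNIV :: 'v set)) - int p"
      using slice_nonzeroD(1)[OF n] unfolding mem_koszul_family faces_iff by blast
  qed
  moreover have "\<not> cohomology_nonzero TYPE('k) (koszul_family ?P b) (int (card (UNIV :: 'v set)) - int p)"
    if n: "slice b ?X \<noteq> (\<lambda>\<sigma>. 0)" for b
  proof (cases "\<exists>v. 1 \<le> b v")
    case True
    then obtain v where v: "1 \<le> b v" by blast
    show ?thesis
    proof (rule cohomology_cone_zero[of v])
      fix \<sigma> assume s: "insert v \<sigma> \<in> koszul_family ?P b"
      have i: "\<forall>w. 0 \<le> face_exponent b (insert v \<sigma>) w" using s unfolding mem_koszul_family .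
      have "0 \<le> face_exponent b \<sigma> w" for w using i[rule_format, of w] v by (cases "w = v") auto
      then show "\<sigma> \<in> koszul_family ?P b" unfolding mem_koszul_family by (intro allI)
    qed
  next
    case False
    obtain \<sigma> where s: "slice b ?X \<sigma> \<noteq> 0" using n by auto
    have le: "b v \<le> 0" for v using False by (metis int_one_le_iff_zero_less not_less)
    have "v \<in> \<sigma> \<and> b v = 0" for v
      using slice_nonzeroD(1)[OF s, of v] le[of v] by (auto split: if_splits)
    then have "\<sigma> = UNIV" "b = (\<lambda>v. 0)" by auto
    moreover have "\<sigma> \<in> faces p" using slice_nonzeroD(2)[OF s] face_function_supported[of \<sigma> p x] by force
    ultimately have False using aug s by (simp add: faces_def)
    then show ?thesis ..
  qed
  ultimately show ?thesis
    using koszul_boundary_vec[OF x cyc, of "koszul_family ?P"] unfolding mem_koszul_family by blast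
qed

theorem koszul_resolution: "graded_free_resolution (koszul :: ('v::finite, 'k::field) free_complex)"
proof -
  let ?K = "koszul :: ('v, 'k) free_complex"
  let ?N = "\<lambda>p. card (faces p :: 'v set set)"
  have dc: "diff ?K p \<in> carrier_mat (?N p) (?N (Suc p))" for p by (rule koszul_diff_carrier)
  have dh: "diff ?K p $$ (a, b) \<in> homogeneous (int (Suc p) - int p)" if "a < ?N p" "b < ?N (Suc p)" for p a b
  proof -
    have "(\<Sum>v\<in>(nth_face p a :: 'v set). if nth_face p a - {v} = nth_face (Suc p) b then face_sign v (nth_face p a) * var v else 0)
      \<in> (homogeneous 1 :: ('v, 'k) mpoly set)"
      by (rule homogeneous_sum) (auto intro: face_sign_mult_homogeneous var_homogeneous)
    then show ?thesis using that by (simp add: koszul_def)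
  qed
  have surj: "augmentation ?K ` carrier_vec (?N 0) = UNIV"
  proof -
    have "c \<in> augmentation ?K ` carrier_vec (?N 0)" for c
    proof -
      define X :: "'v set \<Rightarrow> ('v, 'k) mpoly" where "X = (\<lambda>\<sigma>. if \<sigma> = UNIV then Poly_Mapping.single 0 c else 0)"
      have "face_function 0 (face_vec 0 X) = X" by (rule face_function_vec) (auto simp: X_def faces_zero)
      moreover have "monomial_of (\<lambda>v::'v. 0) = 0" by (rule poly_mapping_eqI) simp
      ultimately have "augmentation ?K (face_vec 0 X) = c"
        unfolding koszul_augmentation[OF face_vec_carrier] by (simp add: slice_def X_def)
      then show ?thesis by (metis face_vec_carrier image_eqI)
    qed
    then show ?thesis by blast
  qed
  have dd: "koszul_diff (koszul_diff X) = (\<lambda>\<sigma>. 0)" for X :: "'v set \<Rightarrow> ('v, 'k) mpoly"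
    by (rule slice_eqI) (auto simp: slice_koszul_diff coboundary_coboundary slice_def fun_eq_iff)
  have dv: "diff ?K p *\<^sub>v y \<in> carrier_vec (?N p)" if "y \<in> carrier_vec (?N (Suc p))" for p y
    using mult_mat_vec_carrier[OF dc that] .
  have ex0: "{x \<in> carrier_vec (?N 0). augmentation ?K x = 0} = (\<lambda>y. diff ?K 0 *\<^sub>v y) ` carrier_vec (?N (Suc 0))"
  proof (intro equalityI subsetI)
    fix x assume "x \<in> {x \<in> carrier_vec (?N 0). augmentation ?K x = 0}"
    then have x: "x \<in> carrier_vec (?N 0)" "augmentation ?K x = 0" by auto
    have "koszul_diff (face_function 0 x) = (\<lambda>\<sigma>. 0)" using koszul_cycle_iff[OF x(1)] by blast
    then show "x \<in> (\<lambda>y. diff ?K 0 *\<^sub>v y) ` carrier_vec (?N (Suc 0))"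
      using koszul_exact[OF x(1)] x(2) koszul_augmentation[OF x(1)] by auto
  next
    fix x assume "x \<in> (\<lambda>y. diff ?K 0 *\<^sub>v y) ` carrier_vec (?N (Suc 0))"
    then obtain y where y: "y \<in> carrier_vec (?N (Suc 0))" "x = diff ?K 0 *\<^sub>v y" by auto
    have "augmentation ?K x = coboundary (slice (\<lambda>v. 0) (face_function (Suc 0) y)) UNIV"
      unfolding y(2) koszul_augmentation[OF dv[OF y(1)]] face_function_diff[OF y(1)] slice_koszul_diff ..
    also have "\<dots> = 0"
      unfolding coboundary_def by (rule sum.neutral) (auto simp: slice_def)
    finally show "x \<in> {x \<in> carrier_vec (?N 0). augmentation ?K x = 0}" using dv y by auto
  qed
  have ex: "{x \<in> carrier_vec (?N (Suc p)). diff ?K p *\<^sub>v x = 0\<^sub>v (?N p)}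
       = (\<lambda>y. diff ?K (Suc p) *\<^sub>v y) ` carrier_vec (?N (Suc (Suc p)))" for p
  proof (intro equalityI subsetI)
    fix x assume "x \<in> {x \<in> carrier_vec (?N (Suc p)). diff ?K p *\<^sub>v x = 0\<^sub>v (?N p)}"
    then have x: "x \<in> carrier_vec (?N (Suc p))" "diff ?K p *\<^sub>v x = 0\<^sub>v (?N p)" by auto
    have "koszul_diff (face_function (Suc p) x) = (\<lambda>\<sigma>. 0)" using koszul_cycle_iff[OF x(1)] x(2) by blast
    then show "x \<in> (\<lambda>y. diff ?K (Suc p) *\<^sub>v y) ` carrier_vec (?N (Suc (Suc p)))"
      using koszul_exact[OF x(1)] by auto
  next
    fix x assume "x \<in> (\<lambda>y. diff ?K (Suc p) *\<^sub>v y) ` carrier_vec (?N (Suc (Suc p)))"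
    then obtain y where y: "y \<in> carrier_vec (?N (Suc (Suc p)))" "x = diff ?K (Suc p) *\<^sub>v y" by auto
    have "koszul_diff (face_function (Suc p) x) = (\<lambda>\<sigma>. 0)"
      unfolding y(2) face_function_diff[OF y(1)] dd ..
    then show "x \<in> {x \<in> carrier_vec (?N (Suc p)). diff ?K p *\<^sub>v x = 0\<^sub>v (?N p)}"
      using koszul_cycle_iff[OF dv[OF y(1)]] dv[OF y(1)] y(2) by simp
  qed
  show ?thesis
    unfolding graded_free_resolution_def koszul_simps
    using dc dh surj ex0 ex by (auto simp: koszul_def)
qed

section \<open>Tor and regularity of monomial ideals\<close>

lemma exponent_of_add: "exponent_of (m + m') v = exponent_of m v + exponent_of m' v"
  by (simp add: exponent_of_def lookup_add)

lemma monomial_ideal_ring_ideal: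
  fixes P :: "('v::finite \<Rightarrow> int) \<Rightarrow> bool"
  assumes "\<And>e f. P e \<Longrightarrow> (\<And>v. e v \<le> f v) \<Longrightarrow> P f"
  shows "ring_ideal (monomial_ideal P :: ('v, 'k::field) mpoly set)"
  unfolding ring_ideal_def
proof (intro conjI ballI allI)
  show "0 \<in> (monomial_ideal P :: ('v, 'k) mpoly set)" by (simp add: monomial_ideal_def)
  show "a + b \<in> monomial_ideal P" if "a \<in> monomial_ideal P" "b \<in> monomial_ideal P" for a b :: "('v, 'k) mpoly"
    using that keys_add[of a b] by (auto simp: monomial_ideal_def)
  show "r * a \<in> monomial_ideal P" if a: "a \<in> monomial_ideal P" for r a :: "('v, 'k) mpoly"
    unfolding monomial_ideal_def
  proof (intro CollectI ballI)
    fix m assume "m \<in> Poly_Mapping.keys (r * a)"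
    then obtain k l where m: "m = k + l" "l \<in> Poly_Mapping.keys a" using keys_mult[of r a] by auto
    then have "P (exponent_of l)" using a by (simp add: monomial_ideal_def)
    then show "P (exponent_of m)" by (rule assms) (simp add: m(1) exponent_of_add)
  qed
qed

interpretation mpoly_module: Modules.module "(*) :: 'a::comm_ring_1 \<Rightarrow> 'a \<Rightarrow> 'a"
  by unfold_locales (simp_all add: algebra_simps)

lemma ideal_span_eq_monomial_ideal:
  fixes P :: "('v::finite \<Rightarrow> int) \<Rightarrow> bool" and S :: "('v, 'k::field) mpoly set"
  assumes mono: "\<And>e f. P e \<Longrightarrow> (\<And>v. e v \<le> f v) \<Longrightarrow> P f"
    and sub: "S \<subseteq> monomial_ideal P"
    and gen: "\<And>m. P (exponent_of m) \<Longrightarrow> \<exists>g\<in>S. \<exists>r. Poly_Mapping.single m 1 = r * g"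
  shows "ideal_span S = monomial_ideal P"
proof
  have "mpoly_module.subspace (monomial_ideal P :: ('v, 'k) mpoly set)"
  proof -
    have "ring_ideal (monomial_ideal P :: ('v, 'k) mpoly set)"
      by (rule monomial_ideal_ring_ideal) (fact mono)
    then show ?thesis unfolding mpoly_module.subspace_def ring_ideal_def .
  qed
  then show "ideal_span S \<subseteq> monomial_ideal P"
    unfolding ideal_span_def using mpoly_module.span_minimal[OF sub] by blast
  show "monomial_ideal P \<subseteq> ideal_span S"
  proof
    fix p :: "('v, 'k) mpoly" assume p: "p \<in> monomial_ideal P"
    have "Poly_Mapping.single k (Poly_Mapping.lookup p k) \<in> ideal_span S" if "k \<in> Poly_Mapping.keys p" for k
    proof -
      have "P (exponent_of k)" using p that unfolding monomial_ideal_def by blast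
      from gen[OF this] obtain g r where g: "g \<in> S" "Poly_Mapping.single k 1 = r * g" by blast
      have "Poly_Mapping.single k (Poly_Mapping.lookup p k) = Poly_Mapping.single 0 (Poly_Mapping.lookup p k) * Poly_Mapping.single k 1"
        by (simp add: mult_single)
      also have "\<dots> = (Poly_Mapping.single 0 (Poly_Mapping.lookup p k) * r) * g" unfolding g(2) by (rule mult.assoc[symmetric])
      also have "\<dots> \<in> ideal_span S"
        unfolding ideal_span_def by (rule mpoly_module.span_scale[OF mpoly_module.span_base[OF g(1)]])
      finally show ?thesis .
    qed
    then have "(\<Sum>k\<in>Poly_Mapping.keys p. Poly_Mapping.single k (Poly_Mapping.lookup p k)) \<in> ideal_span S"
      unfolding ideal_span_def by (rule mpoly_module.span_sum)
    then show "p \<in> ideal_span S" by (simp add: poly_mapping_sum_single)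
  qed
qed

lemma single_edge_factor:
  fixes m :: "'v::finite \<Rightarrow>\<^sub>0 nat"
  assumes "\<And>v. 0 \<le> exponent_of m v - unit_exponent i v - unit_exponent j v"
  shows "Poly_Mapping.single m (1 :: 'k::field) = var i * var j *
    Poly_Mapping.single (monomial_of (\<lambda>v. exponent_of m v - unit_exponent i v - unit_exponent j v)) 1"
proof -
  have "m = Poly_Mapping.single i 1 + Poly_Mapping.single j 1 +
    monomial_of (\<lambda>v. exponent_of m v - unit_exponent i v - unit_exponent j v)"
  proof (rule poly_mapping_eqI)
    fix v
    show "Poly_Mapping.lookup m v = Poly_Mapping.lookup (Poly_Mapping.single i 1 + Poly_Mapping.single j 1 +
      monomial_of (\<lambda>v. exponent_of m v - unit_exponent i v - unit_exponent j v)) v"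
      using assms[of v] by (auto simp: lookup_add lookup_single when_def exponent_of_def nat_diff_distrib)
  qed
  then show ?thesis by (simp add: var_def mult_single)
qed

lemma edge_ideal_eq: "(edge_ideal E :: ('v::finite, 'k::field) mpoly set) = monomial_ideal (power_exponent E 1)"
  unfolding edge_ideal_def
proof (rule ideal_span_eq_monomial_ideal)
  show "{var i * var j |i j. {i, j} \<in> E} \<subseteq> (monomial_ideal (power_exponent E 1) :: ('v, 'k) mpoly set)"
  proof
    fix x :: "('v, 'k) mpoly" assume "x \<in> {var i * var j |i j. {i, j} \<in> E}"
    then obtain i j where ij: "{i, j} \<in> E" "x = var i * var j" by blast
    have "power_exponent E 1 (exponent_of (Poly_Mapping.single i 1 + Poly_Mapping.single j 1))"
      unfolding One_nat_def power_exponent.simps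
      by (intro exI[of _ i] exI[of _ j] conjI allI)
         (simp_all add: ij(1) exponent_of_def lookup_add lookup_single when_def)
    then show "x \<in> monomial_ideal (power_exponent E 1)"
      by (simp add: ij(2) var_def mult_single monomial_ideal_def del: power_exponent.simps)
  qed
  fix m :: "'v \<Rightarrow>\<^sub>0 nat" assume "power_exponent E 1 (exponent_of m)"
  then obtain i j where ij: "{i, j} \<in> E" "\<And>v. 0 \<le> exponent_of m v - unit_exponent i v - unit_exponent j v"
    by auto
  have "Poly_Mapping.single m 1 = Poly_Mapping.single (monomial_of (\<lambda>v. exponent_of m v - unit_exponent i v - unit_exponent j v)) 1
      * (var i * var j :: ('v, 'k) mpoly)"
    unfolding single_edge_factor[OF ij(2)] by (rule mult.commute)
  then show "\<exists>g\<in>{var i * var j |i j. {i, j} \<in> E}. \<exists>r. Poly_Mapping.single m 1 = r * (g :: ('v, 'k) mpoly)"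
    using ij(1) by blast
qed (rule power_exponent_mono)

lemma ideal_power_eq:
  "ideal_power (edge_ideal E :: ('v::finite, 'k::field) mpoly set) s = monomial_ideal (power_exponent E s)"
proof (induction s)
  case 0
  then show ?case by (simp add: monomial_ideal_def)
next
  case (Suc s)
  show ?case
    unfolding ideal_power.simps Suc.IH
  proof (rule ideal_span_eq_monomial_ideal)
    show "{a * b |a b. a \<in> edge_ideal E \<and> b \<in> monomial_ideal (power_exponent E s)} \<subseteq>
      (monomial_ideal (power_exponent E (Suc s)) :: ('v, 'k) mpoly set)"
    proof
      fix x :: "('v, 'k) mpoly"
      assume "x \<in> {a * b |a b. a \<in> edge_ideal E \<and> b \<in> monomial_ideal (power_exponent E s)}"
      then obtain a b where ab: "a \<in> monomial_ideal (power_exponent E 1)" "b \<in> monomial_ideal (power_exponent E s)" "x = a * b"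
        unfolding edge_ideal_eq by blast
      have "power_exponent E (Suc s) (exponent_of m)" if mx: "m \<in> Poly_Mapping.keys x" for m
      proof -
        obtain k l where m: "m = k + l" "k \<in> Poly_Mapping.keys a" "l \<in> Poly_Mapping.keys b"
          using mx keys_mult[of a b] unfolding ab(3) by blast
        have "power_exponent E 1 (exponent_of k)" "power_exponent E s (exponent_of l)"
          using m ab by (auto simp: monomial_ideal_def simp del: power_exponent.simps)
        then obtain i j where ij: "{i, j} \<in> E" "\<And>v. 0 \<le> exponent_of k v - unit_exponent i v - unit_exponent j v"
          and l: "power_exponent E s (exponent_of l)" by auto
        have "power_exponent E s (\<lambda>v. exponent_of m v - unit_exponent i v - unit_exponent j v)"
          by (rule power_exponent_mono[OF l]) (use ij(2) in \<open>simp add: m(1) exponent_of_add algebra_simps\<close>)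
        then show ?thesis using ij(1) by auto
      qed
      then show "x \<in> monomial_ideal (power_exponent E (Suc s))" by (simp add: monomial_ideal_def del: power_exponent.simps)
    qed
    fix m :: "'v \<Rightarrow>\<^sub>0 nat" assume "power_exponent E (Suc s) (exponent_of m)"
    then obtain i j where ij: "{i, j} \<in> E"
      "power_exponent E s (\<lambda>v. exponent_of m v - unit_exponent i v - unit_exponent j v)" by auto
    let ?e = "\<lambda>v. exponent_of m v - unit_exponent i v - unit_exponent j v"
    note nonneg = power_exponent_nonneg[OF ij(2)]
    have "power_exponent E s (exponent_of (monomial_of ?e))"
      unfolding exponent_of_monomial_of[OF nonneg] by (rule ij(2))
    then have b: "Poly_Mapping.single (monomial_of ?e) 1 \<in> (monomial_ideal (power_exponent E s) :: ('v, 'k) mpoly set)"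
      by (simp add: monomial_ideal_def)
    have a: "var i * var j \<in> (edge_ideal E :: ('v, 'k) mpoly set)"
      unfolding edge_ideal_def ideal_span_def by (rule mpoly_module.span_base) (use ij(1) in blast)
    have "Poly_Mapping.single m 1 = 1 * ((var i * var j) * Poly_Mapping.single (monomial_of ?e) 1 :: ('v, 'k) mpoly)"
      using single_edge_factor[OF nonneg, where 'k='k] by simp
    then show "\<exists>g\<in>{a * b |a b. a \<in> edge_ideal E \<and> b \<in> monomial_ideal (power_exponent E s)}.
        \<exists>r. Poly_Mapping.single m 1 = r * (g :: ('v, 'k) mpoly)"
      using a b by blast
  qed (rule power_exponent_mono)
qed

lemma tensor_component_zero: "ring_ideal M \<Longrightarrow> 0\<^sub>v (rank F p) \<in> tensor_component F M p j"
  by (simp add: tensor_component_def ring_ideal_def)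

lemma tensor_component_add:
  "ring_ideal M \<Longrightarrow> x \<in> tensor_component F M p j \<Longrightarrow> y \<in> tensor_component F M p j \<Longrightarrow> x + y \<in> tensor_component F M p j"
  by (auto simp: tensor_component_def ring_ideal_def intro!: homogeneous_add)

text \<open>Boundaries form a subgroup, so a coset is neutral iff its representative is a boundary.\<close>

lemma homology_nontrivial_iff:
  fixes F :: "('v::finite, 'k::field) free_complex"
  assumes F: "graded_resolution F" and M: "ring_ideal M"
  shows "carrier (homology_group F M i j) \<noteq> {\<one>\<^bsub>homology_group F M i j\<^esub>} \<longleftrightarrow>
    \<not> tensor_cycles F M i j \<subseteq> tensor_boundaries F M i j"
proof -
  interpret graded_resolution F by fact
  let ?Z = "tensor_cycles F M i j" and ?B = "tensor_boundaries F M i j"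
  let ?G = "\<lparr>carrier = ?Z, monoid.mult = (+), one = 0\<^sub>v (rank F i)\<rparr>"
  have carrier: "carrier (homology_group F M i j) = (\<lambda>x. (\<lambda>b. b + x) ` ?B) ` ?Z"
    by (auto simp: homology_group_def FactGroup_def RCOSETS_def r_coset_def)
  have one: "\<one>\<^bsub>homology_group F M i j\<^esub> = ?B" by (simp add: homology_group_def FactGroup_def)
  have B: "b \<in> carrier_vec (rank F i)" if "b \<in> ?B" for b
    using that diff_vec[OF tensor_component_carrier] unfolding tensor_boundaries_def by blast
  have Z: "x \<in> carrier_vec (rank F i)" if "x \<in> ?Z" for x
    using that tensor_component_carrier by (auto simp: tensor_cycles_def)
  have B0: "0\<^sub>v (rank F i) \<in> ?B"
    unfolding tensor_boundaries_def
    by (rule image_eqI[OF _ tensor_component_zero[OF M]]) (simp add: mult_mat_vec_zero[OF diff_carrier])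
  have Badd: "a + b \<in> ?B" and Bdiff: "a - b \<in> ?B" if ab: "a \<in> ?B" "b \<in> ?B" for a b
  proof -
    obtain x y where xy: "x \<in> tensor_component F M (Suc i) j" "a = diff F i *\<^sub>v x"
      "y \<in> tensor_component F M (Suc i) j" "b = diff F i *\<^sub>v y"
      using ab by (auto simp: tensor_boundaries_def)
    note c = tensor_component_carrier[OF xy(1)] tensor_component_carrier[OF xy(3)]
    have "a + b = diff F i *\<^sub>v (x + y)" "a - b = diff F i *\<^sub>v (x - y)"
      using mult_add_distrib_mat_vec[OF diff_carrier c] mult_minus_distrib_mat_vec[OF diff_carrier c] xy by simp_all
    then show "a + b \<in> ?B" "a - b \<in> ?B"
      unfolding tensor_boundaries_def
      using tensor_component_add[OF M xy(1,3)] tensor_component_diff[OF M xy(1,3)] by blast+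
  qed
  have coset: "(\<lambda>b. b + x) ` ?B = ?B \<longleftrightarrow> x \<in> ?B" if x: "x \<in> ?Z" for x
  proof
    assume "(\<lambda>b. b + x) ` ?B = ?B"
    moreover have "0\<^sub>v (rank F i) + x \<in> (\<lambda>b. b + x) ` ?B" using B0 by blast
    ultimately show "x \<in> ?B" using Z[OF x] by simp
  next
    assume xB: "x \<in> ?B"
    have "b \<in> (\<lambda>b. b + x) ` ?B" if b: "b \<in> ?B" for b
    proof (rule image_eqI[OF _ Bdiff[OF b xB]])
      show "b = b - x + x" using B[OF b] Z[OF x] by auto
    qed
    then show "(\<lambda>b. b + x) ` ?B = ?B" using Badd[OF _ xB] by blast
  qed
  have Z0: "0\<^sub>v (rank F i) \<in> ?Z"
    unfolding tensor_cycles_def using tensor_component_zero[OF M, of F i j] mult_mat_vec_zero[OF diff_carrier] by auto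
  show ?thesis
  proof
    assume ne: "carrier (homology_group F M i j) \<noteq> {\<one>\<^bsub>homology_group F M i j\<^esub>}"
    show "\<not> ?Z \<subseteq> ?B"
    proof
      assume "?Z \<subseteq> ?B"
      then have "(\<lambda>x. (\<lambda>b. b + x) ` ?B) ` ?Z = (\<lambda>x. ?B) ` ?Z"
        by (intro image_cong refl) (use coset in blast)
      then have "carrier (homology_group F M i j) = {?B}" using Z0 unfolding carrier by auto
      then show False using ne one by simp
    qed
  next
    assume "\<not> ?Z \<subseteq> ?B"
    then obtain x where x: "x \<in> ?Z" "x \<notin> ?B" by blast
    have "(\<lambda>b. b + x) ` ?B \<in> carrier (homology_group F M i j)"
      unfolding carrier using x(1) by (rule imageI)
    moreover have "(\<lambda>b. b + x) ` ?B \<noteq> ?B" using coset[OF x(1)] x(2) by simp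
    ultimately show "carrier (homology_group F M i j) \<noteq> {\<one>\<^bsub>homology_group F M i j\<^esub>}"
      unfolding one by (metis singletonD)
  qed
qed

text \<open>The fixed resolution in the definition of \<open>Tor\<close> is replaced by the Koszul complex.\<close>

theorem Tor_monomial_ideal_nontrivial_iff:
  fixes P :: "('v::finite \<Rightarrow> int) \<Rightarrow> bool"
  assumes P: "\<And>e v. P e \<Longrightarrow> 0 \<le> e v" and mono: "\<And>e f. P e \<Longrightarrow> (\<And>v. e v \<le> f v) \<Longrightarrow> P f"
  shows "carrier (Tor (monomial_ideal P :: ('v, 'k::field) mpoly set) i j)
      \<noteq> {\<one>\<^bsub>Tor (monomial_ideal P :: ('v, 'k) mpoly set) i j\<^esub>} \<longleftrightarrow>
    (\<exists>b. (\<Sum>v\<in>UNIV. b v) = j \<and>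
      cohomology_nonzero TYPE('k) (koszul_family P b) (int (card (UNIV :: 'v set)) - int i))"
proof -
  let ?M = "monomial_ideal P :: ('v, 'k) mpoly set"
  have M: "ring_ideal ?M" by (rule monomial_ideal_ring_ideal) (fact mono)
  have "graded_free_resolution (residue_resolution :: ('v, 'k) free_complex)"
    unfolding residue_resolution_def by (rule someI[of graded_free_resolution, OF koszul_resolution])
  then have R: "graded_resolution (residue_resolution :: ('v, 'k) free_complex)" by (rule graded_resolution.intro)
  have K: "graded_resolution (koszul :: ('v, 'k) free_complex)" by (rule graded_resolution.intro[OF koszul_resolution])
  have "tensor_cycles residue_resolution ?M i j \<subseteq> tensor_boundaries residue_resolution ?M i j
    \<longleftrightarrow> tensor_cycles koszul ?M i j \<subseteq> tensor_boundaries koszul ?M i j"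
    using tensor_homology_vanishes_transfer[OF R K M] tensor_homology_vanishes_transfer[OF K R M] by blast
  then show ?thesis
    unfolding Tor_def homology_nontrivial_iff[OF R M] using koszul_homology_vanishes_iff[of P i j, where 'k='k] P by auto
qed

lemma cohomology_nonzero_degree:
  assumes "cohomology_nonzero (K :: 'k::field itself) (S :: 'v::finite set set) m"
  obtains p where "m = int (card (UNIV :: 'v set)) - int p"
proof -
  obtain \<sigma> where "\<sigma> \<in> S" "m = int (card \<sigma>)" using cohomology_nonzero_face[OF assms] .
  moreover have "card \<sigma> \<le> card (UNIV :: 'v set)" by (simp add: card_mono)
  ultimately have "m = int (card (UNIV :: 'v set)) - int (card (UNIV :: 'v set) - card \<sigma>)" by simp
  then show ?thesis by (rule that)
qed

lemma reg_eq_Sup_cube_values: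
  fixes P :: "('v::finite \<Rightarrow> int) \<Rightarrow> bool"
  assumes P: "\<And>e v. P e \<Longrightarrow> 0 \<le> e v" and mono: "\<And>e f. P e \<Longrightarrow> (\<And>v. e v \<le> f v) \<Longrightarrow> P f"
  shows "reg (monomial_ideal P :: ('v, 'k::field) mpoly set)
    = Sup ((\<lambda>r. ereal (real_of_int r)) ` cube_values TYPE('k) P 0 {})"
proof -
  let ?n = "int (card (UNIV :: 'v set))"
  have Tor: "carrier (Tor (monomial_ideal P :: ('v, 'k) mpoly set) i j)
      \<noteq> {\<one>\<^bsub>Tor (monomial_ideal P :: ('v, 'k) mpoly set) i j\<^esub>} \<longleftrightarrow>
    (\<exists>b. (\<Sum>v\<in>UNIV. b v) = j \<and> cohomology_nonzero TYPE('k) (koszul_family P b) (?n - int i))" for i j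
    by (rule Tor_monomial_ideal_nontrivial_iff) (fact P, fact mono)
  have "(\<exists>i j. r = j - int i \<and> carrier (Tor (monomial_ideal P :: ('v, 'k) mpoly set) i j)
      \<noteq> {\<one>\<^bsub>Tor (monomial_ideal P :: ('v, 'k) mpoly set) i j\<^esub>}) \<longleftrightarrow> r \<in> cube_values TYPE('k) P 0 {}"
    (is "?L \<longleftrightarrow> _") for r
  proof
    assume ?L
    then obtain i b where b: "r = (\<Sum>v\<in>UNIV. b v) - int i" "cohomology_nonzero TYPE('k) (koszul_family P b) (?n - int i)"
      unfolding Tor by blast
    have "r = (\<Sum>v\<in>UNIV. b v - 1) + (?n - int i)" using b(1) by (simp add: sum_subtractf)
    moreover have "cohomology_nonzero TYPE('k) (cube_family P (\<lambda>v. b v - 1) (\<lambda>v. if v \<in> {} then 0 else b v - 1 + 1)) (?n - int i)"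
      using b(2) by (simp add: koszul_family_def)
    ultimately show "r \<in> cube_values TYPE('k) P 0 {}" unfolding cube_values_def by blast
  next
    assume "r \<in> cube_values TYPE('k) P 0 {}"
    then obtain lo m where lo: "r = (\<Sum>v\<in>UNIV. lo v) + m" "cohomology_nonzero TYPE('k) (cube_family P lo (\<lambda>v. lo v + 1)) m"
      unfolding cube_values_def by auto
    obtain i where i: "m = ?n - int i" using cohomology_nonzero_degree[OF lo(2)] .
    define b where "b = (\<lambda>v. lo v + 1)"
    have "r = (\<Sum>v\<in>UNIV. b v) - int i" using lo(1) i by (simp add: b_def sum.distrib)
    moreover have "cohomology_nonzero TYPE('k) (koszul_family P b) (?n - int i)"
      using lo(2) i by (simp add: koszul_family_def b_def)
    ultimately show ?L unfolding Tor by blast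
  qed
  then have value_set: "{r. \<exists>i j. r = j - int i \<and> carrier (Tor (monomial_ideal P :: ('v, 'k) mpoly set) i j)
      \<noteq> {\<one>\<^bsub>Tor (monomial_ideal P :: ('v, 'k) mpoly set) i j\<^esub>}} = cube_values TYPE('k) P 0 {}"
    by (rule Collect_eqI[of _ "\<lambda>r. r \<in> cube_values TYPE('k) P 0 {}", unfolded Collect_mem_eq])
  have image: "{g (f i j) |i j. C i j} = g ` {r. \<exists>i j. r = f i j \<and> C i j}"
    for g :: "int \<Rightarrow> ereal" and f :: "nat \<Rightarrow> int \<Rightarrow> int" and C by blast
  show ?thesis unfolding reg_def image[of "\<lambda>r. ereal (real_of_int r)" "\<lambda>i j. j - int i"] value_set ..
qed

lemma int_set_has_max:
  fixes A :: "int set"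
  assumes "A \<noteq> {}" "\<forall>a\<in>A. a \<le> B"
  obtains r where "r \<in> A" "\<forall>a\<in>A. a \<le> r"
proof -
  have ne: "\<exists>n. B - int n \<in> A"
  proof -
    obtain a where a: "a \<in> A" using assms(1) by blast
    then have "B - int (nat (B - a)) \<in> A" using assms(2) by simp
    then show ?thesis ..
  qed
  define n where "n = (LEAST n. B - int n \<in> A)"
  have "B - int n \<in> A" unfolding n_def using ne by (rule LeastI_ex)
  moreover have "a \<le> B - int n" if a: "a \<in> A" for a
  proof -
    have "B - int (nat (B - a)) \<in> A" using a assms(2) by simp
    then have "n \<le> nat (B - a)" unfolding n_def by (rule Least_le)
    moreover have "a \<le> B" using a assms(2) by blast
    ultimately show ?thesis by linarith
  qed
  ultimately show ?thesis using that by blast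
qed

text \<open>The regularity of the \<open>s\<close>-th power is attained, since the values are integers bounded above;
  the next power has a larger value.\<close>

lemma (in join_graph) reg_power_less:
  "reg (ideal_power (edge_ideal E :: ('v, 'k::field) mpoly set) s)
    < reg (ideal_power (edge_ideal E :: ('v, 'k) mpoly set) (Suc s))"
proof -
  let ?V = "\<lambda>s. koszul_values TYPE('k) s"
  have reg: "reg (ideal_power (edge_ideal E :: ('v, 'k) mpoly set) s) = Sup ((\<lambda>r. ereal (real_of_int r)) ` ?V s)" for s
    unfolding ideal_power_eq
    by (rule reg_eq_Sup_cube_values) (fact power_exponent_nonneg, fact power_exponent_mono)
  obtain B where B: "\<forall>r\<in>?V s. r \<le> B" using koszul_values_bounded by blast
  have "?V s \<noteq> {}" using generator_value by blast
  then obtain r where r: "r \<in> ?V s" "\<forall>a\<in>?V s. a \<le> r" by (rule int_set_has_max[OF _ B])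
  obtain r' where r': "r' \<in> ?V (Suc s)" "r < r'" using koszul_step[OF r(1)] by blast
  have "Sup ((\<lambda>r. ereal (real_of_int r)) ` ?V s) \<le> ereal (real_of_int r)"
    by (rule Sup_least) (use r(2) in auto)
  also have "\<dots> < ereal (real_of_int r')" using r'(2) by simp
  also have "\<dots> \<le> Sup ((\<lambda>r. ereal (real_of_int r)) ` ?V (Suc s))"
    by (rule Sup_upper) (use r'(1) in blast)
  finally show ?thesis unfolding reg .
qed

theorem theorem1p8:
  fixes E :: "'v::finite set set" and V1 V2 :: "'v set"
  assumes "\<And>e. e \<in> E \<Longrightarrow> card e = 2"
    and "V1 \<union> V2 = UNIV" and "V1 \<inter> V2 = {}" and "V1 \<noteq> {}" and "V2 \<noteq> {}"
    and "\<And>u v. u \<in> V1 \<Longrightarrow> v \<in> V2 \<Longrightarrow> {u, v} \<in> E"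
  shows "strict_mono_on {1..}
    (\<lambda>s. reg (ideal_power (edge_ideal E :: ('v, 'k::field) mpoly set) s))"
proof -
  interpret join_graph E V1 V2 by unfold_locales (use assms in auto)
  have "strict_mono (\<lambda>s. reg (ideal_power (edge_ideal E :: ('v, 'k) mpoly set) s))"
    unfolding strict_mono_Suc_iff by (intro allI reg_power_less)
  then show ?thesis by (auto simp: strict_mono_on_def strict_mono_def)
qed

end
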